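(* Let $1\le r\le n-1$. The quasisymmetric Grassmannian $\mathrm{QGr}(r;n)$ is an equidimensional complex of $(n-1)$-dimensional toric varieties: it is a finite union of closures of $(n-1)$-dimensional $T$-orbits in $\mathrm{Gr}(r;n)$, where $T=(\mathbb C^* )^n$.
   Context: $\mathrm{Gr}(r;n)$ is the Grassmannian of $r$-planes in $\mathbb C^n$, with $T$ acting by scaling coordinates. $[n]=\{1,\dots,n\}$. $\mathrm{NC}_n\subset S_n$ is the set of permutations obtained from noncrossing set partitions of $[n]$ by turning each block $\{b_1<\cdots<b_s\}$ into the cycle $(b_s\,b_{s-1}\,\cdots\,b_1)$ (so $b_s\mapsto b_{s-1}\mapsto\cdots\mapsto b_1\mapsto b_s$) and multiplying these cycles. For $w\in \mathrm{NC}_n$, $\mathrm{Inv}_{\mathrm{NC}}(w)=\{(i,j)\mid i<j,\ w^{-1}(i)>w^{-1}(j),\ (i\,j)w\in\mathrm{NC}_n\}$. $\mathrm{Fl}_n=\mathrm{GL}_n(\mathbb C)/B$ ($B$ upper triangular); $MB$ corresponds to the flag with $V_i$ the span of the first $i$ columns of $M$. For $w\in\mathrm{NC}_n$, $\mathring X^w_{\mathrm{NC}}\subset \mathrm{Fl}_n$ is the set of flags represented by matrices with entry $1$ in positions $(w(j),j)$, arbitrary complex entries in positions $(i,w^{-1}(j))$ for $(i,j)\in\mathrm{Inv}_{\mathrm{NC}}(w)$, and $0$ elsewhere. The quasisymmetric flag variety is the (closed, $T$-invariant) subvariety $\mathrm{QFl}_n=\bigsqcup_{w\in\mathrm{NC}_n}\mathring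 X^w_{\mathrm{NC}}$. With $\pi:\mathrm{Fl}_n\to\mathrm{Gr}(r;n)$, $V_\bullet\mapsto V_r$, the quasisymmetric Grassmannian is $\mathrm{QGr}(r;n):=\pi(\mathrm{QFl}_n)$. *)

theory Defs
  imports "HOL-Analysis.Analysis" "HOL-Combinatorics.Cycles" "HOL-Library.Disjoint_Sets"
    "HOL-Library.Extended_Nat"
begin

text \<open>
  The index set \<open>[n]\<close> is the universe of a type \<open>'n::{finite,wellorder}\<close>, with \<open>n = CARD('n)\<close>;
  \<open>\<complex>\<^sup>n\<close> is \<^typ>\<open>complex ^ 'n\<close>, and \<open>M $ i $ j\<close> is the entry of \<open>M\<close> in row \<open>i\<close> and column \<open>j\<close>.
\<close>

subsection \<open>Noncrossing permutations\<close>

definition noncrossing :: "'n::linorder set set \<Rightarrow> bool" where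
  "noncrossing P \<longleftrightarrow>
     \<not> (\<exists>A\<in>P. \<exists>B\<in>P. A \<noteq> B \<and> (\<exists>a\<in>A. \<exists>b\<in>B. \<exists>c\<in>A. \<exists>d\<in>B. a < b \<and> b < c \<and> c < d))"

text \<open>
  \<^const>\<open>cycle_of_list\<close> sends each list entry to the next one, so a block
  \<open>b\<^sub>1 < \<dots> < b\<^sub>s\<close> has to be listed in decreasing order to get
  \<open>b\<^sub>s \<mapsto> b\<^sub>s\<^sub>-\<^sub>1 \<mapsto> \<dots> \<mapsto> b\<^sub>1 \<mapsto> b\<^sub>s\<close>.
\<close>

definition block_cycle :: "'n::linorder set \<Rightarrow> 'n \<Rightarrow> 'n" where
  "block_cycle A = cycle_of_list (rev (sorted_list_of_set A))"

text \<open>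
  The list \<open>Bs\<close> enumerates the blocks; the cycles are disjoint, so the order of the factors is
  immaterial.
\<close>

definition NC :: "('n::{finite,wellorder} \<Rightarrow> 'n) set" where
  "NC = {foldr (\<circ>) (map block_cycle Bs) id | Bs.
           distinct Bs \<and> partition_on UNIV (set Bs) \<and> noncrossing (set Bs)}"

definition Inv_NC :: "('n::{finite,wellorder} \<Rightarrow> 'n) \<Rightarrow> ('n \<times> 'n) set" where
  "Inv_NC w = {(i, j). i < j \<and> inv w i > inv w j \<and> Transposition.transpose i j \<circ> w \<in> NC}"

subsection \<open>Flags and the quasisymmetric flag variety\<close>

text \<open>
  A flag is the sequence \<open>i \<mapsto> V\<^sub>i\<close> of its subspaces; \<open>flag_of M\<close> is the flag of the coset \<open>MB\<close>.
  The \<open>j\<close>-th column is among the first \<open>i\<close> ones iff at most \<open>i\<close> indices are \<open>\<le> j\<close>.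
\<close>

definition flag_of ::
    "complex ^ 'n::{finite,wellorder} ^ 'n::{finite,wellorder} \<Rightarrow> nat \<Rightarrow> (complex ^ 'n::{finite,wellorder}) set" where
  "flag_of M i = vec.span {column j M | j. card {..j} \<le> i}"

text \<open>
  Position \<open>(i, w\<^sup>-\<^sup>1(j))\<close> with \<open>(i, j) \<in> Inv_NC w\<close> is written below as position \<open>(i, c)\<close> with
  \<open>(i, w c) \<in> Inv_NC w\<close>.
\<close>

definition NC_cell_matrices ::
    "('n::{finite,wellorder} \<Rightarrow> 'n) \<Rightarrow> (complex ^ 'n::{finite,wellorder} ^ 'n::{finite,wellorder}) set" where
  "NC_cell_matrices w =
     {M. (\<forall>c. M $ w c $ c = 1) \<and>
         (\<forall>i c. i \<noteq> w c \<and> (i, w c) \<notin> Inv_NC w \<longrightarrow> M $ i $ c = 0)}"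

definition NC_cell ::
    "('n::{finite,wellorder} \<Rightarrow> 'n) \<Rightarrow> (nat \<Rightarrow> (complex ^ 'n::{finite,wellorder}) set) set" where
  "NC_cell w = flag_of ` NC_cell_matrices w"

definition QFl :: "(nat \<Rightarrow> (complex ^ 'n::{finite,wellorder}) set) set" where
  "QFl = (\<Union>w\<in>NC. NC_cell w)"

definition Gr :: "nat \<Rightarrow> (complex ^ 'n) set set" where
  "Gr r = {V. vec.subspace V \<and> vec.dim V = r}"

definition QGr :: "nat \<Rightarrow> (complex ^ 'n::{finite,wellorder}) set set" where
  "QGr r = (\<lambda>F. F r) ` QFl"

subsection \<open>The torus action\<close>

definition torus :: "(complex ^ 'n) set" where
  "torus = {t. \<forall>i. t $ i \<noteq> 0}"

definition torus_act :: "complex ^ 'n \<Rightarrow> (complex ^ 'n) set \<Rightarrow> (complex ^ 'n) set" where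
  "torus_act t V = (\<lambda>v. \<chi> i. t $ i * v $ i) ` V"

definition torus_orbit :: "(complex ^ 'n) set \<Rightarrow> (complex ^ 'n) set set" where
  "torus_orbit V = (\<lambda>t. torus_act t V) ` torus"

subsection \<open>The Zariski topology\<close>

inductive mat_polynomial :: "(complex ^ 'n ^ 'm \<Rightarrow> complex) \<Rightarrow> bool" where
  const: "mat_polynomial (\<lambda>M. c)"
| entry: "mat_polynomial (\<lambda>M. M $ i $ j)"
| add: "mat_polynomial f \<Longrightarrow> mat_polynomial g \<Longrightarrow> mat_polynomial (\<lambda>M. f M + g M)"
| mult: "mat_polynomial f \<Longrightarrow> mat_polynomial g \<Longrightarrow> mat_polynomial (\<lambda>M. f M * g M)"

definition mat_algebraic_set :: "(complex ^ 'n ^ 'm) set \<Rightarrow> bool" where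
  "mat_algebraic_set Z \<longleftrightarrow> (\<exists>S. (\<forall>f\<in>S. mat_polynomial f) \<and> Z = {M. \<forall>f\<in>S. f M = 0})"

definition zariski_mat :: "(complex ^ 'n ^ 'm) topology" where
  "zariski_mat = topology (\<lambda>U. mat_algebraic_set (- U))"

definition zariski_GL :: "(complex ^ 'n ^ 'n) topology" where
  "zariski_GL = subtopology zariski_mat {M. invertible M}"

text \<open>
  \<open>Gr(r;n)\<close> is the homogeneous space \<open>GL\<^sub>n/P\<close>, with \<open>P\<close> the stabilizer of the span of the first
  \<open>r\<close> coordinate vectors. Its Zariski topology is the quotient topology along
  \<open>GL\<^sub>n \<rightarrow> Gr(r;n)\<close>, \<open>M \<mapsto> flag_of M r\<close>.
\<close>

definition zariski_Gr :: "nat \<Rightarrow> (complex ^ 'n::{finite,wellorder}) set topology" where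
  "zariski_Gr r =
     topology (\<lambda>U. U \<subseteq> Gr r \<and> openin zariski_GL {M. invertible M \<and> flag_of M r \<in> U})"

lemma mat_algebraic_set_Un:
  assumes "mat_algebraic_set Y" "mat_algebraic_set Z"
  shows "mat_algebraic_set (Y \<union> Z)"
proof -
  obtain S where S: "\<forall>f\<in>S. mat_polynomial f" "Y = {M. \<forall>f\<in>S. f M = 0}"
    using assms(1) unfolding mat_algebraic_set_def by auto
  obtain T where T: "\<forall>f\<in>T. mat_polynomial f" "Z = {M. \<forall>f\<in>T. f M = 0}"
    using assms(2) unfolding mat_algebraic_set_def by auto
  let ?R = "(\<lambda>(f, g) M. f M * g M) ` (S \<times> T)"
  have "\<forall>h\<in>?R. mat_polynomial h"
    using S(1) T(1) by (auto intro: mat_polynomial.mult)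
  moreover have "Y \<union> Z = {M. \<forall>h\<in>?R. h M = 0}"
    unfolding S(2) T(2) by auto
  ultimately show ?thesis
    unfolding mat_algebraic_set_def by (intro exI[of _ ?R] conjI)
qed

lemma mat_algebraic_set_INT:
  assumes "\<And>i. i \<in> I \<Longrightarrow> mat_algebraic_set (Z i)"
  shows "mat_algebraic_set (\<Inter>i\<in>I. Z i)"
proof -
  have "\<forall>i\<in>I. \<exists>S. (\<forall>f\<in>S. mat_polynomial f) \<and> Z i = {M. \<forall>f\<in>S. f M = 0}"
    using assms unfolding mat_algebraic_set_def by simp
  from bchoice[OF this] obtain S where
    S: "\<forall>i\<in>I. (\<forall>f\<in>S i. mat_polynomial f) \<and> Z i = {M. \<forall>f\<in>S i. f M = 0}" ..
  have "(\<Inter>i\<in>I. Z i) = (\<Inter>i\<in>I. {M. \<forall>f\<in>S i. f M = 0})"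
    using S by simp
  also have "\<dots> = {M. \<forall>f\<in>(\<Union>i\<in>I. S i). f M = 0}"
    by auto
  finally show ?thesis
    unfolding mat_algebraic_set_def using S by (intro exI[of _ "\<Union>i\<in>I. S i"]) simp
qed

lemma openin_zariski_mat:
  fixes U :: "(complex ^ 'n ^ 'm) set"
  shows "openin zariski_mat U \<longleftrightarrow> mat_algebraic_set (- U)"
proof -
  have "istopology (\<lambda>U :: (complex ^ 'n ^ 'm) set. mat_algebraic_set (- U))"
    unfolding istopology_def
  proof (intro conjI allI impI)
    fix U V :: "(complex ^ 'n ^ 'm) set"
    assume "mat_algebraic_set (- U)" "mat_algebraic_set (- V)"
    then show "mat_algebraic_set (- (U \<inter> V))"
      by (simp add: mat_algebraic_set_Un)
  next
    fix K :: "(complex ^ 'n ^ 'm) set set"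
    assume "\<forall>U\<in>K. mat_algebraic_set (- U)"
    then have "mat_algebraic_set (\<Inter>U\<in>K. - U)"
      by (simp add: mat_algebraic_set_INT)
    then show "mat_algebraic_set (- (\<Union>K))"
      by (simp add: uminus_Sup)
  qed
  then show ?thesis
    by (simp only: zariski_mat_def topology_inverse')
qed

lemma topspace_zariski_mat: "topspace zariski_mat = UNIV"
proof -
  have "openin zariski_mat (UNIV :: (complex ^ 'n ^ 'm) set)"
    unfolding openin_zariski_mat mat_algebraic_set_def
    by (rule exI[of _ "{\<lambda>M. 1}"]) (auto intro: mat_polynomial.const)
  then show ?thesis
    using openin_subset by blast
qed

lemma istopology_zariski_Gr:
  "istopology (\<lambda>U. U \<subseteq> Gr r \<and> openin zariski_GL {M. invertible M \<and> flag_of M r \<in> U})"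
  unfolding istopology_def
proof (intro conjI allI impI; (elim conjE)?)
  fix U V :: "(complex ^ 'n::{finite,wellorder}) set set"
  assume "openin zariski_GL {M. invertible M \<and> flag_of M r \<in> U}"
    "openin zariski_GL {M. invertible M \<and> flag_of M r \<in> V}"
  then have "openin zariski_GL ({M. invertible M \<and> flag_of M r \<in> U} \<inter>
      {M. invertible M \<and> flag_of M r \<in> V})"
    by (rule openin_Int)
  moreover have "{M. invertible M \<and> flag_of M r \<in> U} \<inter> {M. invertible M \<and> flag_of M r \<in> V} =
      {M. invertible M \<and> flag_of M r \<in> U \<inter> V}"
    by blast
  ultimately show "openin zariski_GL {M. invertible M \<and> flag_of M r \<in> U \<inter> V}"
    by simp
next
  fix K :: "(complex ^ 'n::{finite,wellorder}) set set set"
  assume "\<forall>U\<in>K. U \<subseteq> Gr r \<and> openin zariski_GL {M. invertible M \<and> flag_of M r \<in> U}"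
  then have "openin zariski_GL (\<Union>U\<in>K. {M. invertible M \<and> flag_of M r \<in> U})"
    by blast
  moreover have "(\<Union>U\<in>K. {M. invertible M \<and> flag_of M r \<in> U}) =
      {M. invertible M \<and> flag_of M r \<in> \<Union>K}"
    by blast
  ultimately show "openin zariski_GL {M. invertible M \<and> flag_of M r \<in> \<Union>K}"
    by simp
qed blast+

lemma openin_zariski_Gr:
  "openin (zariski_Gr r) U \<longleftrightarrow>
     U \<subseteq> Gr r \<and> openin zariski_GL {M. invertible M \<and> flag_of M r \<in> U}"
  by (simp add: zariski_Gr_def topology_inverse'[OF istopology_zariski_Gr])

lemma flag_of_in_Gr:
  fixes M :: "complex ^ 'n::{finite,wellorder} ^ 'n::{finite,wellorder}"
  assumes "invertible M" "r \<le> CARD('n)"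
  shows "flag_of M r \<in> Gr r"
proof -
  have strict: "card {..i} < card {..j}" if "i < j" for i j :: 'n
    using that by (intro psubset_card_mono) auto
  have inj: "inj (\<lambda>j::'n. card {..j})"
    by (rule strict_mono_imp_inj_on) (simp add: strict_mono_def strict)
  have range: "range (\<lambda>j::'n. card {..j}) = {1..CARD('n)}"
  proof (rule card_subset_eq)
    show "(\<lambda>j::'n. card {..j}) ` UNIV \<subseteq> {1..CARD('n)}"
      by (auto simp: Suc_le_eq card_gt_0_iff intro!: card_mono)
    show "card ((\<lambda>j::'n. card {..j}) ` UNIV) = card {1..CARD('n)}"
      using inj by (simp add: card_image)
  qed simp
  then have img: "(\<lambda>j::'n. card {..j}) ` {j. card {..j} \<le> r} = {1..r}"
  proof -
    have "(\<lambda>j::'n. card {..j}) ` {j. card {..j} \<le> r} = range (\<lambda>j::'n. card {..j}) \<inter> {..r}"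
      by blast
    also have "\<dots> = {1..CARD('n)} \<inter> {..r}"
      using range by simp
    also have "\<dots> = {1..r}"
      using assms(2) by auto
    finally show ?thesis .
  qed
  have num: "card {j::'n. card {..j} \<le> r} = r"
    using card_image[OF inj_on_subset[OF inj subset_UNIV], of "{j. card {..j} \<le> r}"] img by simp
  have inj_mult: "inj ((*v) M)"
    by (rule inj_matrix_vector_mult[OF assms(1)])
  have col: "column j M = M *v axis j 1" for j
    by (simp add: vec_eq_iff column_def matrix_vector_mult_def axis_def if_distrib cong: if_cong)
  have inj_col: "inj (\<lambda>j. column j M)"
  proof (rule injI)
    fix i j :: 'n
    assume "column i M = column j M"
    then have "axis i (1::complex) = axis j 1"
      unfolding col using inj_mult by (simp add: inj_eq)
    then show "i = j"
      by (simp add: axis_eq_axis)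
  qed
  have ind: "vec.independent {column j M | j. card {..j} \<le> r}"
  proof (rule vec.independent_mono)
    have "det (Finite_Cartesian_Product.transpose M) \<noteq> 0"
      using assms(1) by (simp add: det_transpose invertible_det_nz)
    then have "vec.independent (rows (Finite_Cartesian_Product.transpose M))"
      using det_dependent_rows by blast
    then show "vec.independent (columns M)"
      by (simp add: rows_transpose)
    show "{column j M | j. card {..j} \<le> r} \<subseteq> columns M"
      by (auto simp: columns_def)
  qed
  have "{column j M | j. card {..j} \<le> r} = (\<lambda>j. column j M) ` {j. card {..j} \<le> r}"
    by auto
  then have "card {column j M | j. card {..j} \<le> r} = r"
    using card_image[OF inj_on_subset[OF inj_col subset_UNIV], of "{j. card {..j} \<le> r}"] num
    by simp
  then show ?thesis
    using ind by (simp add: Gr_def flag_of_def vec.dim_eq_card_independent)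
qed

lemma topspace_zariski_Gr:
  assumes "r \<le> CARD('n::{finite,wellorder})"
  shows "topspace (zariski_Gr r) = (Gr r :: (complex ^ 'n::{finite,wellorder}) set set)"
proof -
  have "{M :: complex ^ 'n::{finite,wellorder} ^ 'n::{finite,wellorder}. invertible M \<and> flag_of M r \<in> Gr r} = topspace zariski_GL"
    using flag_of_in_Gr[OF _ assms] by (auto simp: zariski_GL_def topspace_zariski_mat)
  then have "openin (zariski_Gr r) (Gr r :: (complex ^ 'n::{finite,wellorder}) set set)"
    by (simp add: openin_zariski_Gr)
  then show ?thesis
    using openin_subset[of "zariski_Gr r" "Gr r"] openin_topspace[of "zariski_Gr r"]
    unfolding openin_zariski_Gr by blast
qed

subsection \<open>Dimension\<close>

definition irreducible_space :: "'a topology \<Rightarrow> bool" where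
  "irreducible_space X \<longleftrightarrow> topspace X \<noteq> {} \<and>
     (\<forall>A B. closedin X A \<and> closedin X B \<and> topspace X = A \<union> B \<longrightarrow> A = topspace X \<or> B = topspace X)"

text \<open>
  The supremum of the lengths \<open>k\<close> of chains \<open>Z\<^sub>0 \<subset> \<dots> \<subset> Z\<^sub>k\<close> of irreducible closed subsets. The
  empty space gets dimension \<open>0\<close>.
\<close>

definition krull_dim :: "'a topology \<Rightarrow> enat" where
  "krull_dim X = Sup {enat k | k. \<exists>Z :: nat \<Rightarrow> 'a set.
     (\<forall>i\<le>k. closedin X (Z i) \<and> irreducible_space (subtopology X (Z i))) \<and>
     (\<forall>i<k. Z i \<subset> Z (Suc i))}"

end

(*
  Modulo unit vectors, the first r columns of an NC cell matrix are vectors e_b + a e_c with c <= r,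
  and one vector for each block containing elements <= r and > r; these blocks are nested, and each
  such vector involves its own block and one element of the next larger one. So every point of
  QGr(r;n) is a degeneration of a subspace spanned by r vectors whose supports form a tree on the
  n coordinates. The torus acts transitively on the coefficients along a tree, hence the generic
  subspaces form finitely many orbits, each a torus of dimension n - 1 with coordinates given by
  ratios of minors; its Krull dimension is n - 1 because algebraically independent functions on an
  irreducible closed set stay independent, together with one more, on a larger one.

  Conversely, a point in the closure of such an orbit satisfies upper bounds on the ranks of its
  coordinate projections. In terms of the reduced basis whose pivots are the last nonzero
  coordinates, two of these bounds become equalities at every non-pivot p <= r, and this confines
  the supports of the basis so that the basis can be read as an NC cell matrix.
*)
theory Submission imports Defs begin

text \<open>Only the way the blocks straddle \<open>r\<close> matters: each straddling block
  contributes its last element \<open><= r\<close>, a centre, and noncrossingness makes the maxima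
  of these blocks decrease as the centres increase. What remains is a map \<open>\<kappa>\<close> on
  a finite type, whence the finiteness. With m centres the supports have 2(r-m) + m + (n-r) + (m-1)
  = n+r-1 incidences between n coordinates and r vectors; rescaling the r vectors leaves n-1
  parameters.

  The topology of \<open>Gr r\<close> is a quotient topology, so closures do not come with
  equations, and the two inclusions use different tools. Points are put into a closure as Euclidean
  limits, since polynomials are continuous. Points are kept inside \<open>QGr r\<close> by rank
  bounds alone, without knowing that these cut out the closure. This suffices because, for one
  non-pivot p, the two bounds exceed the generic count by one in total, and p uses up exactly this
  one.

  Krull dimension quantifies over chains of arbitrary irreducible closed sets, so its upper bound
  needs an invariant that grows along every chain: the number of algebraically independent
  functions, bounded by counting monomials.\<close>

subsection \<open>Noncrossing permutations and their block labellings\<close>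

text \<open>
  A noncrossing partition is recorded by a labelling \<open>f\<close> whose fibres are its blocks. On each
  fibre, \<open>w\<close> sends an element to the preceding one, and the least element to the greatest.
\<close>

definition noncrossing_labelling :: "('n::linorder \<Rightarrow> 'b) \<Rightarrow> bool" where
  "noncrossing_labelling f \<longleftrightarrow>
     (\<forall>a b c d. a < b \<and> b < c \<and> c < d \<and> f a = f c \<and> f b = f d \<longrightarrow> f a = f b)"

definition cyclic_pred :: "('n::linorder \<Rightarrow> 'b) \<Rightarrow> ('n \<Rightarrow> 'n) \<Rightarrow> bool" where
  "cyclic_pred f w \<longleftrightarrow>
     (\<forall>x. f (w x) = f x \<and>
       (if w x < x then \<forall>y. f y = f x \<longrightarrow> y \<le> w x \<or> x \<le> y
        else \<forall>y. f y = f x \<longrightarrow> x \<le> y \<and> y \<le> w x))"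

lemma noncrossing_labellingD:
  "noncrossing_labelling f \<Longrightarrow> a < b \<Longrightarrow> b < c \<Longrightarrow> c < d \<Longrightarrow> f a = f c \<Longrightarrow> f b = f d \<Longrightarrow> f a = f b"
  unfolding noncrossing_labelling_def by blast

lemma cyclic_pred_label: "cyclic_pred f w \<Longrightarrow> f (w x) = f x"
  unfolding cyclic_pred_def by blast

lemma cyclic_pred_less:
  "cyclic_pred f w \<Longrightarrow> w x < x \<Longrightarrow> f y = f x \<Longrightarrow> y \<le> w x \<or> x \<le> y"
  unfolding cyclic_pred_def by meson

lemma cyclic_pred_ge:
  "cyclic_pred f w \<Longrightarrow> x \<le> w x \<Longrightarrow> f y = f x \<Longrightarrow> x \<le> y \<and> y \<le> w x"
  unfolding cyclic_pred_def by (metis leD)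

lemma cyclic_pred_unique:
  assumes "cyclic_pred f w" "cyclic_pred f w'"
  shows "w = w'"
proof
  fix x
  show "w x = w' x"
    using cyclic_pred_label[OF assms(1), of x] cyclic_pred_label[OF assms(2), of x]
      cyclic_pred_less[OF assms(1), of x] cyclic_pred_less[OF assms(2), of x]
      cyclic_pred_ge[OF assms(1), of x] cyclic_pred_ge[OF assms(2), of x]
    by (metis antisym le_less_linear leD)
qed

lemma cyclic_pred_bij:
  fixes w :: "'n::{finite,wellorder} \<Rightarrow> 'n"
  assumes "cyclic_pred f w"
  shows "bij w"
proof -
  have "inj w"
  proof (rule injI)
    fix x y assume eq: "w x = w y"
    then have fxy: "f x = f y"
      by (metis assms cyclic_pred_label)
    show "x = y"
      using cyclic_pred_less[OF assms, of x y] cyclic_pred_less[OF assms, of y x]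
        cyclic_pred_ge[OF assms, of x y] cyclic_pred_ge[OF assms, of y x] eq fxy
      by (metis antisym le_less_linear leD)
  qed
  then show ?thesis
    by (simp add: bij_def finite_UNIV_inj_surj)
qed

text \<open>A fibre of \<open>f\<close> is a single cycle of \<open>w\<close>.\<close>

lemma cyclic_pred_closed:
  fixes w :: "'n::{finite,wellorder} \<Rightarrow> 'n"
  assumes "cyclic_pred f w" "S \<noteq> {}" "\<And>x. x \<in> S \<Longrightarrow> w x \<in> S" "\<And>x. x \<in> S \<Longrightarrow> f x = b" "f y = b"
  shows "y \<in> S"
proof (rule ccontr)
  assume y: "y \<notin> S"
  obtain m where m: "m \<in> S" "\<And>x. x \<in> S \<Longrightarrow> m \<le> x"
    using assms(2) by (metis finite Min_in Min_le)
  \<comment> \<open>At the least element \<open>m\<close> of \<open>S\<close> the map cannot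
    descend, so \<open>w m\<close> is the greatest element of the fibre, and \<open>S\<close>
    reaches above \<open>y\<close>. The least element of \<open>S\<close> above \<open>y\<close>
    would then have its predecessor above \<open>y\<close> as well.\<close>
  have "m \<le> w m"
    using m assms(3) by blast
  then have "y \<le> w m"
    using cyclic_pred_ge[OF assms(1)] m assms(4,5) by metis
  then have ne: "{x \<in> S. y \<le> x} \<noteq> {}"
    using assms(3) m(1) by blast
  define k where "k = Min {x \<in> S. y \<le> x}"
  have k: "k \<in> S" "y \<le> k"
    using Min_in[OF _ ne] unfolding k_def by auto
  have kmin: "k \<le> x" if "x \<in> S" "y \<le> x" for x
    unfolding k_def using that by simp
  have "y < k"
    using k y by (metis le_less)
  then have "w k < k"
    using cyclic_pred_ge[OF assms(1), of k y] k assms(4,5) by (metis leD le_less_linear)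
  then have "y \<le> w k"
    using cyclic_pred_less[OF assms(1), of k y] k assms(4,5) \<open>y < k\<close> by (metis leD)
  then show False
    using kmin[of "w k"] assms(3) k(1) \<open>w k < k\<close> by auto
qed

section \<open>Products of block cycles and their labellings\<close>

lemma block_cycle_outside:
  fixes B :: "'n::{finite,wellorder} set"
  shows "x \<notin> B \<Longrightarrow> block_cycle B x = x"
  unfolding block_cycle_def by (rule id_outside_supp) simp

lemma block_cycle_inside:
  fixes B :: "'n::{finite,wellorder} set"
  assumes "x \<in> B"
  shows "block_cycle B x \<in> B \<and>
    (if block_cycle B x < x then \<forall>y\<in>B. y \<le> block_cycle B x \<or> x \<le> y
     else \<forall>y\<in>B. x \<le> y \<and> y \<le> block_cycle B x)"
proof -
  define xs where "xs = sorted_list_of_set B"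
  define cs where "cs = rev xs"
  define m where "m = length xs"
  have xs: "sorted xs" "distinct xs" "set xs = B"
    unfolding xs_def by auto
  have mono: "xs ! i < xs ! j" if "i < j" "j < m" for i j
    using xs that unfolding m_def by (metis strict_sorted_iff sorted_wrt_nth_less)
  have mono': "xs ! i \<le> xs ! j" if "i \<le> j" "j < m" for i j
    using mono that by (metis le_less)
  have B_nth: "\<exists>i<m. y = xs ! i" if "y \<in> B" for y
    using that xs(3) unfolding m_def by (metis in_set_conv_nth)
  obtain k where k: "k < m" "cs ! k = x"
    using assms xs(3) unfolding cs_def m_def by (metis in_set_conv_nth length_rev set_rev)
  \<comment> \<open>The cycle advances one place in the descending list; wrapping around at its end
    is the jump from the least element of the block to the greatest.\<close>
  have "map (cycle_of_list cs) cs = rotate1 cs"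
    using cyclic_rotation[of cs 1] xs by (simp add: cs_def)
  then have "cycle_of_list cs x = rotate1 cs ! k"
    using k by (metis cs_def length_rev m_def nth_map)
  then have w: "block_cycle B x = cs ! (Suc k mod m)"
    using k by (simp add: block_cycle_def cs_def xs_def m_def nth_rotate1)
  have xs_ne: "0 < length xs"
    using k unfolding m_def by linarith
  have x: "x = xs ! (m - Suc k)"
    using k unfolding cs_def m_def by (simp add: rev_nth)
  show ?thesis
  proof (cases "Suc k = m")
    case True
    then have x': "x = xs ! 0"
      using x by simp
    have "Suc k mod m = 0"
      using True by simp
    then have w': "block_cycle B x = xs ! (m - 1)"
      using w rev_nth[OF xs_ne] by (metis One_nat_def cs_def m_def)
    have "x \<le> y \<and> y \<le> block_cycle B x" if y: "y \<in> B" for y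
    proof -
      obtain i where i: "i < m" "y = xs ! i"
        using B_nth[OF y] by blast
      then show ?thesis
        unfolding w' using x' mono'[of 0 i] mono'[of i "m - 1"] by simp
    qed
    moreover have "block_cycle B x \<in> B"
      using k xs(3) w' nth_mem[of "m - 1" xs] by (simp add: m_def)
    ultimately show ?thesis
      using assms by fastforce
  next
    case False
    then have w': "block_cycle B x = xs ! (m - Suc (Suc k))"
      using w k by (simp add: cs_def rev_nth m_def)
    have less: "block_cycle B x < x"
      using False k w' x mono[of "m - Suc (Suc k)" "m - Suc k"] by simp
    have "y \<le> block_cycle B x \<or> x \<le> y" if y: "y \<in> B" for y
    proof -
      obtain i where i: "i < m" "y = xs ! i"
        using B_nth[OF y] by blast
      show ?thesis
      proof (cases "i \<le> m - Suc (Suc k)")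
        case True
        then show ?thesis
          using mono'[of i "m - Suc (Suc k)"] k i w' by auto
      next
        case False
        then show ?thesis
          using mono'[of "m - Suc k" i] k i x by auto
      qed
    qed
    moreover have "block_cycle B x \<in> B"
      using k xs(3) w' nth_mem[of "m - Suc (Suc k)" xs] by (simp add: m_def)
    ultimately show ?thesis
      using less by simp
  qed
qed

lemma foldr_block_cycle:
  fixes Bs :: "'n::{finite,wellorder} set list"
  assumes "distinct Bs" "disjoint (set Bs)" "B \<in> set Bs" "x \<in> B"
  shows "foldr (\<circ>) (map block_cycle Bs) id x = block_cycle B x"
  using assms
proof (induction Bs)
  case (Cons A Bs)
  have outside: "foldr (\<circ>) (map block_cycle Cs) id y = y" if "\<And>C. C \<in> set Cs \<Longrightarrow> y \<notin> C" for Cs and y :: 'n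
    using that by (induction Cs) (auto simp: block_cycle_outside)
  have Cons_apply: "foldr (\<circ>) (map block_cycle (A # Bs)) id x = block_cycle A (foldr (\<circ>) (map block_cycle Bs) id x)"
    unfolding list.map foldr.simps comp_apply ..
  show ?case
  proof (cases "B = A")
    case True
    then have "x \<notin> C" if "C \<in> set Bs" for C
      using Cons.prems that by (auto simp: disjoint_def)
    then show ?thesis
      using outside[of Bs x] by (metis Cons_apply True)
  next
    case False
    then have B: "B \<in> set Bs"
      using Cons.prems by auto
    have "disjoint (set Bs)"
      using Cons.prems(2) by (auto simp: disjoint_def)
    then have "foldr (\<circ>) (map block_cycle Bs) id x = block_cycle B x"
      using Cons.prems B by (intro Cons.IH) auto
    moreover have "block_cycle B x \<in> B"
      using block_cycle_inside Cons.prems by blast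
    then have "block_cycle B x \<notin> A"
      using Cons.prems False B by (auto simp: disjoint_def)
    ultimately show ?thesis
      by (metis Cons_apply block_cycle_outside)
  qed
qed simp

lemma cyclic_pred_foldr:
  fixes Bs :: "'n::{finite,wellorder} set list"
  assumes "distinct Bs" "partition_on UNIV (set Bs)"
    and f: "\<And>x y B. B \<in> set Bs \<Longrightarrow> x \<in> B \<Longrightarrow> f y = f x \<longleftrightarrow> y \<in> B"
  shows "cyclic_pred f (foldr (\<circ>) (map block_cycle Bs) id)"
  unfolding cyclic_pred_def
proof
  fix x
  obtain B where B: "B \<in> set Bs" "x \<in> B"
    using assms(2) by (metis UNIV_I UnionE partition_onD1)
  have "foldr (\<circ>) (map block_cycle Bs) id x = block_cycle B x"
    using foldr_block_cycle[OF assms(1) _ B] assms(2) by (simp add: partition_onD2)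
  then show "f (foldr (\<circ>) (map block_cycle Bs) id x) = f x \<and>
       (if foldr (\<circ>) (map block_cycle Bs) id x < x
        then \<forall>y. f y = f x \<longrightarrow> y \<le> foldr (\<circ>) (map block_cycle Bs) id x \<or> x \<le> y
        else \<forall>y. f y = f x \<longrightarrow> x \<le> y \<and> y \<le> foldr (\<circ>) (map block_cycle Bs) id x)"
    using block_cycle_inside[OF B(2)] f[OF B] by simp
qed

lemma NC_labelling:
  fixes w :: "'n::{finite,wellorder} \<Rightarrow> 'n"
  assumes "w \<in> NC"
  obtains f :: "'n \<Rightarrow> 'n set" where "noncrossing_labelling f" "cyclic_pred f w"
proof -
  obtain Bs where Bs: "w = foldr (\<circ>) (map block_cycle Bs) id" "distinct Bs"
      "partition_on UNIV (set Bs)" "noncrossing (set Bs)"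
    using assms unfolding NC_def by blast
  have "\<forall>x. \<exists>B. B \<in> set Bs \<and> x \<in> B"
    using Bs(3) by (metis UNIV_I UnionE partition_onD1)
  then obtain f where f: "\<And>x. f x \<in> set Bs \<and> x \<in> f x"
    by metis
  have disj: "A = B" if "A \<in> set Bs" "B \<in> set Bs" "x \<in> A" "x \<in> B" for A B x
    using Bs(3) that unfolding partition_on_def disjoint_def by blast
  have "noncrossing_labelling f"
    unfolding noncrossing_labelling_def
    using Bs(4) f unfolding noncrossing_def by metis
  moreover have "cyclic_pred f w"
    unfolding Bs(1) by (rule cyclic_pred_foldr[OF Bs(2,3)]) (use f disj in metis)
  ultimately show ?thesis
    using that by blast
qed

lemma labelling_NC:
  fixes f :: "'n::{finite,wellorder} \<Rightarrow> 'b"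
  assumes "noncrossing_labelling f"
  obtains w where "w \<in> NC" "cyclic_pred f w"
proof -
  define P where "P = range (\<lambda>x. {y. f y = f x})"
  obtain Bs where Bs: "set Bs = P" "distinct Bs"
    using finite_distinct_list[of P] unfolding P_def by auto
  have "partition_on UNIV P"
    unfolding P_def partition_on_def disjoint_def by auto
  moreover have "noncrossing P"
    unfolding noncrossing_def
  proof (clarify)
    fix A B a b c d
    assume "A \<in> P" "B \<in> P" and ne: "A \<noteq> B" and in_blocks: "a \<in> A" "b \<in> B" "c \<in> A" "d \<in> B"
      and "a < b" "b < c" "c < d"
    then have "A = {y. f y = f a}" "B = {y. f y = f b}" "f c = f a" "f d = f b"
      unfolding P_def by auto
    then show False
      using noncrossing_labellingD[OF assms \<open>a < b\<close> \<open>b < c\<close> \<open>c < d\<close>] ne by auto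
  qed
  ultimately have "foldr (\<circ>) (map block_cycle Bs) id \<in> NC"
    unfolding NC_def using Bs by auto
  moreover have "cyclic_pred f (foldr (\<circ>) (map block_cycle Bs) id)"
    using \<open>partition_on UNIV P\<close> by (intro cyclic_pred_foldr) (auto simp: Bs P_def)
  ultimately show ?thesis
    using that by blast
qed

text \<open>Labels are only compared for equality, so any label type will do: a modified permutation
  is shown to be in \<open>NC\<close> by exhibiting a suitable relabelling.\<close>

lemma cyclic_pred_NC:
  fixes f :: "'n::{finite,wellorder} \<Rightarrow> 'b"
  assumes "noncrossing_labelling f" "cyclic_pred f w"
  shows "w \<in> NC"
  using labelling_NC[OF assms(1)] cyclic_pred_unique[OF assms(2)] by metis

text \<open>With j = \<open>w c\<close> and e = \<open>inv w i\<close>, the permutation (i j)w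
  differs from \<open>w\<close> only in sending e to j and c to i, so it splits one cycle or merges
  two. If c were above \<open>w c\<close>, then i < j < c < e would cross in the new labelling. When
  blocks are merged, the block of c lies in the gap between i and its successor e, and a third block
  with elements after i on both sides of a point of it would cross the merged block.\<close>

lemma Inv_NC_cases:
  fixes w :: "'n::{finite,wellorder} \<Rightarrow> 'n"
  assumes f: "noncrossing_labelling f" "cyclic_pred f w" and Inv: "(i, w c) \<in> Inv_NC w"
  shows "c \<le> w c"
    and "f i = f c \<or> i < c \<and> w c < inv w i \<and>
      (\<forall>p x d. f x = f c \<and> f p = f d \<and> i < p \<and> p < x \<and> x < d \<longrightarrow> f p = f i \<or> f p = f c)"
proof -
  define j where "j = w c"
  define e where "e = inv w i"
  have bij: "bij w"
    using f(2) by (rule cyclic_pred_bij)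
  then have we: "w e = i" and inv_j: "inv w j = c"
    unfolding e_def j_def by (simp_all add: bij_is_surj surj_f_inv_f bij_is_inj)
  have ij: "i < j" and ce: "c < e" and w'_NC: "Transposition.transpose i j \<circ> w \<in> NC"
    using Inv inv_j unfolding Inv_NC_def j_def e_def by auto
  define w' where "w' = Transposition.transpose i j \<circ> w"
  have w'e: "w' e = j" and w'c: "w' c = i"
    unfolding w'_def by (simp_all add: we j_def[symmetric])
  have w'_same: "w' x = w x" if "x \<noteq> e" "x \<noteq> c" for x
  proof -
    have "w x \<noteq> i" "w x \<noteq> j"
      using that bij we by (auto simp: j_def bij_def inj_eq)
    then show ?thesis
      unfolding w'_def by simp
  qed
  obtain g :: "'n \<Rightarrow> 'n set" where g: "noncrossing_labelling g" "cyclic_pred g w'"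
    using NC_labelling[OF w'_NC] unfolding w'_def by blast
  have fi: "f i = f e" and fj: "f j = f c"
    using cyclic_pred_label[OF f(2)] we j_def by metis+
  have gj: "g j = g e" and gi: "g i = g c"
    using cyclic_pred_label[OF g(2)] w'e w'c by metis+
  show cj: "c \<le> w c"
  proof (rule ccontr)
    assume "\<not> c \<le> w c"
    then have jc: "j < c"
      by (simp add: j_def)
    have "g c \<noteq> g e"
      using cyclic_pred_less[OF g(2), of e c] w'e jc ce order.strict_trans[OF jc ce] by auto
    moreover have "g i = g j"
      using noncrossing_labellingD[OF g(1) ij jc ce] gi gj by simp
    ultimately show False
      using gi gj by simp
  qed
  then have cj: "c \<le> j"
    by (simp add: j_def)
  have closed: "f x = f c \<Longrightarrow> x \<noteq> e" if "f i \<noteq> f c" for x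
    using that fi by auto
  \<comment> \<open>If the new labels of e and c differed, the points of c's old block with the
    label of e would be closed under \<open>w\<close>, as only c and e are altered. They include j,
    hence would fill the block and contain c.\<close>
  have g_ec: "g e = g c" if ne: "f i \<noteq> f c"
  proof (rule ccontr)
    assume neq: "g e \<noteq> g c"
    have "c \<in> {x. f x = f c \<and> g x = g e}"
    proof (rule cyclic_pred_closed[OF f(2), where b = "f c"])
      show "{x. f x = f c \<and> g x = g e} \<noteq> {}"
        using fj gj by blast
      fix x assume x: "x \<in> {x. f x = f c \<and> g x = g e}"
      then have "w' x = w x"
        using closed[OF ne] neq by (intro w'_same) auto
      then show "w x \<in> {x. f x = f c \<and> g x = g e}"
        using x cyclic_pred_label[OF f(2), of x] cyclic_pred_label[OF g(2), of x] by auto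
    qed auto
    then show False
      using neq by simp
  qed
  have nested: "i < c \<and> j < e" if ne: "f i \<noteq> f c"
  proof -
    have "j < e"
    proof (rule ccontr)
      assume "\<not> j < e"
      then have "e \<le> c"
        using cyclic_pred_ge[OF g(2), of e c] w'e g_ec[OF ne] by auto
      then show False
        using ce by (simp add: leD)
    qed
    moreover have "i < c"
    proof (rule ccontr)
      assume "\<not> i < c"
      then have "c < i"
        using ne by (metis le_less not_le)
      then show False
        using noncrossing_labellingD[OF f(1) _ ij \<open>j < e\<close>] fi fj ne by metis
    qed
    ultimately show ?thesis by simp
  qed
  \<comment> \<open>The transposition does not touch third blocks, so \<open>g\<close> is constant
    on each of them and separates them from the merged block; i < p < x < d would then be a crossing
    for \<open>g\<close>.\<close>
  have nc: "f p = f i \<or> f p = f c"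
    if ne: "f i \<noteq> f c" and asm: "f x = f c" "f p = f d" "i < p" "p < x" "x < d" for p x d
  proof (rule ccontr)
    assume neg: "\<not> ?thesis"
    have gx: "x \<in> {x. f x = f c \<and> g x = g c}"
    proof (rule cyclic_pred_closed[OF f(2), where b = "f c"])
      fix y assume y: "y \<in> {x. f x = f c \<and> g x = g c}"
      then show "w y \<in> {x. f x = f c \<and> g x = g c}"
        using cyclic_pred_label[OF f(2), of y] cyclic_pred_label[OF g(2), of y]
          w'_same[of y] closed[OF ne, of y] fj gj g_ec[OF ne] by (cases "y = c") (auto simp: j_def)
    qed (use asm in auto)
    have gpd: "d \<in> {x. f x = f p \<and> g x = g p}"
    proof (rule cyclic_pred_closed[OF f(2), where b = "f p"])
      fix y assume y: "y \<in> {x. f x = f p \<and> g x = g p}"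
      then show "w y \<in> {x. f x = f p \<and> g x = g p}"
        using cyclic_pred_label[OF f(2), of y] cyclic_pred_label[OF g(2), of y]
          w'_same[of y] neg fi by (cases "y = e"; cases "y = c") auto
    qed (use asm in auto)
    have "g p \<noteq> g c"
    proof
      assume gpc: "g p = g c"
      have "p \<in> {x. (f x = f i \<or> f x = f c) \<and> g x = g c}"
      proof (rule cyclic_pred_closed[OF g(2), where b = "g c"])
        fix y assume y: "y \<in> {x. (f x = f i \<or> f x = f c) \<and> g x = g c}"
        then show "w' y \<in> {x. (f x = f i \<or> f x = f c) \<and> g x = g c}"
          using cyclic_pred_label[OF f(2), of y] cyclic_pred_label[OF g(2), of y]
            w'_same[of y] w'e w'c fj gj gi g_ec[OF ne] by (cases "y = c"; cases "y = e") auto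
      qed (use gpc in auto)
      then show False
        using neg by simp
    qed
    then show False
      using noncrossing_labellingD[OF g(1) asm(3-5)] gx gpd gi by auto
  qed
  show "f i = f c \<or> i < c \<and> w c < inv w i \<and>
      (\<forall>p x d. f x = f c \<and> f p = f d \<and> i < p \<and> p < x \<and> x < d \<longrightarrow> f p = f i \<or> f p = f c)"
    using nested nc unfolding j_def e_def by blast
qed

text \<open>The block of c is cut into its elements \<open><= i\<close> and its elements above i.
  Then c, the least of the lower part, goes to its maximum i, and e, the least of the upper part,
  goes to \<open>w c\<close>.\<close>

lemma Inv_NC_split:
  fixes w :: "'n::{finite,wellorder} \<Rightarrow> 'n"
  assumes f: "noncrossing_labelling f" "cyclic_pred f w" and c: "c \<le> w c" and i: "f i = f c" "i < w c"
  shows "(i, w c) \<in> Inv_NC w"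
proof -
  define j where "j = w c"
  define e where "e = inv w i"
  have bij: "bij w"
    using f(2) by (rule cyclic_pred_bij)
  then have we: "w e = i" and inv_j: "inv w j = c"
    unfolding e_def j_def by (simp_all add: bij_is_surj surj_f_inv_f bij_is_inj)
  have fe: "f e = f c"
    using cyclic_pred_label[OF f(2), of e] we i by simp
  have block: "c \<le> y \<and> y \<le> j" if "f y = f c" for y
    using cyclic_pred_ge[OF f(2) c] that unfolding j_def by simp
  have ec: "e \<noteq> c"
    using we i(2) by auto
  then have ce: "c < e"
    using block[OF fe] by (metis le_less)
  have ie: "i < e"
    using cyclic_pred_ge[OF f(2), of e c] we fe ce by force
  have gap: "y \<le> i \<or> e \<le> y" if "f y = f c" for y
    using cyclic_pred_less[OF f(2), of e y] we fe that ie by simp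
  then have next_ge: "e \<le> y" if "f y = f c" "i < y" for y
    using that by (metis leD)
  define g where "g x = (f x, f x = f c \<and> i < x)" for x
  have "noncrossing_labelling g"
    unfolding noncrossing_labelling_def
  proof (intro allI impI; elim conjE)
    fix x p y d
    assume o: "x < p" "p < y" "y < d" and eq: "g x = g y" "g p = g d"
    have "f x = f p"
      using noncrossing_labellingD[OF f(1) o] eq by (simp add: g_def)
    moreover have "i < x \<Longrightarrow> i < p" "i < p \<Longrightarrow> i < y"
      using o by auto
    ultimately show "g x = g p"
      using eq by (auto simp: g_def)
  qed
  moreover have "cyclic_pred g (Transposition.transpose i j \<circ> w)"
    unfolding cyclic_pred_def
  proof
    fix x
    let ?w = "Transposition.transpose i j \<circ> w"
    have wx: "?w x = (if x = e then j else if x = c then i else w x)"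
      using we bij by (auto simp: j_def[symmetric] bij_def inj_def Transposition.transpose_def)
    consider "x = e" | "x = c" | "x \<noteq> e" "x \<noteq> c" "f x = f c" | "f x \<noteq> f c"
      by blast
    then show "g (?w x) = g x \<and> (if ?w x < x then \<forall>y. g y = g x \<longrightarrow> y \<le> ?w x \<or> x \<le> y
        else \<forall>y. g y = g x \<longrightarrow> x \<le> y \<and> y \<le> ?w x)"
    proof cases
      case 1
      have fj: "f j = f c"
        using cyclic_pred_label[OF f(2), of c] by (simp add: j_def)
      then have "e \<le> j"
        using gap[OF fj] i j_def by auto
      then show ?thesis
        using 1 wx fj fe ie i block next_ge by (auto simp: g_def j_def)
    next
      case 2
      have "\<not> i < c"
        using block[OF i(1)] by (simp add: not_less)
      with 2 show ?thesis
        using wx ec i ie block by (auto simp: g_def)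
    next
      case 3
      then have "w x < x"
        using cyclic_pred_ge[OF f(2), of x c] block[of x] by force
      moreover have "w x \<noteq> i"
        using 3 we bij by (auto simp: bij_def inj_def)
      moreover have "f (w x) = f c"
        using cyclic_pred_label[OF f(2), of x] 3 by simp
      moreover have "i < w x \<longleftrightarrow> i < x"
        using cyclic_pred_less[OF f(2) \<open>w x < x\<close>, of i] i(1) 3(3) \<open>w x < x\<close> \<open>w x \<noteq> i\<close> by auto
      ultimately show ?thesis
        using 3 wx cyclic_pred_less[OF f(2), of x] i by (auto simp: g_def)
    next
      case 4
      then have wx': "?w x = w x"
        using wx fe by auto
      have gx: "g y = g x \<longleftrightarrow> f y = f x" for y
        using 4 by (auto simp: g_def)
      show ?thesis
        unfolding wx' gx using f(2) unfolding cyclic_pred_def by blast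
    qed
  qed
  ultimately have "Transposition.transpose i j \<circ> w \<in> NC"
    by (rule cyclic_pred_NC)
  then show ?thesis
    using i ce inv_j unfolding Inv_NC_def j_def e_def by auto
qed

text \<open>The two blocks are given a common label. A third block crossing the union alternates
  with one point of each; wherever it surrounds a point of c's block, the last assumption pushes its
  left point before i, and then it already crosses the old block of i.\<close>

lemma Inv_NC_merge:
  fixes w :: "'n::{finite,wellorder} \<Rightarrow> 'n"
  assumes f: "noncrossing_labelling f" "cyclic_pred f w" and c: "c \<le> w c"
    and i: "i < c" "w c < inv w i" "f i \<noteq> f c"
    and nc: "\<And>p x d. f x = f c \<Longrightarrow> f p = f d \<Longrightarrow> i < p \<Longrightarrow> p < x \<Longrightarrow> x < d \<Longrightarrow> f p = f i \<or> f p = f c"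
  shows "(i, w c) \<in> Inv_NC w"
proof -
  define j where "j = w c"
  define e where "e = inv w i"
  have bij: "bij w"
    using f(2) by (rule cyclic_pred_bij)
  then have we: "w e = i" and inv_j: "inv w j = c"
    unfolding e_def j_def by (simp_all add: bij_is_surj surj_f_inv_f bij_is_inj)
  have fe: "f e = f i" and fj: "f j = f c"
    using cyclic_pred_label[OF f(2), of e] cyclic_pred_label[OF f(2), of c] we by (simp_all add: j_def)
  have block: "c \<le> y \<and> y \<le> j" if "f y = f c" for y
    using cyclic_pred_ge[OF f(2) c] that unfolding j_def by simp
  have je: "j < e" and cj: "c \<le> j"
    using i c by (simp_all add: j_def e_def)
  have gap: "y \<le> i \<or> e \<le> y" if "f y = f i" for y
    using cyclic_pred_less[OF f(2), of e y] we fe that i(1) cj je by auto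
  define g where "g x = (if f x = f c then f i else f x)" for x
  \<comment> \<open>\<open>nc1\<close> and \<open>nc2\<close> differ in whether the left one of the
    two points in the union belongs to the block of i or to that of c. Each treats both orders in
    which a third block can alternate with these points.\<close>
  have nc1: False if "f x = f i" "f y = f c" "f p = f d" "f p \<noteq> f i" "f p \<noteq> f c"
      "x < p \<and> p < y \<and> y < d \<or> p < x \<and> x < d \<and> d < y" for x y p d
  proof -
    have *: "\<And>a b c d. a < b \<Longrightarrow> b < c \<Longrightarrow> c < d \<Longrightarrow> f a = f c \<Longrightarrow> f b = f d \<Longrightarrow> f a = f b"
      by (rule noncrossing_labellingD[OF f(1)])
    have y: "c \<le> y" "y \<le> j"
      using block that by auto
    have pi: "p \<noteq> i" "d \<noteq> i" "p \<noteq> e" "d \<noteq> e"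
      using that fe by auto
    show False
    proof (cases "x < p")
      case True
      then have o: "x < p" "p < y" "y < d"
        using that by auto
      have "p < i"
        using nc[of y p d] that o pi by (metis linorder_neqE)
      then show False
        using *[of x p i d] o y i that by auto
    next
      case False
      then have o: "p < x" "x < d" "d < y"
        using that by auto
      have x: "x \<le> i"
        using gap[of x] that o y je by auto
      show False
      proof (cases "d < i")
        case True
        then show False
          using *[of p x d i] o that by auto
      next
        case False
        then show False
          using *[of p x d e] o that fe y je pi by auto
      qed
    qed
  qed
  have nc2: False if "f x = f c" "f y = f i" "f p = f d" "f p \<noteq> f i" "f p \<noteq> f c"
      "x < p \<and> p < y \<and> y < d \<or> p < x \<and> x < d \<and> d < y" for x y p d
  proof -
    have *: "\<And>a b c d. a < b \<Longrightarrow> b < c \<Longrightarrow> c < d \<Longrightarrow> f a = f c \<Longrightarrow> f b = f d \<Longrightarrow> f a = f b"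
      by (rule noncrossing_labellingD[OF f(1)])
    have x: "c \<le> x" "x \<le> j"
      using block that by auto
    have pi: "p \<noteq> i" "d \<noteq> i" "p \<noteq> e" "d \<noteq> e"
      using that fe by auto
    show False
    proof (cases "x < p")
      case True
      then have o: "x < p" "p < y" "y < d"
        using that by auto
      then show False
        using *[of i p y d] x i that by auto
    next
      case False
      then have o: "p < x" "x < d" "d < y"
        using that by auto
      have "p < i"
        using nc[of x p d] that o pi by (metis linorder_neqE)
      then show False
        using *[of p i d y] o x i that by auto
    qed
  qed
  have "noncrossing_labelling g"
    unfolding noncrossing_labelling_def
  proof (intro allI impI; elim conjE)
    fix x p y d
    assume o: "x < p" "p < y" "y < d" and g: "g x = g y" "g p = g d"
    show "g x = g p"
    proof (rule ccontr)
      assume ne: "g x \<noteq> g p"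
      have f': "f a = f b \<or> f a = f i \<and> f b = f c \<or> f a = f c \<and> f b = f i" if "g a = g b" for a b
        using that unfolding g_def by (auto split: if_splits)
      have out: "f p \<noteq> f i \<and> f p \<noteq> f c \<or> f x \<noteq> f i \<and> f x \<noteq> f c"
        using ne by (auto simp: g_def split: if_splits)
      have eq: "f x = f y \<Longrightarrow> f p \<noteq> f d"
        using noncrossing_labellingD[OF f(1) o] ne unfolding g_def by metis
      show False
      proof (cases "f p = f d")
        case True
        then have "f x \<noteq> f y" "f x = f i \<and> f y = f c \<or> f x = f c \<and> f y = f i"
          using f'[OF g(1)] eq by auto
        then show False
          using True out o nc1[of x y p d] nc2[of x y p d] by metis
      next
        case False
        then have pd: "f p = f i \<and> f d = f c \<or> f p = f c \<and> f d = f i"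
          using f'[OF g(2)] by auto
        then have "f x = f y" "f x \<noteq> f i" "f x \<noteq> f c"
          using f'[OF g(1)] out by auto
        then show False
          using pd o nc1[of p d x y] nc2[of p d x y] by metis
      qed
    qed
  qed
  moreover have "cyclic_pred g (Transposition.transpose i j \<circ> w)"
    unfolding cyclic_pred_def
  proof
    fix x
    let ?w = "Transposition.transpose i j \<circ> w"
    have wx: "?w x = (if x = e then j else if x = c then i else w x)"
      using we bij by (auto simp: j_def[symmetric] bij_def inj_def Transposition.transpose_def)
    have ec: "e \<noteq> c"
      using cj je by auto
    consider "x = e" | "x = c" | "x \<noteq> e" "x \<noteq> c" "f x = f c" | "x \<noteq> e" "f x = f i" | "f x \<noteq> f c" "f x \<noteq> f i"
      by blast
    then show "g (?w x) = g x \<and> (if ?w x < x then \<forall>y. g y = g x \<longrightarrow> y \<le> ?w x \<or> x \<le> y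
        else \<forall>y. g y = g x \<longrightarrow> x \<le> y \<and> y \<le> ?w x)"
    proof cases
      case 1
      have "y \<le> j \<or> e \<le> y" if "g y = g e" for y
        using that gap[of y] block[of y] cj i fe by (auto simp: g_def split: if_splits)
      then show ?thesis
        using 1 wx fj fe je by (auto simp: g_def)
    next
      case 2
      have "y \<le> i \<or> c \<le> y" if "g y = g c" for y
        using that gap[of y] block[of y] cj je i fe by (auto simp: g_def split: if_splits)
      then show ?thesis
        using 2 wx ec i by (auto simp: g_def)
    next
      case 3
      then have less: "w x < x"
        using cyclic_pred_ge[OF f(2), of x c] block[of x] by force
      have fwx: "f (w x) = f c"
        using cyclic_pred_label[OF f(2), of x] 3 by simp
      have "y \<le> w x \<or> x \<le> y" if "g y = g x" for y
        using that 3 less fwx gap[of y] block[of x] block[of "w x"] je i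
          cyclic_pred_less[OF f(2) less, of y] by (auto simp: g_def split: if_splits)
      then show ?thesis
        using 3 wx fwx less by (auto simp: g_def)
    next
      case 4
      have fwx: "f (w x) = f i"
        using cyclic_pred_label[OF f(2), of x] 4 by simp
      have xi: "x \<le> i \<or> e < x"
        using gap[OF 4(2)] 4(1) by auto
      have xc: "x \<noteq> c"
        using 4 i by auto
      show ?thesis
      proof (cases "w x < x")
        case True
        have "x \<le> i \<or> e \<le> w x"
          using xi cyclic_pred_less[OF f(2) True, of e] fe 4 by auto
        then have "y \<le> w x \<or> x \<le> y" if "g y = g x" for y
          using that 4 fwx block[of y] je i cyclic_pred_less[OF f(2) True, of y]
          by (auto simp: g_def split: if_splits)
        then show ?thesis
          using 4 wx fwx True xc i by (auto simp: g_def)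
      next
        case False
        then have xw: "x \<le> w x" by simp
        have "x \<le> i" "e \<le> w x"
          using cyclic_pred_ge[OF f(2) xw, of e] cyclic_pred_ge[OF f(2) xw, of i] fe 4 by auto
        then have "x \<le> y \<and> y \<le> w x" if "g y = g x" for y
          using that 4 fwx block[of y] je i cyclic_pred_ge[OF f(2) xw, of y]
          by (auto simp: g_def split: if_splits)
        then show ?thesis
          using 4 wx fwx False xc i by (auto simp: g_def)
      qed
    next
      case 5
      then have wx': "?w x = w x"
        using wx fe by auto
      have gx: "g y = g x \<longleftrightarrow> f y = f x" for y
        using 5 by (auto simp: g_def)
      show ?thesis
        unfolding wx' gx using f(2) unfolding cyclic_pred_def by blast
    qed
  qed
  ultimately have "Transposition.transpose i j \<circ> w \<in> NC"
    by (rule cyclic_pred_NC)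
  then show ?thesis
    using i cj je inv_j unfolding Inv_NC_def j_def e_def by auto
qed

subsection \<open>Dimension of irreducible zero sets in a torus\<close>

lemma homogeneous_system_nontrivial:
  fixes a :: "'a \<Rightarrow> 'b \<Rightarrow> 'k::field"
  assumes "finite B" "finite A" "card B < card A"
  shows "\<exists>c. (\<exists>x\<in>A. c x \<noteq> 0) \<and> (\<forall>y\<in>B. (\<Sum>x\<in>A. c x * a x y) = 0)"
  using assms
proof (induction B arbitrary: A a rule: finite_induct)
  case empty
  then obtain x where "x \<in> A"
    by fastforce
  then show ?case
    by (intro exI[of _ "\<lambda>_. 1"]) auto
next
  case (insert b B)
  show ?case
  proof (cases "\<forall>x\<in>A. a x b = 0")
    case True
    have "card B < card A"
      using insert by simp
    then obtain c where "\<exists>x\<in>A. c x \<noteq> 0" "\<forall>y\<in>B. (\<Sum>x\<in>A. c x * a x y) = 0"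
      using insert.IH[of A a] insert.prems(1) by blast
    then show ?thesis
      using True by (intro exI[of _ c]) auto
  next
    case False
    then obtain p where p: "p \<in> A" "a p b \<noteq> 0"
      by blast
    define a' where "a' x y = a x y - a x b / a p b * a p y" for x y
    have "card B < card (A - {p})"
      using insert p by simp
    then obtain c where c: "\<exists>x\<in>A-{p}. c x \<noteq> 0" "\<forall>y\<in>B. (\<Sum>x\<in>A-{p}. c x * a' x y) = 0"
      using insert.IH[of "A - {p}" a'] insert.prems(1) by blast
    define d where "d x = (if x = p then - (\<Sum>x\<in>A-{p}. c x * a x b) / a p b else c x)" for x
    have d: "(\<Sum>x\<in>A. d x * a x y) = (\<Sum>x\<in>A-{p}. c x * a' x y)" for y
    proof -
      have "(\<Sum>x\<in>A. d x * a x y) = d p * a p y + (\<Sum>x\<in>A-{p}. d x * a x y)"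
        using insert.prems(1) p by (simp add: sum.remove)
      also have "(\<Sum>x\<in>A-{p}. d x * a x y) = (\<Sum>x\<in>A-{p}. c x * a x y)"
        by (intro sum.cong) (auto simp: d_def)
      also have "d p * a p y = - (\<Sum>x\<in>A-{p}. c x * (a x b / a p b * a p y))"
        by (simp add: d_def sum_distrib_right sum_divide_distrib mult.assoc)
      also have "\<dots> + (\<Sum>x\<in>A-{p}. c x * a x y) = (\<Sum>x\<in>A-{p}. c x * a' x y)"
        by (simp add: a'_def right_diff_distrib sum_subtractf)
      finally show ?thesis .
    qed
    have "a' x b = 0" for x
      using p by (simp add: a'_def)
    then have "(\<Sum>x\<in>A. d x * a x b) = 0"
      by (simp add: d)
    then show ?thesis
      using c d by (intro exI[of _ d]) (auto simp: d_def)
  qed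
qed

section \<open>Algebraic independence of polynomial functions and degree counting\<close>

inductive vec_polynomial :: "(complex ^ 'n \<Rightarrow> complex) \<Rightarrow> bool" where
  const: "vec_polynomial (\<lambda>t. c)"
| coord: "vec_polynomial (\<lambda>t. t $ i)"
| add: "vec_polynomial f \<Longrightarrow> vec_polynomial g \<Longrightarrow> vec_polynomial (\<lambda>t. f t + g t)"
| mult: "vec_polynomial f \<Longrightarrow> vec_polynomial g \<Longrightarrow> vec_polynomial (\<lambda>t. f t * g t)"

text \<open>
  \<open>power_combination hs D c\<close> evaluates at \<open>hs\<close> the polynomial of degree at most \<open>D\<close> in each
  variable whose coefficient at the exponent list \<open>l\<close> is \<open>c l\<close>.
\<close>

fun power_combination :: "('a \<Rightarrow> complex) list \<Rightarrow> nat \<Rightarrow> (nat list \<Rightarrow> complex) \<Rightarrow> 'a \<Rightarrow> complex" where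
  "power_combination [] D c t = c []"
| "power_combination (h # hs) D c t =
     (\<Sum>a\<le>D. h t ^ a * power_combination hs D (\<lambda>l. c (a # l)) t)"

definition algebraically_independent :: "'a set \<Rightarrow> ('a \<Rightarrow> complex) list \<Rightarrow> bool" where
  "algebraically_independent Z hs \<longleftrightarrow>
     (\<forall>D c. (\<forall>t\<in>Z. power_combination hs D c t = 0) \<longrightarrow>
        (\<forall>l. set l \<subseteq> {..D} \<and> length l = length hs \<longrightarrow> c l = 0))"

lemma vec_polynomial_sum:
  "(\<And>i. i \<in> I \<Longrightarrow> vec_polynomial (f i)) \<Longrightarrow> vec_polynomial (\<lambda>t. \<Sum>i\<in>I. f i t)"
  by (induction I rule: infinite_finite_induct) (simp_all add: vec_polynomial.const vec_polynomial.add)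

lemma vec_polynomial_power: "vec_polynomial f \<Longrightarrow> vec_polynomial (\<lambda>t. f t ^ k)"
  by (induction k) (simp_all add: vec_polynomial.const vec_polynomial.mult)

lemma vec_polynomial_power_combination:
  "\<forall>h\<in>set hs. vec_polynomial h \<Longrightarrow> vec_polynomial (power_combination hs D c)"
proof (induction hs arbitrary: c)
  case Nil
  have "power_combination [] D c = (\<lambda>t. c [])"
    by (simp add: fun_eq_iff)
  then show ?case
    by (simp add: vec_polynomial.const)
next
  case (Cons h hs)
  then have "vec_polynomial (\<lambda>t. \<Sum>a\<le>D. h t ^ a * power_combination hs D (\<lambda>l. c (a # l)) t)"
    by (intro vec_polynomial_sum vec_polynomial.mult vec_polynomial_power) auto
  moreover have "power_combination (h # hs) D c =
      (\<lambda>t. \<Sum>a\<le>D. h t ^ a * power_combination hs D (\<lambda>l. c (a # l)) t)"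
    by (simp add: fun_eq_iff)
  ultimately show ?case by simp
qed

text \<open>
  If \<open>\<Sum>\<^sub>a h\<^sup>a g\<^sub>a\<close> vanishes on \<open>Z'\<close>, then restriction to \<open>Z\<close> gives \<open>g\<^sub>0 = 0\<close>, and irreducibility
  of \<open>Z'\<close> allows to cancel one factor \<open>h\<close>.
\<close>

lemma algebraically_independent_Cons:
  fixes hs :: "(complex ^ 'n \<Rightarrow> complex) list"
  assumes indep: "algebraically_independent Z hs" and "Z \<subseteq> Z'"
    and irred: "\<And>f g. vec_polynomial f \<Longrightarrow> vec_polynomial g \<Longrightarrow> \<forall>t\<in>Z'. f t * g t = 0 \<Longrightarrow>
                  (\<forall>t\<in>Z'. f t = 0) \<or> (\<forall>t\<in>Z'. g t = 0)"
    and h: "vec_polynomial h" "\<forall>t\<in>Z. h t = 0" "\<exists>t\<in>Z'. h t \<noteq> 0"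
    and hs: "\<forall>h\<in>set hs. vec_polynomial h"
  shows "algebraically_independent Z' (h # hs)"
proof -
  have key: "\<forall>a\<le>m. \<forall>l. set l \<subseteq> {..D} \<and> length l = length hs \<longrightarrow> c a l = 0"
    if "\<forall>t\<in>Z'. (\<Sum>a\<le>m. h t ^ a * power_combination hs D (c a) t) = 0" for m D c
    using that
  proof (induction m arbitrary: c)
    case 0
    then have "\<forall>t\<in>Z. power_combination hs D (c 0) t = 0"
      using \<open>Z \<subseteq> Z'\<close> by auto
    then show ?case
      using indep unfolding algebraically_independent_def by simp
  next
    case (Suc m)
    define g where "g t = (\<Sum>a\<le>m. h t ^ a * power_combination hs D (c (Suc a)) t)" for t
    have sum: "(\<Sum>a\<le>Suc m. h t ^ a * power_combination hs D (c a) t) =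
        power_combination hs D (c 0) t + h t * g t" for t
      by (simp add: sum.atMost_Suc_shift g_def sum_distrib_left mult.assoc del: sum.atMost_Suc)
    have "\<forall>t\<in>Z. power_combination hs D (c 0) t = 0"
    proof
      fix t assume "t \<in> Z"
      then show "power_combination hs D (c 0) t = 0"
        using Suc.prems[unfolded sum] h(2) \<open>Z \<subseteq> Z'\<close> by (auto dest!: bspec[where x = t])
    qed
    then have c0: "c 0 l = 0" if "set l \<subseteq> {..D}" "length l = length hs" for l
      using indep that unfolding algebraically_independent_def by blast
    have zero: "power_combination hs' D c' t = 0"
      if "\<And>l. set l \<subseteq> {..D} \<Longrightarrow> length l = length hs' \<Longrightarrow> c' l = 0" for hs' c' and t :: "complex ^ 'n"
      using that by (induction hs' arbitrary: c') auto
    have "\<forall>t\<in>Z'. h t * g t = 0"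
      using Suc.prems[unfolded sum] zero[of hs "c 0"] c0 by auto
    moreover have "vec_polynomial g"
      unfolding g_def using hs h(1)
      by (intro vec_polynomial_sum vec_polynomial.mult vec_polynomial_power vec_polynomial_power_combination)
    ultimately have "\<forall>t\<in>Z'. g t = 0"
      using irred[OF h(1)] h(3) by blast
    then have IH: "\<forall>a\<le>m. \<forall>l. set l \<subseteq> {..D} \<and> length l = length hs \<longrightarrow> c (Suc a) l = 0"
      by (intro Suc.IH) (simp add: g_def)
    show ?case
    proof (intro allI impI)
      fix a l assume "a \<le> Suc m" "set l \<subseteq> {..D} \<and> length l = length hs"
      then show "c a l = 0"
        using c0 IH by (cases a) auto
    qed
  qed
  show ?thesis
    unfolding algebraically_independent_def
  proof (intro allI impI; elim conjE)
    fix D c l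
    assume "\<forall>t\<in>Z'. power_combination (h # hs) D c t = 0" and l: "set l \<subseteq> {..D}" "length l = length (h # hs)"
    then have "\<forall>a\<le>D. \<forall>l. set l \<subseteq> {..D} \<and> length l = length hs \<longrightarrow> c (a # l) = 0"
      by (intro key) simp
    with l show "c l = 0"
      by (cases l) auto
  qed
qed

text \<open>Only the restriction to \<open>T\<close> is recorded. Where the coordinates outside
  \<open>I\<close> equal 1, every polynomial can thus be written in \<open>card I\<close> variables,
  and this number governs the count of coefficients.\<close>

definition bounded_degree :: "'n set \<Rightarrow> nat \<Rightarrow> (complex ^ 'n) set \<Rightarrow> (complex ^ 'n \<Rightarrow> complex) \<Rightarrow> bool" where
  "bounded_degree I e T f \<longleftrightarrow>
     (\<exists>a. \<forall>t\<in>T. f t = (\<Sum>b\<in>I \<rightarrow>\<^sub>E {..e}. a b * (\<Prod>i\<in>I. t $ i ^ b i)))"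

lemma bounded_degree_sum:
  assumes "\<And>x. x \<in> X \<Longrightarrow> bounded_degree I e T (f x)"
  shows "bounded_degree I e T (\<lambda>t. \<Sum>x\<in>X. f x t)"
proof -
  have "\<forall>x\<in>X. \<exists>a. \<forall>t\<in>T. f x t = (\<Sum>b\<in>I \<rightarrow>\<^sub>E {..e}. a b * (\<Prod>i\<in>I. t $ i ^ b i))"
    using assms unfolding bounded_degree_def by blast
  from bchoice[OF this] obtain a where
    a: "\<forall>x\<in>X. \<forall>t\<in>T. f x t = (\<Sum>b\<in>I \<rightarrow>\<^sub>E {..e}. a x b * (\<Prod>i\<in>I. t $ i ^ b i))" ..
  have "(\<Sum>x\<in>X. f x t) = (\<Sum>b\<in>I \<rightarrow>\<^sub>E {..e}. (\<Sum>x\<in>X. a x b) * (\<Prod>i\<in>I. t $ i ^ b i))" if "t \<in> T" for t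
  proof -
    have "(\<Sum>x\<in>X. f x t) = (\<Sum>x\<in>X. \<Sum>b\<in>I \<rightarrow>\<^sub>E {..e}. a x b * (\<Prod>i\<in>I. t $ i ^ b i))"
      using a that by simp
    also have "\<dots> = (\<Sum>b\<in>I \<rightarrow>\<^sub>E {..e}. \<Sum>x\<in>X. a x b * (\<Prod>i\<in>I. t $ i ^ b i))"
      by (rule sum.swap)
    finally show ?thesis
      by (simp add: sum_distrib_right)
  qed
  then show ?thesis
    unfolding bounded_degree_def by (intro exI[of _ "\<lambda>b. \<Sum>x\<in>X. a x b"]) simp
qed

lemma bounded_degree_monomial:
  fixes I :: "'n::finite set"
  assumes "\<And>i. i \<in> I \<Longrightarrow> d i \<le> e"
  shows "bounded_degree I e T (\<lambda>t. c * (\<Prod>i\<in>I. t $ i ^ d i))"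
proof -
  have fin: "finite (I \<rightarrow>\<^sub>E {..e})"
    by (rule finite_PiE) auto
  have mem: "restrict d I \<in> I \<rightarrow>\<^sub>E {..e}"
    using assms by auto
  have "(\<Sum>b\<in>I \<rightarrow>\<^sub>E {..e}. (if b = restrict d I then c else 0) * (\<Prod>i\<in>I. t $ i ^ b i)) =
      (\<Sum>b\<in>I \<rightarrow>\<^sub>E {..e}. if b = restrict d I then c * (\<Prod>i\<in>I. t $ i ^ d i) else 0)" for t :: "complex ^ 'n"
    by (intro sum.cong) auto
  then have "c * (\<Prod>i\<in>I. t $ i ^ d i) =
      (\<Sum>b\<in>I \<rightarrow>\<^sub>E {..e}. (if b = restrict d I then c else 0) * (\<Prod>i\<in>I. t $ i ^ b i))" for t :: "complex ^ 'n"
    using fin mem by simp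
  then show ?thesis
    unfolding bounded_degree_def by (intro exI[of _ "\<lambda>b. if b = restrict d I then c else 0"]) simp
qed

lemma bounded_degree_mult:
  fixes I :: "'n::finite set"
  assumes "bounded_degree I e T f" "bounded_degree I e' T g"
  shows "bounded_degree I (e + e') T (\<lambda>t. f t * g t)"
proof -
  obtain a where a: "\<And>t. t \<in> T \<Longrightarrow> f t = (\<Sum>b\<in>I \<rightarrow>\<^sub>E {..e}. a b * (\<Prod>i\<in>I. t $ i ^ b i))"
    using assms(1) unfolding bounded_degree_def by blast
  obtain a' where a': "\<And>t. t \<in> T \<Longrightarrow> g t = (\<Sum>b\<in>I \<rightarrow>\<^sub>E {..e'}. a' b * (\<Prod>i\<in>I. t $ i ^ b i))"
    using assms(2) unfolding bounded_degree_def by blast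
  let ?h = "\<lambda>t. \<Sum>b\<in>I \<rightarrow>\<^sub>E {..e}. \<Sum>b'\<in>I \<rightarrow>\<^sub>E {..e'}. (a b * a' b') * (\<Prod>i\<in>I. t $ i ^ (b i + b' i))"
  have "bounded_degree I (e + e') T ?h"
  proof (intro bounded_degree_sum bounded_degree_monomial)
    fix b b' i assume "b \<in> I \<rightarrow>\<^sub>E {..e}" "b' \<in> I \<rightarrow>\<^sub>E {..e'}" "i \<in> I"
    then have "b i \<in> {..e}" "b' i \<in> {..e'}"
      by (auto simp: PiE_iff)
    then show "b i + b' i \<le> e + e'"
      by simp
  qed
  moreover have "f t * g t = ?h t" if "t \<in> T" for t
    unfolding a[OF that] a'[OF that] sum_product power_add prod.distrib
    by (intro sum.cong refl) (simp add: mult_ac)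
  ultimately show ?thesis
    unfolding bounded_degree_def by simp
qed

lemma bounded_degree_mono:
  fixes I :: "'n::finite set"
  assumes "bounded_degree I e T f" "e \<le> e'"
  shows "bounded_degree I e' T f"
  using bounded_degree_mult[OF assms(1) bounded_degree_monomial[of I "\<lambda>_. 0" "e' - e" T 1]] assms(2)
  by simp

lemma bounded_degree_add:
  assumes "bounded_degree I e T f" "bounded_degree I e T g"
  shows "bounded_degree I e T (\<lambda>t. f t + g t)"
  using bounded_degree_sum[of UNIV I e T "\<lambda>b. if b then f else g"] assms by (simp add: UNIV_bool add.commute)

lemma bounded_degree_vec_polynomial:
  fixes T :: "(complex ^ 'n::finite) set"
  assumes "vec_polynomial f" and T: "\<And>t i. t \<in> T \<Longrightarrow> i \<notin> I \<Longrightarrow> t $ i = 1"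
  shows "\<exists>e. bounded_degree I e T f"
  using assms(1)
proof induction
  case (const c)
  show ?case
    using bounded_degree_monomial[of I "\<lambda>_. 0" 0 T c] by auto
next
  case (coord j)
  have "t $ j = (\<Prod>i\<in>I. t $ i ^ (if i = j then 1 else 0))" if "t \<in> T" for t
  proof -
    have "(\<Prod>i\<in>I. t $ i ^ (if i = j then 1 else 0)) = (\<Prod>i\<in>I. if i = j then t $ j else 1)"
      by (intro prod.cong) auto
    then show ?thesis
      using T[OF that, of j] by simp
  qed
  moreover have "bounded_degree I 1 T (\<lambda>t. 1 * (\<Prod>i\<in>I. t $ i ^ (if i = j then 1 else 0)))"
    by (rule bounded_degree_monomial) auto
  ultimately have "bounded_degree I 1 T (\<lambda>t. t $ j)"
    unfolding bounded_degree_def by simp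
  then show ?case by blast
next
  case (add f g)
  then obtain e e' where e: "bounded_degree I e T f" "bounded_degree I e' T g"
    by blast
  then have "bounded_degree I (max e e') T f" "bounded_degree I (max e e') T g"
    by (auto elim!: bounded_degree_mono)
  then show ?case
    using bounded_degree_add by blast
next
  case (mult f g)
  then show ?case
    using bounded_degree_mult by blast
qed

lemma power_combination_sum:
  "power_combination hs D c t =
     (\<Sum>l | set l \<subseteq> {..D} \<and> length l = length hs. c l * prod_list (map2 (\<lambda>h a. h t ^ a) hs l))"
proof (induction hs arbitrary: c)
  case Nil
  have "{l::nat list. set l \<subseteq> {..D} \<and> length l = length ([]::('a \<Rightarrow> complex) list)} = {[]}"
    by auto
  then show ?case by simp
next
  case (Cons h hs)
  let ?A = "{l. set l \<subseteq> {..D} \<and> length l = length hs}"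
  have eq: "{l. set l \<subseteq> {..D} \<and> length l = length (h # hs)} = (\<lambda>(a, l). a # l) ` ({..D} \<times> ?A)"
    by (auto simp: image_iff length_Suc_conv)
  have "power_combination (h # hs) D c t = (\<Sum>a\<le>D. \<Sum>l\<in>?A. h t ^ a * (c (a # l) * prod_list (map2 (\<lambda>h a. h t ^ a) hs l)))"
    by (simp add: Cons.IH sum_distrib_left)
  also have "\<dots> = (\<Sum>(a, l)\<in>{..D} \<times> ?A. h t ^ a * (c (a # l) * prod_list (map2 (\<lambda>h a. h t ^ a) hs l)))"
    by (rule sum.cartesian_product)
  also have "\<dots> = (\<Sum>l | set l \<subseteq> {..D} \<and> length l = length (h # hs). c l * prod_list (map2 (\<lambda>h a. h t ^ a) (h # hs) l))"
    unfolding eq by (subst sum.reindex) (auto simp: inj_on_def mult_ac intro!: sum.cong)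
  finally show ?case .
qed

text \<open>There are more monomials of degree at most \<open>D\<close> in \<open>hs\<close> than coefficients available for them.\<close>

lemma algebraically_independent_length:
  fixes T :: "(complex ^ 'n::finite) set"
  assumes "algebraically_independent Z hs" "Z \<subseteq> T" "\<forall>h\<in>set hs. vec_polynomial h"
    and T: "\<And>t i. t \<in> T \<Longrightarrow> i \<notin> I \<Longrightarrow> t $ i = 1"
  shows "length hs \<le> card I"
proof (rule ccontr)
  assume "\<not> length hs \<le> card I"
  then have less: "card I < length hs" by simp
  have "\<exists>e. \<forall>h\<in>set hs. bounded_degree I e T h"
    using assms(3)
  proof (induction hs)
    case (Cons h hs)
    then obtain e where e: "\<forall>h\<in>set hs. bounded_degree I e T h"
      by auto
    have "\<exists>e'. bounded_degree I e' T h"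
      using Cons.prems T by (intro bounded_degree_vec_polynomial) auto
    then obtain e' where e': "bounded_degree I e' T h"
      by blast
    have "\<forall>h\<in>set (h # hs). bounded_degree I (max e e') T h"
      using e e' by (metis bounded_degree_mono max.cobounded1 max.cobounded2 set_ConsD)
    then show ?case by blast
  qed simp
  then obtain e where e: "\<forall>h\<in>set hs. bounded_degree I e T h"
    by blast
  define k where "k = length hs"
  \<comment> \<open>Chosen so that the count closes: the products have degree at most
    \<open>E = k * (D * e)\<close>, hence at most ((k e + 1)(D + 1))^|I| = D (D + 1)^|I|
    coefficients, fewer than the (D + 1)^k products because k > |I|.\<close>
  define D where "D = (k * e + 1) ^ card I"
  define E where "E = k * (D * e)"
  define A where "A = {l. set l \<subseteq> {..D} \<and> length l = k}"
  define B where "B = (I \<rightarrow>\<^sub>E {..E})"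
  have pow: "bounded_degree I (a * e) T (\<lambda>t. h t ^ a)" if "h \<in> set hs" for h a
  proof (induction a)
    case 0
    show ?case
      using bounded_degree_monomial[of I "\<lambda>_. 0" 0 T 1] by simp
  next
    case (Suc a)
    then show ?case
      using bounded_degree_mult[of I e T h "a * e" "\<lambda>t. h t ^ a"] e that by simp
  qed
  have mon: "bounded_degree I (length gs * (D * e)) T (\<lambda>t. prod_list (map2 (\<lambda>h a. h t ^ a) gs l))"
    if "set l \<subseteq> {..D}" "set gs \<subseteq> set hs" "length l = length gs" for gs l
    using that
  proof (induction gs arbitrary: l)
    case Nil
    show ?case
      using bounded_degree_monomial[of I "\<lambda>_. 0" 0 T 1] by simp
  next
    case (Cons g gs)
    then obtain a l' where l: "l = a # l'"
      by (cases l) auto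
    have "bounded_degree I (D * e) T (\<lambda>t. g t ^ a)"
      using Cons.prems l by (intro bounded_degree_mono[OF pow]) auto
    from bounded_degree_mult[OF this Cons.IH[of l']] show ?case
      using Cons.prems l by simp
  qed
  have "\<forall>l\<in>A. \<exists>a. \<forall>t\<in>T. prod_list (map2 (\<lambda>h a. h t ^ a) hs l) = (\<Sum>b\<in>B. a b * (\<Prod>i\<in>I. t $ i ^ b i))"
    using mon[OF _ order_refl] unfolding A_def B_def E_def k_def bounded_degree_def by simp
  from bchoice[OF this] obtain a where a: "\<forall>l\<in>A. \<forall>t\<in>T.
      prod_list (map2 (\<lambda>h a. h t ^ a) hs l) = (\<Sum>b\<in>B. a l b * (\<Prod>i\<in>I. t $ i ^ b i))" ..
  have fin: "finite A" "finite B"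
    unfolding A_def B_def by (auto intro: finite_lists_length_eq finite_PiE)
  have "card B = (E + 1) ^ card I"
    unfolding B_def by (simp add: card_PiE)
  also have "\<dots> \<le> ((k * e + 1) * (D + 1)) ^ card I"
    by (intro power_mono) (auto simp: E_def algebra_simps)
  also have "\<dots> = D * (D + 1) ^ card I"
    unfolding power_mult_distrib D_def ..
  also have "\<dots> < (D + 1) ^ Suc (card I)"
    by simp
  also have "\<dots> \<le> (D + 1) ^ k"
    using less unfolding k_def by (intro power_increasing) auto
  also have "\<dots> = card A"
    unfolding A_def by (subst card_lists_length_eq) auto
  finally have "card B < card A" .
  then obtain c where c: "\<exists>l\<in>A. c l \<noteq> 0" "\<forall>b\<in>B. (\<Sum>l\<in>A. c l * a l b) = 0"
    using homogeneous_system_nontrivial[OF fin(2,1)] by blast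
  have "power_combination hs D c t = 0" if "t \<in> Z" for t
  proof -
    have "power_combination hs D c t = (\<Sum>l\<in>A. c l * prod_list (map2 (\<lambda>h a. h t ^ a) hs l))"
      unfolding power_combination_sum A_def k_def ..
    also have "\<dots> = (\<Sum>l\<in>A. c l * (\<Sum>b\<in>B. a l b * (\<Prod>i\<in>I. t $ i ^ b i)))"
      using a that assms(2) by (intro sum.cong) auto
    also have "\<dots> = (\<Sum>l\<in>A. \<Sum>b\<in>B. c l * a l b * (\<Prod>i\<in>I. t $ i ^ b i))"
      by (simp add: sum_distrib_left mult.assoc)
    also have "\<dots> = (\<Sum>b\<in>B. \<Sum>l\<in>A. c l * a l b * (\<Prod>i\<in>I. t $ i ^ b i))"
      by (rule sum.swap)
    also have "\<dots> = (\<Sum>b\<in>B. (\<Sum>l\<in>A. c l * a l b) * (\<Prod>i\<in>I. t $ i ^ b i))"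
      by (simp add: sum_distrib_right)
    also have "\<dots> = 0"
      using c(2) by simp
    finally show ?thesis .
  qed
  then show False
    using assms(1) c(1) unfolding algebraically_independent_def A_def k_def by blast
qed

section \<open>Irreducibility and dimension of slices of the torus\<close>

lemma vec_polynomial_line:
  assumes "vec_polynomial h"
  shows "\<exists>p. \<forall>s. h (\<chi> i. x $ i + s * y $ i) = poly p s"
  using assms
proof induction
  case (const c)
  show ?case by (rule exI[of _ "[:c:]"]) simp
next
  case (coord i)
  show ?case by (rule exI[of _ "[:x $ i, y $ i:]"]) simp
next
  case (add f g)
  then obtain p q where "\<forall>s. f (\<chi> i. x $ i + s * y $ i) = poly p s" "\<forall>s. g (\<chi> i. x $ i + s * y $ i) = poly q s"
    by blast
  then show ?case by (intro exI[of _ "p + q"]) simp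
next
  case (mult f g)
  then obtain p q where "\<forall>s. f (\<chi> i. x $ i + s * y $ i) = poly p s" "\<forall>s. g (\<chi> i. x $ i + s * y $ i) = poly q s"
    by blast
  then show ?case by (intro exI[of _ "p * q"]) simp
qed

text \<open>A torus of dimension \<open>card I\<close> inside the full coordinate space, so that an
  orbit and all members of a chain of subtori are parametrized within one type.\<close>

definition slice_torus :: "'n set \<Rightarrow> (complex ^ 'n) set" where
  "slice_torus I = {t. (\<forall>i. t $ i \<noteq> 0) \<and> (\<forall>i. i \<notin> I \<longrightarrow> t $ i = 1)}"

text \<open>On the line through \<open>t\<close> and \<open>t'\<close> both polynomials and all
  coordinates are nonzero univariate polynomials, so all but finitely many of its points
  serve.\<close>

lemma slice_torus_irreducible:
  fixes h h' :: "complex ^ 'n::finite \<Rightarrow> complex"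
  assumes "vec_polynomial h" "vec_polynomial h'"
    and t: "t \<in> slice_torus I" "h t \<noteq> 0" and t': "t' \<in> slice_torus I" "h' t' \<noteq> 0"
  shows "\<exists>u\<in>slice_torus I. h u \<noteq> 0 \<and> h' u \<noteq> 0"
proof -
  define y where "y = t' - t"
  define u where "u s = (\<chi> i. t $ i + s * y $ i)" for s
  have u: "u 0 = t" "u 1 = t'"
    by (simp_all add: u_def y_def vec_eq_iff)
  obtain p p' where p: "\<And>s. h (u s) = poly p s" "\<And>s. h' (u s) = poly p' s"
    using vec_polynomial_line[OF assms(1), of t y] vec_polynomial_line[OF assms(2), of t y]
    unfolding u_def by blast
  define q where "q = p * p' * (\<Prod>i\<in>UNIV. [:t $ i, y $ i:])"
  have "p \<noteq> 0" "p' \<noteq> 0"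
    using p(1)[of 0] p(2)[of 1] u t t' by auto
  moreover have "[:t $ i, y $ i:] \<noteq> 0" for i
    using t(1) by (simp add: slice_torus_def)
  ultimately have "q \<noteq> 0"
    by (simp add: q_def)
  then have "finite {s. poly q s = 0}"
    by (rule poly_roots_finite)
  then obtain s where "poly q s \<noteq> 0"
    using ex_new_if_finite[OF infinite_UNIV_char_0] by blast
  then have s: "poly p s \<noteq> 0" "poly p' s \<noteq> 0" "\<And>i. t $ i + s * y $ i \<noteq> 0"
    by (auto simp: q_def poly_prod)
  have "u s \<in> slice_torus I"
    using s(3) t(1) t'(1) by (simp add: slice_torus_def u_def y_def)
  then show ?thesis
    using s p by (intro bexI[of _ "u s"]) auto
qed

text \<open>The last two assumptions make \<open>\<phi>\<close> a homeomorphism from the slice onto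
  \<open>X\<close>. Upper bound: each strict inclusion in a chain supplies a polynomial vanishing on
  the smaller set but not on the larger, which extends an algebraically independent list by one.
  Lower bound: free the coordinates of \<open>I\<close> one at a time.\<close>

lemma krull_dim_slice_torus:
  fixes \<phi> :: "complex ^ 'n::finite \<Rightarrow> 'a"
  assumes inj: "inj_on \<phi> (slice_torus I)" and img: "\<phi> ` slice_torus I = topspace X"
    and pull: "\<And>A. closedin X A \<Longrightarrow>
      \<exists>S. (\<forall>h\<in>S. vec_polynomial h) \<and> (\<forall>t\<in>slice_torus I. \<phi> t \<in> A \<longleftrightarrow> (\<forall>h\<in>S. h t = 0))"
    and push: "\<And>h. vec_polynomial h \<Longrightarrow> closedin X (\<phi> ` {t \<in> slice_torus I. h t = 0})"
  shows "krull_dim X = enat (card I)"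
proof (rule antisym)
  have lift: "\<exists>t\<in>slice_torus I. \<phi> t = z" if "z \<in> topspace X" for z
    using that unfolding img[symmetric] by auto
  define lengths where "lengths = {enat k | k. \<exists>Z :: nat \<Rightarrow> 'a set.
     (\<forall>i\<le>k. closedin X (Z i) \<and> irreducible_space (subtopology X (Z i))) \<and>
     (\<forall>i<k. Z i \<subset> Z (Suc i))}"
  have krull: "krull_dim X = Sup lengths"
    unfolding krull_dim_def lengths_def ..
  show "krull_dim X \<le> enat (card I)"
    unfolding krull
  proof (rule Sup_least)
    fix x assume "x \<in> lengths"
    then obtain k Z where k: "x = enat k"
      and Z: "\<And>i. i \<le> k \<Longrightarrow> closedin X (Z i) \<and> irreducible_space (subtopology X (Z i))"
        "\<And>i. i < k \<Longrightarrow> Z i \<subset> Z (Suc i)"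
      unfolding lengths_def by blast
    define Y where "Y i = {t \<in> slice_torus I. \<phi> t \<in> Z i}" for i
    have sub: "Z i \<subseteq> topspace X" if "i \<le> k" for i
      using Z(1)[OF that] closedin_subset by blast
    have "\<exists>hs. length hs = j \<and> (\<forall>h\<in>set hs. vec_polynomial h) \<and> algebraically_independent (Y j) hs"
      if "j \<le> k" for j
      using that
    proof (induction j)
      case 0
      have "topspace (subtopology X (Z 0)) \<noteq> {}"
        using Z(1)[of 0] unfolding irreducible_space_def by blast
      then obtain z where "z \<in> topspace X" "z \<in> Z 0"
        by auto
      then obtain t where "t \<in> Y 0"
        using lift[of z] by (auto simp: Y_def)
      then show ?case
        by (intro exI[of _ "[]"]) (auto simp: algebraically_independent_def)
    next
      case (Suc j)
      then obtain hs where hs: "length hs = j" "\<forall>h\<in>set hs. vec_polynomial h"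
          "algebraically_independent (Y j) hs"
        by auto
      have strict: "Z j \<subset> Z (Suc j)"
        using Z(2) Suc.prems by simp
      have "closedin X (Z j)"
        using Z(1)[of j] Suc.prems by simp
      from pull[OF this] obtain S where
        S: "\<forall>h\<in>S. vec_polynomial h" "\<forall>t\<in>slice_torus I. \<phi> t \<in> Z j \<longleftrightarrow> (\<forall>h\<in>S. h t = 0)"
        by (elim exE conjE)
      obtain x where x: "x \<in> Z (Suc j)" "x \<notin> Z j"
        using strict by blast
      then obtain t where t: "t \<in> slice_torus I" "\<phi> t = x"
        using lift[of x] sub[OF Suc.prems] by auto
      then obtain h where h: "h \<in> S" "h t \<noteq> 0"
        using S(2) x(2) by auto
      have "algebraically_independent (Y (Suc j)) (h # hs)"
      proof (rule algebraically_independent_Cons[OF hs(3)])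
        show "Y j \<subseteq> Y (Suc j)"
          using strict unfolding Y_def by blast
        show "vec_polynomial h" "\<forall>t\<in>Y j. h t = 0"
          using S h by (auto simp: Y_def)
        show "\<exists>t\<in>Y (Suc j). h t \<noteq> 0"
          using t x h by (auto simp: Y_def)
        show "\<forall>h\<in>set hs. vec_polynomial h"
          by (fact hs(2))
        fix f g :: "complex ^ 'n \<Rightarrow> complex"
        assume fg: "vec_polynomial f" "vec_polynomial g" "\<forall>t\<in>Y (Suc j). f t * g t = 0"
        define C where "C f = \<phi> ` {t \<in> slice_torus I. f t = 0} \<inter> Z (Suc j)" for f :: "complex ^ 'n \<Rightarrow> complex"
        have top: "topspace (subtopology X (Z (Suc j))) = Z (Suc j)"
          using sub[OF Suc.prems] by auto
        have "closedin (subtopology X (Z (Suc j))) (C f)" "closedin (subtopology X (Z (Suc j))) (C g)"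
          using push fg unfolding closedin_subtopology C_def by blast+
        moreover have "Z (Suc j) = C f \<union> C g"
        proof
          show "Z (Suc j) \<subseteq> C f \<union> C g"
          proof
            fix z assume z: "z \<in> Z (Suc j)"
            then obtain t where "t \<in> slice_torus I" "\<phi> t = z"
              using lift[of z] sub[OF Suc.prems] by auto
            then show "z \<in> C f \<union> C g"
              using fg(3) z unfolding C_def Y_def by auto
          qed
        qed (auto simp: C_def)
        ultimately have "C f = Z (Suc j) \<or> C g = Z (Suc j)"
          using Z(1)[OF Suc.prems] unfolding irreducible_space_def top by blast
        moreover have "\<forall>t\<in>Y (Suc j). f t = 0" if "C f = Z (Suc j)" for f :: "complex ^ 'n \<Rightarrow> complex"
        proof
          fix t assume t: "t \<in> Y (Suc j)"
          then have "\<phi> t \<in> C f"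
            using that by (simp add: Y_def)
          then obtain t' where "t' \<in> slice_torus I" "f t' = 0" "\<phi> t = \<phi> t'"
            unfolding C_def by blast
          then show "f t = 0"
            using inj t by (auto simp: Y_def inj_on_def)
        qed
        ultimately show "(\<forall>t\<in>Y (Suc j). f t = 0) \<or> (\<forall>t\<in>Y (Suc j). g t = 0)"
          by blast
      qed
      then show ?case
        using hs S h by (intro exI[of _ "h # hs"]) auto
    qed
    then obtain hs where "length hs = k" "\<forall>h\<in>set hs. vec_polynomial h" "algebraically_independent (Y k) hs"
      by blast
    moreover have "Y k \<subseteq> slice_torus I"
      unfolding Y_def by blast
    moreover have "t $ i = 1" if "t \<in> slice_torus I" "i \<notin> I" for t i
      using that unfolding slice_torus_def by simp
    ultimately have "k \<le> card I"
      using algebraically_independent_length[of "Y k" hs "slice_torus I" I] by simp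
    then show "x \<le> enat (card I)"
      by (simp add: k)
  qed
  obtain e where e: "bij_betw e {..<card I} I"
    using ex_bij_betw_nat_finite[of I] by (auto simp: atLeast0LessThan)
  define Z where "Z k = \<phi> ` slice_torus (e ` {..<k})" for k
  have sub: "slice_torus (e ` {..<k}) \<subseteq> slice_torus I" if "k \<le> card I" for k
  proof -
    have "e ` {..<k} \<subseteq> I"
      using e that unfolding bij_betw_def by auto
    then show ?thesis
      unfolding slice_torus_def by blast
  qed
  have closed: "closedin X (Z k)" if "k \<le> card I" for k
  proof -
    let ?C = "\<lambda>i. \<phi> ` {t \<in> slice_torus I. t $ i + (- 1) = 0}"
    have "closedin X (topspace X \<inter> \<Inter> (?C ` (- e ` {..<k})))"
    proof (cases "- e ` {..<k} = {}")
      case False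
      have "closedin X (?C i)" for i
        by (intro push vec_polynomial.intros)
      then show ?thesis
        using False by (intro closedin_Int closedin_topspace closedin_Inter) auto
    qed simp
    moreover have "Z k = topspace X \<inter> \<Inter> (?C ` (- e ` {..<k}))"
    proof (intro equalityI subsetI)
      fix z assume "z \<in> Z k"
      then obtain t where t: "t \<in> slice_torus (e ` {..<k})" "z = \<phi> t"
        unfolding Z_def by blast
      then have "t \<in> slice_torus I"
        using sub[OF that] by blast
      moreover from this have "\<phi> t \<in> topspace X"
        unfolding img[symmetric] by blast
      moreover have "t $ i + (- 1) = 0" if "i \<notin> e ` {..<k}" for i
        using t that by (simp add: slice_torus_def)
      ultimately show "z \<in> topspace X \<inter> \<Inter> (?C ` (- e ` {..<k}))"
        unfolding t(2) by blast
    next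
      fix z assume z: "z \<in> topspace X \<inter> \<Inter> (?C ` (- e ` {..<k}))"
      then obtain t where t: "t \<in> slice_torus I" "\<phi> t = z"
        using lift[of z] by auto
      have "t $ i = 1" if "i \<notin> e ` {..<k}" for i
      proof -
        have "z \<in> ?C i"
          using z that by auto
        then obtain t' where "t' \<in> slice_torus I" "t' $ i + (- 1) = 0" "\<phi> t = \<phi> t'"
          using t by auto
        then show ?thesis
          using inj t by (auto simp: inj_on_def)
      qed
      then show "z \<in> Z k"
        using t unfolding Z_def slice_torus_def by blast
    qed
    ultimately show ?thesis by simp
  qed
  have irred: "irreducible_space (subtopology X (Z k))" if k: "k \<le> card I" for k
    unfolding irreducible_space_def
  proof (intro conjI allI impI)
    have top: "topspace (subtopology X (Z k)) = Z k"
      using closed[OF k] closedin_subset by fastforce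
    define W where "W = slice_torus (e ` {..<k})"
    have Zk: "Z k = \<phi> ` W" and WT: "W \<subseteq> slice_torus I"
      unfolding Z_def W_def using sub[OF k] by auto
    have "(\<chi> i. 1) \<in> W"
      by (simp add: W_def slice_torus_def)
    then show "topspace (subtopology X (Z k)) \<noteq> {}"
      unfolding top unfolding Zk by auto
    fix A B assume AB: "closedin (subtopology X (Z k)) A \<and> closedin (subtopology X (Z k)) B \<and>
        topspace (subtopology X (Z k)) = A \<union> B"
    then have Un: "\<phi> ` W = A \<union> B"
      unfolding top unfolding Zk by simp
    have polys: "\<exists>S. (\<forall>h\<in>S. vec_polynomial h) \<and> (\<forall>t\<in>W. \<phi> t \<in> A \<longleftrightarrow> (\<forall>h\<in>S. h t = 0))"
      if A: "closedin (subtopology X (Z k)) A" for A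
    proof -
      obtain C where C: "closedin X C" "A = C \<inter> \<phi> ` W"
        using A unfolding closedin_subtopology Zk by auto
      from pull[OF C(1)] obtain S where S: "\<forall>h\<in>S. vec_polynomial h"
          "\<forall>t\<in>slice_torus I. \<phi> t \<in> C \<longleftrightarrow> (\<forall>h\<in>S. h t = 0)"
        by (elim exE conjE)
      then show ?thesis
        using WT unfolding C(2) by (intro exI[of _ S]) auto
    qed
    have clA: "closedin (subtopology X (Z k)) A" and clB: "closedin (subtopology X (Z k)) B"
      using AB by auto
    from polys[OF clA] obtain S where S: "\<forall>h\<in>S. vec_polynomial h"
        "\<forall>t\<in>W. \<phi> t \<in> A \<longleftrightarrow> (\<forall>h\<in>S. h t = 0)"
      by (elim exE conjE)
    from polys[OF clB] obtain S' where S': "\<forall>h\<in>S'. vec_polynomial h"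
        "\<forall>t\<in>W. \<phi> t \<in> B \<longleftrightarrow> (\<forall>h\<in>S'. h t = 0)"
      by (elim exE conjE)
    show "A = topspace (subtopology X (Z k)) \<or> B = topspace (subtopology X (Z k))"
    proof (rule ccontr)
      assume "\<not> ?thesis"
      then have "A \<noteq> \<phi> ` W" "B \<noteq> \<phi> ` W"
        unfolding top unfolding Zk by auto
      moreover have "A \<subseteq> \<phi> ` W" "B \<subseteq> \<phi> ` W"
        unfolding Un by auto
      ultimately obtain t t' where t: "t \<in> W" "\<phi> t \<notin> A" and t': "t' \<in> W" "\<phi> t' \<notin> B"
        by (metis image_subsetI subset_antisym)
      obtain h where h: "h \<in> S" "h t \<noteq> 0"
        using S(2) t by auto
      obtain h' where h': "h' \<in> S'" "h' t' \<noteq> 0"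
        using S'(2) t' by auto
      have "\<exists>u\<in>W. h u \<noteq> 0 \<and> h' u \<noteq> 0"
        unfolding W_def using S(1) S'(1) h h' t(1) t'(1) unfolding W_def
        by (intro slice_torus_irreducible) auto
      then obtain u where u: "u \<in> W" "h u \<noteq> 0" "h' u \<noteq> 0"
        by auto
      then have "\<phi> u \<in> A \<union> B"
        unfolding Un[symmetric] by auto
      then show False
        using S(2) S'(2) u h(1) h'(1) by auto
    qed
  qed
  have strict: "Z k \<subset> Z (Suc k)" if k: "k < card I" for k
  proof
    show "Z k \<subseteq> Z (Suc k)"
      unfolding Z_def slice_torus_def lessThan_Suc by (intro image_mono) auto
    define t :: "complex ^ 'n" where "t = (\<chi> i. if i = e k then 2 else 1)"
    have t: "t \<in> slice_torus (e ` {..<Suc k})"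
      by (auto simp: t_def slice_torus_def)
    have "e k \<notin> e ` {..<k}"
    proof
      assume "e k \<in> e ` {..<k}"
      then obtain x where "x < k" "e k = e x"
        by auto
      then show False
        using inj_onD[OF bij_betw_imp_inj_on[OF e], of k x] k by simp
    qed
    then have "t \<notin> slice_torus (e ` {..<k})"
      by (auto simp: t_def slice_torus_def)
    then have "\<phi> t \<notin> Z k"
      unfolding Z_def using inj_on_image_mem_iff[OF inj, of t] t sub[of k] sub[of "Suc k"] k by auto
    then show "Z k \<noteq> Z (Suc k)"
      using t unfolding Z_def by blast
  qed
  have "enat (card I) \<in> lengths"
    unfolding lengths_def using closed irred strict by (intro CollectI exI[of _ "card I"] conjI refl exI[of _ Z]) auto
  then show "enat (card I) \<le> krull_dim X"
    unfolding krull by (rule Sup_upper)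
qed

subsection \<open>Invertible matrices and their columns\<close>

lemma matrix_range_subspace: "vec.subspace (range ((*v) (M :: complex ^ 'n ^ 'm)))"
  by (intro vec.linear_subspace_image matrix_vector_mul_linear_gen vec.subspace_UNIV)

lemma column_eq_mult_axis: "column j M = (M :: complex ^ 'n ^ 'm) *v axis j 1"
  by (simp add: vec_eq_iff column_def matrix_vector_mult_def axis_def if_distrib cong: if_cong)

lemma invertible_if_axes_in_span:
  fixes M :: "complex ^ 'n ^ 'n"
  assumes "\<And>i. axis i 1 \<in> vec.span (range (\<lambda>j. column j M))"
  shows "invertible M"
proof -
  have "vec.span (range (\<lambda>j. column j M)) \<subseteq> range ((*v) M)"
    by (intro vec.span_minimal matrix_range_subspace) (auto simp: column_eq_mult_axis)
  then have "\<forall>i. \<exists>z. M *v z = axis i 1"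
    using assms by (metis imageE subsetD)
  from choice[OF this] obtain b where b: "\<And>i. M *v b i = axis i 1"
    by auto
  have "M ** (\<chi> k i. b i $ k) = mat 1"
  proof -
    have "(M ** (\<chi> k i. b i $ k)) $ j $ i = (M *v b i) $ j" for i j
      by (simp add: matrix_matrix_mult_def matrix_vector_mult_def)
    then show ?thesis
      by (simp add: vec_eq_iff b mat_def axis_def)
  qed
  then show ?thesis
    by (auto simp: invertible_right_inverse)
qed

lemma invertible_columns:
  fixes M :: "complex ^ 'n ^ 'n"
  assumes "invertible M"
  shows "inj (\<lambda>j. column j M)" "vec.independent (range (\<lambda>j. column j M))"
proof -
  have "inj ((*v) M)"
    by (rule inj_matrix_vector_mult[OF assms])
  then show "inj (\<lambda>j. column j M)"
    unfolding column_eq_mult_axis inj_def by (metis axis_eq_axis zero_neq_one)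
  have "det (Finite_Cartesian_Product.transpose M) \<noteq> 0"
    using assms by (simp add: det_transpose invertible_det_nz)
  then have "vec.independent (rows (Finite_Cartesian_Product.transpose M))"
    using det_dependent_rows by blast
  then show "vec.independent (range (\<lambda>j. column j M))"
    by (simp add: rows_transpose columns_def full_SetCompr_eq)
qed

text \<open>Completes independent vectors in prescribed columns to a basis. It serves both to
  represent a subspace by a matrix and to turn the independence of a few columns into a nonzero
  determinant.\<close>

lemma exists_invertible_extending:
  fixes u :: "'n \<Rightarrow> complex ^ 'n"
  assumes "inj_on u K" "vec.independent (u ` K)"
  shows "\<exists>N. invertible N \<and> (\<forall>c\<in>K. column c N = u c)"
proof -
  define B where "B = vec.extend_basis (u ` K)"
  have B: "u ` K \<subseteq> B" "vec.independent B" "vec.span B = UNIV"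
    unfolding B_def using assms(2)
    by (simp_all add: vec.extend_basis_superset vec.independent_extend_basis)
  have fin: "finite B"
    using B(2) by (rule vec.finiteI_independent)
  have "card B = vec.dim (UNIV :: (complex ^ 'n) set)"
    using B by (intro vec.basis_card_eq_dim) auto
  then have "card B = CARD('n)"
    by (simp only: vec_dim_card)
  moreover have "card (u ` K) = card K"
    using assms(1) by (rule card_image)
  ultimately have "card (B - u ` K) = card (- K)"
    using B(1) by (simp add: card_Diff_subset finite_subset[OF _ fin] Compl_eq_Diff_UNIV)
  then obtain h where h: "bij_betw h (- K) (B - u ` K)"
    using finite_same_card_bij[of "- K" "B - u ` K"] fin by auto
  define N where "N = (\<chi> i c. if c \<in> K then u c $ i else h c $ i)"
  have col: "column c N = (if c \<in> K then u c else h c)" for c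
    by (simp add: N_def column_def vec_eq_iff)
  have "B \<subseteq> range (\<lambda>j. column j N)"
  proof
    fix b assume b: "b \<in> B"
    show "b \<in> range (\<lambda>j. column j N)"
    proof (cases "b \<in> u ` K")
      case True
      then obtain c where "c \<in> K" "b = u c" by auto
      then show ?thesis
        using col[of c] by (metis rangeI)
    next
      case False
      then have "b \<in> h ` (- K)"
        using h b unfolding bij_betw_def by simp
      then obtain c where "c \<notin> K" "b = h c" by auto
      then show ?thesis
        using col[of c] by (metis rangeI)
    qed
  qed
  then have "vec.span (range (\<lambda>j. column j N)) = UNIV"
    using vec.span_mono[of B] B(3) by auto
  then have "invertible N"
    by (intro invertible_if_axes_in_span) simp
  then show ?thesis
    using col by auto
qed

subsection \<open>Points of the Grassmannian\<close>

definition first_indices :: "nat \<Rightarrow> 'n::{finite,wellorder} set" where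
  "first_indices r = {j. card {..j} \<le> r}"

lemma first_indices_down: "j \<in> first_indices r \<Longrightarrow> i \<le> j \<Longrightarrow> i \<in> first_indices r"
  unfolding first_indices_def using card_mono[of "{..j}" "{..i}"] by auto

lemma card_first_indices:
  assumes "r \<le> CARD('n::{finite,wellorder})"
  shows "card (first_indices r :: 'n set) = r"
  using assms
proof (induction r)
  case 0
  have "card {..j} > 0" for j :: 'n
    by (simp add: card_gt_0_iff)
  then show ?case
    by (simp add: first_indices_def)
next
  case (Suc r)
  then have r: "card (first_indices r :: 'n set) = r" by simp
  then have ne: "- first_indices r \<noteq> ({} :: 'n set)"
    using Suc.prems by (metis Compl_empty_eq card.empty double_complement Suc_n_not_le_n)
  define m where "m = (LEAST j::'n. j \<notin> first_indices r)"
  have m: "m \<notin> first_indices r" "\<And>j. j < m \<Longrightarrow> j \<in> first_indices r"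
    unfolding m_def using ne not_less_Least LeastI_ex[of "\<lambda>j. j \<notin> first_indices r"] by auto
  have less: "{..<m} = first_indices r"
    using m first_indices_down by (metis (no_types, lifting) lessThan_iff linorder_not_less set_eqI)
  have "{..m} = insert m {..<m}"
    by auto
  then have card_m: "card {..m} = Suc r"
    using less r m(1) by simp
  have "(first_indices (Suc r) :: 'n set) = {..m}"
  proof (intro equalityI subsetI)
    fix j :: 'n assume "j \<in> first_indices (Suc r)"
    moreover have "{..m} \<subset> {..j}" if "m < j"
      using that by auto
    ultimately have "\<not> m < j"
      using psubset_card_mono[of "{..j}" "{..m}"] card_m by (auto simp: first_indices_def)
    then show "j \<in> {..m}" by simp
  next
    fix j :: 'n assume "j \<in> {..m}"
    then show "j \<in> first_indices (Suc r)"
      using card_mono[of "{..m}" "{..j}"] card_m by (auto simp: first_indices_def)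
  qed
  then show ?case
    using card_m by simp
qed

lemma flag_of_first_indices: "flag_of M r = vec.span ((\<lambda>j. column j M) ` first_indices r)"
  unfolding flag_of_def first_indices_def by (rule arg_cong[where f = vec.span]) auto

lemma flag_of_mult:
  fixes N P :: "complex ^ 'n::{finite,wellorder} ^ 'n::{finite,wellorder}"
  shows "flag_of (N ** P) r = (*v) N ` flag_of P r"
proof -
  have "column j (N ** P) = N *v column j P" for j
    by (simp add: column_eq_mult_axis matrix_vector_mul_assoc)
  then have "flag_of (N ** P) r = vec.span ((*v) N ` (\<lambda>j. column j P) ` first_indices r)"
    by (simp add: flag_of_first_indices image_image)
  also have "\<dots> = (*v) N ` flag_of P r"
    unfolding flag_of_first_indices by (rule vec.linear_span_image) (rule matrix_vector_mul_linear_gen)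
  finally show ?thesis .
qed

lemma Gr_flag_of:
  fixes V :: "(complex ^ 'n::{finite,wellorder}) set"
  assumes "V \<in> Gr r" "r \<le> CARD('n)"
  obtains M where "invertible M" "flag_of M r = V"
proof -
  have V: "vec.subspace V" "vec.dim V = r"
    using assms(1) by (auto simp: Gr_def)
  obtain B where B: "B \<subseteq> V" "vec.independent B" "V \<subseteq> vec.span B" "card B = vec.dim V"
    using vec.basis_exists by blast
  then have span: "vec.span B = V"
    using V(1) by (metis vec.span_minimal subset_antisym)
  have "finite B"
    using B(2) by (rule vec.finiteI_independent)
  moreover have "card (first_indices r :: 'n set) = card B"
    using card_first_indices[OF assms(2)] B V by simp
  ultimately obtain u where u: "bij_betw u (first_indices r :: 'n set) B"
    using finite_same_card_bij[of "first_indices r :: 'n set" B] by auto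
  then obtain N where N: "invertible N" "\<forall>c\<in>first_indices r. column c N = u c"
    using exists_invertible_extending[of u "first_indices r"] B(2) unfolding bij_betw_def by auto
  have "(\<lambda>j. column j N) ` first_indices r = B"
    using N(2) u unfolding bij_betw_def by simp
  then have "flag_of N r = V"
    unfolding flag_of_first_indices by (simp add: span)
  then show ?thesis
    using that N(1) by blast
qed

text \<open>The pivot of a vector is its last nonzero coordinate.\<close>

lemma reduced_echelon_basis:
  fixes V :: "(complex ^ 'n::{finite,wellorder}) set"
  assumes "V \<in> Gr r"
  shows "\<exists>J b. card J = r \<and>
    (\<forall>j\<in>J. b j \<in> V \<and> b j $ j = 1 \<and> (\<forall>i. j < i \<longrightarrow> b j $ i = 0) \<and> (\<forall>i\<in>J. i \<noteq> j \<longrightarrow> b j $ i = 0)) \<and>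
    (\<forall>v\<in>V. v = (\<Sum>j\<in>J. v $ j *s b j))"
proof -
  have V: "vec.subspace V" "vec.dim V = r"
    using assms(1) by (auto simp: Gr_def)
  define J where "J = {j. \<exists>v\<in>V. v $ j \<noteq> 0 \<and> (\<forall>i. j < i \<longrightarrow> v $ i = 0)}"
  have ex: "\<exists>x. x \<in> V \<and> x $ j = 1 \<and> (\<forall>i. j < i \<longrightarrow> x $ i = 0) \<and> (\<forall>i\<in>J. i \<noteq> j \<longrightarrow> x $ i = 0)"
    if "j \<in> J" for j
    using that
  proof (induction j rule: less_induct)
    case (less j)
    then have "\<forall>k\<in>{k \<in> J. k < j}. \<exists>x. x \<in> V \<and> x $ k = 1 \<and> (\<forall>i. k < i \<longrightarrow> x $ i = 0) \<and> (\<forall>i\<in>J. i \<noteq> k \<longrightarrow> x $ i = 0)"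
      by blast
    from bchoice[OF this] obtain b where b: "\<And>k. k \<in> J \<Longrightarrow> k < j \<Longrightarrow> b k \<in> V \<and> b k $ k = 1 \<and>
        (\<forall>i. k < i \<longrightarrow> b k $ i = 0) \<and> (\<forall>i\<in>J. i \<noteq> k \<longrightarrow> b k $ i = 0)"
      by auto
    obtain v where v: "v \<in> V" "v $ j \<noteq> 0" "\<forall>i. j < i \<longrightarrow> v $ i = 0"
      using less.prems unfolding J_def by blast
    define y where "y = inverse (v $ j) *s v"
    \<comment> \<open>The vectors of smaller pivots vanish from position \<open>j\<close> on, so
      clearing the coordinates at these pivots does not disturb the pivot at
      \<open>j\<close>.\<close>
    define x where "x = y - (\<Sum>k\<in>{k \<in> J. k < j}. y $ k *s b k)"
    have y: "y \<in> V" "y $ j = 1" "\<And>i. j < i \<Longrightarrow> y $ i = 0"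
      unfolding y_def using v V(1) by (auto intro: vec.subspace_scale)
    have sum: "x $ i = y $ i - (\<Sum>k\<in>{k \<in> J. k < j}. y $ k * b k $ i)" for i
      by (simp add: x_def sum_component)
    have "x \<in> V"
      unfolding x_def using y(1) b V(1) by (intro vec.subspace_diff vec.subspace_sum vec.subspace_scale) auto
    moreover have ge: "x $ i = y $ i" if "j \<le> i" for i
      unfolding sum using b that by (subst sum.neutral) auto
    moreover have "x $ i = 0" if "i \<in> J" "i \<noteq> j" for i
    proof (cases "i < j")
      case True
      have "(\<Sum>k\<in>{k \<in> J. k < j}. y $ k * b k $ i) = (\<Sum>k\<in>{k \<in> J. k < j}. if k = i then y $ i else 0)"
        using b that by (intro sum.cong) auto
      then show ?thesis
        unfolding sum using that True by simp
    next
      case False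
      then have "j < i"
        using that by simp
      then show ?thesis
        using ge[of i] y by simp
    qed
    ultimately show ?case
      using y by (intro exI[of _ x]) auto
  qed
  have "\<forall>j\<in>J. \<exists>x. x \<in> V \<and> x $ j = 1 \<and> (\<forall>i. j < i \<longrightarrow> x $ i = 0) \<and> (\<forall>i\<in>J. i \<noteq> j \<longrightarrow> x $ i = 0)"
    using ex by blast
  from bchoice[OF this] obtain b where b: "\<And>j. j \<in> J \<Longrightarrow> b j \<in> V" "\<And>j. j \<in> J \<Longrightarrow> b j $ j = 1"
    "\<And>j i. j \<in> J \<Longrightarrow> j < i \<Longrightarrow> b j $ i = 0"
    "\<And>j i. j \<in> J \<Longrightarrow> i \<in> J \<Longrightarrow> i \<noteq> j \<Longrightarrow> b j $ i = 0"
    by blast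
  have coord: "(\<Sum>j\<in>J. c j *s b j) $ i = c i" if "i \<in> J" for c i
  proof -
    have "(\<Sum>j\<in>J. c j *s b j) $ i = (\<Sum>j\<in>J. if j = i then c i else 0)"
      unfolding sum_component using b that by (intro sum.cong) auto
    then show ?thesis
      using that by simp
  qed
  have expand: "v = (\<Sum>j\<in>J. v $ j *s b j)" if "v \<in> V" for v
  proof (rule ccontr)
    \<comment> \<open>\<open>z\<close> lies in \<open>V\<close> and vanishes on \<open>J\<close>; if
      it were nonzero, its last nonzero coordinate would be a pivot and so belong to
      \<open>J\<close>.\<close>
    define z where "z = v - (\<Sum>j\<in>J. v $ j *s b j)"
    assume "v \<noteq> (\<Sum>j\<in>J. v $ j *s b j)"
    then have "{i. z $ i \<noteq> 0} \<noteq> {}"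
      unfolding z_def by (auto simp: vec_eq_iff)
    then have max: "Max {i. z $ i \<noteq> 0} \<in> {i. z $ i \<noteq> 0}"
      by (intro Max_in) auto
    define m where "m = Max {i. z $ i \<noteq> 0}"
    have "z \<in> V"
      unfolding z_def using that b(1) V(1)
      by (intro vec.subspace_diff vec.subspace_sum vec.subspace_scale) auto
    moreover have "z $ i = 0" if "m < i" for i
    proof (rule ccontr)
      assume "z $ i \<noteq> 0"
      then have "i \<le> m"
        unfolding m_def by (intro Max_ge) auto
      then show False
        using that by simp
    qed
    ultimately have "m \<in> J"
      using max unfolding J_def m_def by blast
    then have "z $ m = 0"
      unfolding z_def using coord[of m "\<lambda>j. v $ j"] by simp
    then show False
      using max unfolding m_def by simp
  qed
  have inj: "inj_on b J"
    by (rule inj_onI) (metis b(2,4) zero_neq_one)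
  have "vec.independent (b ` J)"
  proof (rule vec.independent_if_scalars_zero)
    fix f x assume f: "(\<Sum>x\<in>b ` J. f x *s x) = 0" and x: "x \<in> b ` J"
    then obtain j where j: "j \<in> J" "x = b j" by auto
    have "(\<Sum>j\<in>J. f (b j) *s b j) = 0"
      using f by (simp add: sum.reindex[OF inj])
    then show "f x = 0"
      using coord[OF j(1), of "\<lambda>j. f (b j)"] j by simp
  qed simp
  moreover have "V \<subseteq> vec.span (b ` J)"
  proof
    fix v assume "v \<in> V"
    then have "v = (\<Sum>j\<in>J. v $ j *s b j)" by (rule expand)
    also have "\<dots> \<in> vec.span (b ` J)"
      by (intro vec.span_sum vec.span_scale vec.span_base) auto
    finally show "v \<in> vec.span (b ` J)" .
  qed
  ultimately have "card (b ` J) = r"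
    using b(1) V(2) vec.basis_card_eq_dim[of "b ` J" V] by auto
  then have "card J = r"
    using card_image[OF inj] by simp
  moreover have "\<forall>j\<in>J. b j \<in> V \<and> b j $ j = 1 \<and> (\<forall>i. j < i \<longrightarrow> b j $ i = 0) \<and> (\<forall>i\<in>J. i \<noteq> j \<longrightarrow> b j $ i = 0)"
    using b by simp
  moreover have "\<forall>v\<in>V. v = (\<Sum>j\<in>J. v $ j *s b j)"
    by (intro ballI expand)
  ultimately show ?thesis
    by (intro exI conjI)
qed

subsection \<open>Zariski closures in the Grassmannian\<close>

lemma mat_polynomial_sum:
  "(\<And>i. i \<in> I \<Longrightarrow> mat_polynomial (f i)) \<Longrightarrow> mat_polynomial (\<lambda>M. \<Sum>i\<in>I. f i M)"
  by (induction I rule: infinite_finite_induct) (simp_all add: mat_polynomial.const mat_polynomial.add)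

lemma mat_polynomial_prod:
  "(\<And>i. i \<in> I \<Longrightarrow> mat_polynomial (f i)) \<Longrightarrow> mat_polynomial (\<lambda>M. \<Prod>i\<in>I. f i M)"
  by (induction I rule: infinite_finite_induct) (simp_all add: mat_polynomial.const mat_polynomial.mult)

lemma mat_polynomial_det:
  fixes A :: "complex ^ 'n ^ 'm \<Rightarrow> complex ^ 'k ^ 'k"
  assumes "\<And>i j. mat_polynomial (\<lambda>M. A M $ i $ j)"
  shows "mat_polynomial (\<lambda>M. det (A M))"
  unfolding det_def
  by (intro mat_polynomial_sum mat_polynomial.mult mat_polynomial.const mat_polynomial_prod assms)

lemma mat_polynomial_comp:
  assumes "mat_polynomial f" "\<And>i j. mat_polynomial (\<lambda>M. A M $ i $ j)"
  shows "mat_polynomial (\<lambda>M. f (A M))"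
  using assms(1) by induction (simp_all add: mat_polynomial.intros assms(2))

lemma mat_polynomial_continuous: "mat_polynomial f \<Longrightarrow> continuous_on UNIV f"
  by (induction rule: mat_polynomial.induct) (auto intro!: continuous_intros)

lemma openin_zariski_GL:
  "openin zariski_GL U \<longleftrightarrow>
     (\<exists>S. (\<forall>f\<in>S. mat_polynomial f) \<and> U = {M. invertible M \<and> (\<exists>f\<in>S. f M \<noteq> 0)})"
proof
  assume "openin zariski_GL U"
  then obtain W where W: "openin zariski_mat W" "U = W \<inter> {M. invertible M}"
    unfolding zariski_GL_def openin_subtopology by auto
  obtain S where S: "\<forall>f\<in>S. mat_polynomial f" "- W = {M. \<forall>f\<in>S. f M = 0}"
    using W(1) unfolding openin_zariski_mat mat_algebraic_set_def by auto
  have "W = - {M. \<forall>f\<in>S. f M = 0}"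
    using S(2) by (metis double_complement)
  then have "W = {M. \<exists>f\<in>S. f M \<noteq> 0}"
    by auto
  then have "U = {M. invertible M \<and> (\<exists>f\<in>S. f M \<noteq> 0)}"
    using W(2) by auto
  with S(1) show "\<exists>S. (\<forall>f\<in>S. mat_polynomial f) \<and> U = {M. invertible M \<and> (\<exists>f\<in>S. f M \<noteq> 0)}"
    by (intro exI[of _ S] conjI)
next
  assume "\<exists>S. (\<forall>f\<in>S. mat_polynomial f) \<and> U = {M. invertible M \<and> (\<exists>f\<in>S. f M \<noteq> 0)}"
  then obtain S where S: "\<forall>f\<in>S. mat_polynomial f" "U = {M. invertible M \<and> (\<exists>f\<in>S. f M \<noteq> 0)}"
    by (elim exE conjE)
  have "openin zariski_mat {M. \<exists>f\<in>S. f M \<noteq> 0}"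
    unfolding openin_zariski_mat mat_algebraic_set_def
    using S(1) by (intro exI[of _ S]) auto
  moreover have "U = {M. \<exists>f\<in>S. f M \<noteq> 0} \<inter> {M. invertible M}"
    using S(2) by auto
  ultimately show "openin zariski_GL U"
    unfolding zariski_GL_def openin_subtopology by (intro exI conjI)
qed

text \<open>
  The preimage in \<open>GL\<^sub>n\<close> is the union of the translates of \<open>{F \<noteq> 0}\<close> by the stabilizer of the
  base point.
\<close>

lemma openin_zariski_Gr_nonzero:
  fixes F :: "complex ^ 'n::{finite,wellorder} ^ 'n::{finite,wellorder} \<Rightarrow> complex"
  assumes "mat_polynomial F" "r \<le> CARD('n)"
  shows "openin (zariski_Gr r) {V. \<exists>M. invertible M \<and> flag_of M r = V \<and> F M \<noteq> 0}"
  unfolding openin_zariski_Gr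
proof
  show "{V. \<exists>M. invertible M \<and> flag_of M r = V \<and> F M \<noteq> 0} \<subseteq> Gr r"
    using flag_of_in_Gr[OF _ assms(2)] by auto
  define St where "St = {P :: complex ^ 'n::{finite,wellorder} ^ 'n::{finite,wellorder}. invertible P \<and> flag_of P r = flag_of (mat 1) r}"
  define S where "S = (\<lambda>P M. F (M ** P)) ` St"
  have "mat_polynomial (\<lambda>M. F (M ** P))" for P
    unfolding matrix_matrix_mult_def
    by (rule mat_polynomial_comp[OF assms(1)])
      (simp add: mat_polynomial_sum mat_polynomial.intros)
  then have "\<forall>f\<in>S. mat_polynomial f"
    by (auto simp: S_def)
  moreover have "(\<exists>N. invertible N \<and> flag_of N r = flag_of M r \<and> F N \<noteq> 0) \<longleftrightarrow> (\<exists>f\<in>S. f M \<noteq> 0)"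
    if M: "invertible M" for M
  proof
    assume "\<exists>N. invertible N \<and> flag_of N r = flag_of M r \<and> F N \<noteq> 0"
    then obtain N where N: "invertible N" "flag_of N r = flag_of M r" "F N \<noteq> 0"
      by auto
    obtain M' where M': "M ** M' = mat 1" "M' ** M = mat 1"
      using M unfolding invertible_def by auto
    have eq: "M ** (M' ** N) = N"
      by (simp add: matrix_mul_assoc M')
    have "invertible M'"
      using M' by (auto simp: invertible_def)
    then have "invertible (M' ** N)"
      using N(1) by (rule invertible_mult)
    moreover have "flag_of (M' ** N) r = flag_of (M' ** M) r"
      unfolding flag_of_mult N(2) ..
    ultimately have "M' ** N \<in> St"
      by (simp add: St_def M')
    then show "\<exists>f\<in>S. f M \<noteq> 0"
      unfolding S_def using N(3) eq by (intro bexI[of _ "\<lambda>M. F (M ** (M' ** N))"]) auto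
  next
    assume "\<exists>f\<in>S. f M \<noteq> 0"
    then obtain P where P: "P \<in> St" "F (M ** P) \<noteq> 0"
      unfolding S_def by auto
    have "flag_of (M ** P) r = flag_of (M ** mat 1) r"
      unfolding flag_of_mult using P(1) by (simp add: St_def)
    moreover have "invertible (M ** P)"
      using M P(1) by (simp add: St_def invertible_mult)
    ultimately show "\<exists>N. invertible N \<and> flag_of N r = flag_of M r \<and> F N \<noteq> 0"
      using P(2) by (intro exI[of _ "M ** P"]) simp
  qed
  ultimately show "openin zariski_GL {M. invertible M \<and> flag_of M r \<in> {V. \<exists>M. invertible M \<and> flag_of M r = V \<and> F M \<noteq> 0}}"
    unfolding openin_zariski_GL by (intro exI[of _ S] conjI) auto
qed

lemma closedin_zariski_Gr_zero:
  fixes F :: "complex ^ 'n::{finite,wellorder} ^ 'n::{finite,wellorder} \<Rightarrow> complex"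
  assumes "mat_polynomial F" "r \<le> CARD('n)"
  shows "closedin (zariski_Gr r) {V \<in> Gr r. \<forall>M. invertible M \<and> flag_of M r = V \<longrightarrow> F M = 0}"
proof -
  have "{V \<in> Gr r. \<forall>M. invertible M \<and> flag_of M r = V \<longrightarrow> F M = 0} =
      topspace (zariski_Gr r) - {V. \<exists>M. invertible M \<and> flag_of M r = V \<and> F M \<noteq> 0}"
    by (auto simp: topspace_zariski_Gr[OF assms(2)])
  then show ?thesis
    using closedin_diff[OF closedin_topspace openin_zariski_Gr_nonzero[OF assms]] by simp
qed

text \<open>Polynomials are continuous, so a nonvanishing condition at the limit, and the
  nonvanishing of the determinant, persist along a tail of the sequence. Hence only the invertible
  members need to represent points of \<open>X\<close>.\<close>

lemma flag_of_limit_in_closure: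
  fixes M :: "complex ^ 'n::{finite,wellorder} ^ 'n::{finite,wellorder}"
  assumes lim: "A \<longlonglongrightarrow> M" and M: "invertible M" and r: "r \<le> CARD('n)"
    and A: "\<And>k. invertible (A k) \<Longrightarrow> flag_of (A k) r \<in> X"
  shows "flag_of M r \<in> zariski_Gr r closure_of X"
  unfolding in_closure_of
proof (intro conjI allI impI)
  show "flag_of M r \<in> topspace (zariski_Gr r)"
    using flag_of_in_Gr[OF M r] by (simp add: topspace_zariski_Gr[OF r])
  fix U assume U: "flag_of M r \<in> U \<and> openin (zariski_Gr r) U"
  then obtain S where S: "\<forall>f\<in>S. mat_polynomial f"
      "{M. invertible M \<and> flag_of M r \<in> U} = {M. invertible M \<and> (\<exists>f\<in>S. f M \<noteq> 0)}"
    unfolding openin_zariski_Gr openin_zariski_GL by auto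
  have iff: "flag_of N r \<in> U \<longleftrightarrow> (\<exists>f\<in>S. f N \<noteq> 0)" if "invertible N" for N
    using S(2) that by (auto simp: set_eq_iff)
  obtain f where f: "f \<in> S" "f M \<noteq> 0"
    using U M iff by auto
  have "(\<lambda>k. f (A k)) \<longlonglongrightarrow> f M"
    using mat_polynomial_continuous[of f] S(1) f(1) lim
    by (intro continuous_on_tendsto_compose[of UNIV f]) auto
  then have ev1: "\<forall>\<^sub>F k in sequentially. f (A k) \<noteq> 0"
    using f(2) by (rule tendsto_imp_eventually_ne)
  have det: "mat_polynomial (det :: complex ^ 'n::{finite,wellorder} ^ 'n::{finite,wellorder} \<Rightarrow> complex)"
    using mat_polynomial_det[of "\<lambda>M :: complex ^ 'n::{finite,wellorder} ^ 'n::{finite,wellorder}. M"] by (simp add: mat_polynomial.entry)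
  have "(\<lambda>k. det (A k)) \<longlonglongrightarrow> det M"
    using mat_polynomial_continuous[OF det] lim
    by (intro continuous_on_tendsto_compose[of UNIV det]) auto
  then have ev2: "\<forall>\<^sub>F k in sequentially. det (A k) \<noteq> 0"
    using M by (intro tendsto_imp_eventually_ne) (auto simp: invertible_det_nz)
  obtain k where k: "f (A k) \<noteq> 0" "det (A k) \<noteq> 0"
    using eventually_happens[OF eventually_conj[OF ev1 ev2]] by auto
  then have "invertible (A k)"
    by (simp add: invertible_det_nz)
  then show "\<exists>y. y \<in> X \<and> y \<in> U"
    using A[of k] iff[of "A k"] f(1) k(1) by auto
qed

text \<open>\<open>S\<close> is the set of deleted coordinates. The image of V has dimension dim V
  minus that of the vectors of V supported in \<open>S\<close>, so an upper bound on it says that V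
  contains many such vectors.\<close>

definition coordinate_projection :: "'n set \<Rightarrow> complex ^ 'n \<Rightarrow> complex ^ 'n" where
  "coordinate_projection S v = (\<chi> i. if i \<in> S then 0 else v $ i)"

lemma coordinate_projection_linear:
  "Vector_Spaces.linear (*s) (*s) (coordinate_projection S)"
  by unfold_locales (auto simp: coordinate_projection_def vec_eq_iff algebra_simps)

text \<open>Bounds on the rank of a coordinate projection are determinantal conditions.\<close>

lemma closure_projection_dim:
  fixes V :: "(complex ^ 'n::{finite,wellorder}) set"
  assumes V: "V \<in> zariski_Gr r closure_of X" and r: "r \<le> CARD('n)"
    and X: "\<And>W. W \<in> X \<Longrightarrow> vec.dim (coordinate_projection S ` W) \<le> d"
  shows "vec.dim (coordinate_projection S ` V) \<le> d"
proof (rule ccontr)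
  assume gt: "\<not> ?thesis"
  have "V \<in> Gr r"
    using V in_closure_of[of V "zariski_Gr r" X] topspace_zariski_Gr[OF r] by auto
  then obtain M where M: "invertible M" "flag_of M r = V"
    using Gr_flag_of r by blast
  define u where "u N c = coordinate_projection S (column c N)" for N :: "complex ^ 'n::{finite,wellorder} ^ 'n::{finite,wellorder}" and c
  have proj: "coordinate_projection S ` flag_of N r = vec.span (u N ` first_indices r)" for N
    unfolding flag_of_first_indices u_def
    by (subst vec.linear_span_image[OF coordinate_projection_linear, symmetric]) (simp add: image_image)
  obtain B where B: "B \<subseteq> u M ` first_indices r" "vec.independent B" "u M ` first_indices r \<subseteq> vec.span B"
      "card B = vec.dim (u M ` first_indices r)"
    using vec.basis_exists by blast
  have card: "d < card B"
    using gt B(4) unfolding M(2)[symmetric] proj by simp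
  obtain K where K: "K \<subseteq> first_indices r" "B = u M ` K" "inj_on (u M) K"
    using B(1) by (metis subset_image_inj)
  obtain R where R: "invertible R" "\<forall>c\<in>K. column c R = u M c"
    using exists_invertible_extending[of "u M" K] K B(2) by auto
  \<comment> \<open>Columns in \<open>K\<close> are the projected columns of the variable matrix;
    the others are frozen at a completion of those of \<open>M\<close>. So det \<open>Q N\<close> is
    a polynomial in \<open>N\<close>, nonzero at \<open>M\<close>, and wherever it is nonzero the
    projection has rank at least \<open>card K\<close>.\<close>
  define Q where "Q N = (\<chi> i c. if c \<in> K then if i \<in> S then 0 else N $ i $ c else R $ i $ c)"
    for N :: "complex ^ 'n::{finite,wellorder} ^ 'n::{finite,wellorder}"
  have Qcol: "column c (Q N) = u N c" if "c \<in> K" for c N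
    using that by (simp add: Q_def u_def column_def coordinate_projection_def vec_eq_iff)
  have "column c (Q M) = column c R" for c
    using R(2) Qcol[of c M] by (cases "c \<in> K") (auto simp: Q_def column_def)
  then have "Q M = R"
    by (simp add: vec_eq_iff column_def)
  then have FM: "det (Q M) \<noteq> 0"
    using R(1) by (simp add: invertible_det_nz)
  have poly: "mat_polynomial (\<lambda>N. det (Q N))"
  proof (rule mat_polynomial_det)
    fix i j
    show "mat_polynomial (\<lambda>N. Q N $ i $ j)"
      by (cases "j \<in> K"; cases "i \<in> S") (simp_all add: Q_def mat_polynomial.const mat_polynomial.entry)
  qed
  have zero: "det (Q N) = 0" if N: "invertible N" "flag_of N r \<in> X" for N
  proof (rule ccontr)
    assume "det (Q N) \<noteq> 0"
    then have inv: "invertible (Q N)"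
      by (simp add: invertible_det_nz)
    have img: "(\<lambda>c. column c (Q N)) ` K = u N ` K"
      using Qcol by (intro image_cong) auto
    have "card (u N ` K) = card K"
      unfolding img[symmetric] using invertible_columns(1)[OF inv] by (intro card_image) (auto simp: inj_on_def)
    also have "\<dots> = card B"
      using K by (simp add: card_image)
    finally have "d < card (u N ` K)"
      using card by simp
    also have "\<dots> \<le> vec.dim (u N ` first_indices r)"
    proof (rule vec.independent_card_le_dim)
      show "u N ` K \<subseteq> u N ` first_indices r"
        using K(1) by auto
      show "vec.independent (u N ` K)"
        unfolding img[symmetric] using invertible_columns(2)[OF inv] by (rule vec.independent_mono) auto
    qed
    also have "\<dots> \<le> d"
      using X[OF N(2)] unfolding proj by simp
    finally show False by simp
  qed
  define C where "C = {V \<in> Gr r. \<forall>M. invertible M \<and> flag_of M r = V \<longrightarrow> det (Q M) = 0}"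
  have "closedin (zariski_Gr r) C"
    unfolding C_def by (rule closedin_zariski_Gr_zero[OF poly r])
  moreover have "topspace (zariski_Gr r) \<inter> X \<subseteq> C"
    unfolding C_def topspace_zariski_Gr[OF r] using zero by auto
  ultimately have "zariski_Gr r closure_of (topspace (zariski_Gr r) \<inter> X) \<subseteq> C"
    by (rule closure_of_minimal[rotated])
  then have "V \<in> C"
    using V closure_of_restrict[of "zariski_Gr r" X] by auto
  then show False
    unfolding C_def using M FM by auto
qed

subsection \<open>The torus action\<close>

definition diagonal :: "complex ^ 'n \<Rightarrow> complex ^ 'n ^ 'n" where
  "diagonal t = (\<chi> i j. if i = j then t $ i else 0)"

lemma diagonal_mult_vec: "diagonal t *v v = (\<chi> i. t $ i * v $ i)"
  by (simp add: vec_eq_iff diagonal_def matrix_vector_mult_def if_distrib if_distribR cong: if_cong)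

lemma torus_act_diagonal: "torus_act t V = (*v) (diagonal t) ` V"
  unfolding torus_act_def by (rule image_cong) (simp_all add: diagonal_mult_vec)

lemma column_diagonal_mult: "column c (diagonal t ** M) $ i = t $ i * M $ i $ c"
  unfolding column_eq_mult_axis matrix_vector_mul_assoc[symmetric] diagonal_mult_vec
  by (simp add: column_eq_mult_axis[symmetric] column_def)

lemma diagonal_mult_entry: "(diagonal t ** M) $ i $ c = t $ i * M $ i $ c"
  using column_diagonal_mult[of c t M i] by (simp add: column_def)

lemma torus_act_flag_of: "torus_act t (flag_of M r) = flag_of (diagonal t ** M) r"
  unfolding torus_act_diagonal flag_of_mult ..

lemma invertible_diagonal:
  assumes "t \<in> torus"
  shows "invertible (diagonal t :: complex ^ 'n ^ 'n)"
proof (rule invertible_if_axes_in_span)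
  fix i
  have "axis i 1 = inverse (t $ i) *s column i (diagonal t)"
    using assms by (simp add: vec_eq_iff axis_def column_def diagonal_def torus_def)
  then show "axis i 1 \<in> vec.span (range (\<lambda>j. column j (diagonal t)))"
    by (metis rangeI vec.span_base vec.span_scale)
qed

lemma flag_of_scale:
  assumes "\<And>c. c \<in> first_indices r \<Longrightarrow> k c \<noteq> 0 \<and> column c N = k c *s column c M"
  shows "flag_of N r = flag_of M r"
  unfolding flag_of_first_indices
proof (intro equalityI vec.span_minimal vec.subspace_span subsetI)
  fix x assume "x \<in> (\<lambda>j. column j N) ` first_indices r"
  then obtain c where c: "c \<in> first_indices r" "x = column c N" by auto
  then show "x \<in> vec.span ((\<lambda>j. column j M) ` first_indices r)"
    using assms[OF c(1)] by (simp add: vec.span_scale vec.span_base)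
next
  fix x assume "x \<in> (\<lambda>j. column j M) ` first_indices r"
  then obtain c where c: "c \<in> first_indices r" "x = column c M" by auto
  then have "x = inverse (k c) *s column c N"
    using assms[OF c(1)] by simp
  then show "x \<in> vec.span ((\<lambda>j. column j N) ` first_indices r)"
    using c by (simp add: vec.span_scale vec.span_base)
qed

lemma flag_of_subspace: "vec.subspace (flag_of M r)"
  unfolding flag_of_first_indices by (rule vec.subspace_span)

lemma column_in_flag_of: "c \<in> first_indices r \<Longrightarrow> column c M \<in> flag_of M r"
  unfolding flag_of_first_indices by (intro vec.span_base imageI)

lemma flag_of_combination:
  assumes "v \<in> flag_of M r"
  shows "\<exists>z. (\<forall>c. c \<notin> first_indices r \<longrightarrow> z $ c = 0) \<and> M *v z = v"
proof -
  let ?Z = "{z. \<forall>c. c \<notin> first_indices r \<longrightarrow> z $ c = 0}"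
  have "flag_of M r \<subseteq> (*v) M ` ?Z"
    unfolding flag_of_first_indices
  proof (intro vec.span_minimal vec.linear_subspace_image matrix_vector_mul_linear_gen subsetI)
    fix x assume "x \<in> (\<lambda>j. column j M) ` first_indices r"
    then obtain c where "c \<in> first_indices r" "x = M *v axis c 1"
      by (auto simp: column_eq_mult_axis)
    then show "x \<in> (*v) M ` ?Z"
      by (intro image_eqI[of _ _ "axis c 1"]) (auto simp: axis_def)
  qed (auto simp: vec.subspace_def)
  then show ?thesis
    using assms by auto
qed

subsection \<open>The generic orbits\<close>

text \<open>
  Cut \<open>{1..r}\<close> into intervals \<open>I\<^sub>1 < \<dots> < I\<^sub>m\<close> and \<open>{r+1..n}\<close> into intervals \<open>D\<^sub>m < \<dots> < D\<^sub>1\<close>, and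
  choose a centre in each \<open>I\<^sub>i\<close>; \<open>\<kappa>\<close> maps \<open>I\<^sub>i \<union> D\<^sub>i\<close> to the centre of \<open>I\<^sub>i\<close>. The generic subspace of
  this type is spanned by one vector for each \<open>b \<le> r\<close>, with support \<open>supp b\<close>: if \<open>b\<close> is not a
  centre, this is \<open>{b, \<kappa> b}\<close>; if \<open>b\<close> is the centre of \<open>I\<^sub>i\<close>, it consists of \<open>b\<close>, \<open>D\<^sub>i\<close> and the centre
  of \<open>I\<^sub>i\<^sub>-\<^sub>1\<close>. The bipartite incidence graph of these supports is a tree.
\<close>

locale interval_matching =
  fixes r :: nat and \<kappa> :: "'n::{finite,wellorder} \<Rightarrow> 'n"
  assumes r: "r \<le> CARD('n)"
    and \<kappa>_first: "\<kappa> x \<in> first_indices r"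
    and \<kappa>_idem: "\<kappa> (\<kappa> x) = \<kappa> x"
    and \<kappa>_mono: "b \<in> first_indices r \<Longrightarrow> b' \<in> first_indices r \<Longrightarrow> b \<le> b' \<Longrightarrow> \<kappa> b \<le> \<kappa> b'"
    and \<kappa>_antimono: "d \<notin> first_indices r \<Longrightarrow> d' \<notin> first_indices r \<Longrightarrow> d \<le> d' \<Longrightarrow> \<kappa> d' \<le> \<kappa> d"
    and \<kappa>_hit: "\<exists>d. d \<notin> first_indices r \<and> \<kappa> d = \<kappa> x"
begin

definition supp :: "'n \<Rightarrow> 'n set" where
  "supp b = (if \<kappa> b \<noteq> b then {b, \<kappa> b}
     else {b} \<union> {d. d \<notin> first_indices r \<and> \<kappa> d = b} \<union>
       {c. \<kappa> c = c \<and> c < b \<and> (\<forall>c'. \<kappa> c' = c' \<longrightarrow> \<not> (c < c' \<and> c' < b))})"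

definition representative :: "'n \<Rightarrow> 'n" where
  "representative c = (SOME d. d \<notin> first_indices r \<and> \<kappa> d = \<kappa> c)"

text \<open>
  Maps the indices \<open>\<le> r\<close> to pivots of the spanning vectors, and those \<open>> r\<close> to the non-pivots.
\<close>

definition exchange :: "'n \<Rightarrow> 'n" where
  "exchange x = (if x \<in> first_indices r then if \<kappa> x = x then representative x else x
     else if x = representative x then \<kappa> x else x)"

lemma representative: "representative c \<notin> first_indices r" "\<kappa> (representative c) = \<kappa> c"
  unfolding representative_def using someI_ex[OF \<kappa>_hit[of c]] by auto

lemma representative_cong: "\<kappa> c = \<kappa> c' \<Longrightarrow> representative c = representative c'"
  unfolding representative_def by simp

lemma exchange_exchange: "exchange (exchange x) = x"
proof -
  consider "x \<in> first_indices r" "\<kappa> x = x" | "x \<in> first_indices r" "\<kappa> x \<noteq> x"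
    | "x \<notin> first_indices r" "x = representative x" | "x \<notin> first_indices r" "x \<noteq> representative x"
    by blast
  then show ?thesis
  proof cases
    case 1
    then show ?thesis
      using representative[of x] representative_cong[of "representative x" x] by (simp add: exchange_def)
  next
    case 3
    then show ?thesis
      using representative_cong[of "\<kappa> x" x] by (simp add: exchange_def \<kappa>_first \<kappa>_idem)
  qed (simp_all add: exchange_def)
qed

lemma exchange_eq_iff: "exchange x = exchange y \<longleftrightarrow> x = y"
  by (metis exchange_exchange)

lemma exchange_in_supp:
  assumes "b \<in> first_indices r"
  shows "exchange b \<in> supp b"
  using assms representative[of b] by (auto simp: exchange_def supp_def)

text \<open>A centre occurs in the support of other vectors and cannot serve as pivot; its
  representative beyond \<open>r\<close> occurs only in the centre's own support. In the rows
  \<open>exchange b\<close> the generic spanning vectors therefore form a diagonal matrix.\<close>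

lemma exchange_in_supp_iff:
  assumes "b \<in> first_indices r" "c \<in> first_indices r"
  shows "exchange b \<in> supp c \<longleftrightarrow> b = c"
proof
  assume *: "exchange b \<in> supp c"
  show "b = c"
  proof (cases "\<kappa> b = b")
    case True
    then have "representative b \<in> supp c"
      using * assms by (simp add: exchange_def)
    moreover have "representative b \<noteq> c" "representative b \<noteq> \<kappa> c" "\<kappa> (representative b) \<noteq> representative b"
      using representative(1)[of b] assms \<kappa>_first by metis+
    ultimately have "\<kappa> (representative b) = c"
      by (auto simp: supp_def split: if_splits)
    then show ?thesis
      using representative(2) True by simp
  next
    case False
    then have "b \<in> supp c"
      using * assms by (simp add: exchange_def)
    then show ?thesis
      using False assms \<kappa>_idem[of c] by (auto simp: supp_def split: if_splits)
  qed
qed (use assms exchange_in_supp in simp)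

lemma supp_not_exchange:
  assumes "b \<in> first_indices r" "i \<in> supp b" "i \<noteq> exchange b"
  shows "exchange i \<notin> first_indices r"
  using assms exchange_in_supp_iff[of "exchange i" b] exchange_exchange[of i] by auto

text \<open>The spanning vectors are completed by the coordinate vectors at the non-pivots, so
  invertibility reduces to the diagonal minor in the pivot rows.\<close>

definition generic_matrix :: "('n \<Rightarrow> 'n \<Rightarrow> complex) \<Rightarrow> complex ^ 'n::{finite,wellorder} ^ 'n::{finite,wellorder}" where
  "generic_matrix x = (\<chi> i c. if c \<in> first_indices r then x c i else axis (exchange c) 1 $ i)"

lemma invertible_generic_matrix:
  assumes "\<And>b i. b \<in> first_indices r \<Longrightarrow> x b i \<noteq> 0 \<longleftrightarrow> i \<in> supp b"
  shows "invertible (generic_matrix x)"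
  unfolding invertible_left_inverse matrix_left_invertible_ker
proof (intro allI impI)
  fix z assume z: "generic_matrix x *v z = 0"
  have entry: "(\<Sum>c\<in>UNIV. generic_matrix x $ i $ c * z $ c) = 0" for i
    using z by (simp add: vec_eq_iff matrix_vector_mult_def)
  have first: "z $ b = 0" if b: "b \<in> first_indices r" for b
  proof -
    have "generic_matrix x $ exchange b $ c * z $ c = (if c = b then x b (exchange b) * z $ b else 0)" for c
    proof (cases "c \<in> first_indices r")
      case True
      then have "c = b \<or> x c (exchange b) = 0"
        using exchange_in_supp_iff[OF b True] assms[OF True] by auto
      then show ?thesis
        using True by (auto simp: generic_matrix_def)
    next
      case False
      then show ?thesis
        using b by (auto simp: generic_matrix_def axis_def exchange_eq_iff)
    qed
    then have "x b (exchange b) * z $ b = 0"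
      using entry[of "exchange b"] by simp
    then show ?thesis
      using assms[OF b, of "exchange b"] exchange_in_supp[OF b] by simp
  qed
  have "z $ d = 0" if d: "d \<notin> first_indices r" for d
  proof -
    have "generic_matrix x $ exchange d $ c * z $ c = (if c = d then z $ d else 0)" for c
      using d first[of c] by (auto simp: generic_matrix_def axis_def exchange_eq_iff)
    then show ?thesis
      using entry[of "exchange d"] by simp
  qed
  then show "z = 0"
    using first by (metis vec_eq_iff zero_index)
qed

definition base_matrix :: "complex ^ 'n::{finite,wellorder} ^ 'n::{finite,wellorder}" where
  "base_matrix = generic_matrix (\<lambda>b i. if i \<in> supp b then 1 else 0)"

definition generic_orbit :: "(complex ^ 'n::{finite,wellorder}) set set" where
  "generic_orbit = torus_orbit (flag_of base_matrix r)"

lemma invertible_base_matrix: "invertible base_matrix"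
  unfolding base_matrix_def by (rule invertible_generic_matrix) simp

lemma base_matrix_entry: "b \<in> first_indices r \<Longrightarrow> base_matrix $ i $ b = (if i \<in> supp b then 1 else 0)"
  by (simp add: base_matrix_def generic_matrix_def)

lemma base_flag_in_Gr: "flag_of base_matrix r \<in> Gr r"
  by (rule flag_of_in_Gr[OF invertible_base_matrix r])

text \<open>As the incidence graph is a tree, the torus can adjust all coefficients independently.\<close>

lemma flag_of_in_generic_orbit:
  assumes M: "\<And>b i. b \<in> first_indices r \<Longrightarrow> M $ i $ b \<noteq> 0 \<longleftrightarrow> i \<in> supp b"
  shows "flag_of M r \<in> generic_orbit"
proof -
  \<comment> \<open>Row scalings t and column scalings k must satisfy t_i = k_b M_ib for each i in
    \<open>supp b\<close>. At a centre c with a preceding centre \<open>prv c\<close>, eliminating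
    k_c gives t_c = (M_cc / M_(prv c)c) t_(prv c); \<open>\<tau>\<close> is the resulting product,
    starting from 1 at the first centre.\<close>
  define prv where "prv c = Max {c'. \<kappa> c' = c' \<and> c' < c}" for c
  define q where "q c = (if \<exists>c'. \<kappa> c' = c' \<and> c' < c then M $ c $ c / M $ prv c $ c else 1)" for c
  define \<tau> where "\<tau> c = (\<Prod>c' | \<kappa> c' = c' \<and> c' \<le> c. q c')" for c
  have prv: "\<kappa> c = c \<and> c < b \<and> (\<forall>c'. \<kappa> c' = c' \<longrightarrow> \<not> (c < c' \<and> c' < b)) \<longleftrightarrow>
      c = prv b \<and> (\<exists>c'. \<kappa> c' = c' \<and> c' < b)" for b c
  proof (cases "\<exists>c'. \<kappa> c' = c' \<and> c' < b")
    case True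
    then have ne: "{c'. \<kappa> c' = c' \<and> c' < b} \<noteq> {}" by auto
    have "prv b \<in> {c'. \<kappa> c' = c' \<and> c' < b}"
      unfolding prv_def using ne by (intro Max_in) auto
    moreover have "c' \<le> prv b" if "\<kappa> c' = c'" "c' < b" for c'
      unfolding prv_def using that by (intro Max_ge) auto
    ultimately show ?thesis
      by (metis (mono_tags, lifting) leD le_less mem_Collect_eq)
  qed auto
  have supp_centre: "supp b = {b} \<union> {d. d \<notin> first_indices r \<and> \<kappa> d = b} \<union>
      (if \<exists>c'. \<kappa> c' = c' \<and> c' < b then {prv b} else {})" if "\<kappa> b = b" for b
    using that unfolding supp_def prv by auto
  have centre: "b \<in> first_indices r" if "\<kappa> b = b" for b
    using \<kappa>_first[of b] that by simp
  have q_nz: "q c \<noteq> 0" if c: "\<kappa> c = c" for c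
    unfolding q_def using M[OF centre[OF c]] supp_centre[OF c] by auto
  then have \<tau>_nz: "\<tau> c \<noteq> 0" for c
    unfolding \<tau>_def by (simp add: prod_zero_iff)
  have \<tau>_step: "\<tau> c = M $ c $ c / M $ prv c $ c * \<tau> (prv c)" if c: "\<kappa> c = c" "\<exists>c'. \<kappa> c' = c' \<and> c' < c" for c
  proof -
    have p: "\<kappa> (prv c) = prv c" "prv c < c" "\<And>c'. \<kappa> c' = c' \<Longrightarrow> \<not> (prv c < c' \<and> c' < c)"
      using prv[of "prv c" c] c(2) by blast+
    have "x \<le> prv c" if "\<kappa> x = x" "x < c" for x
      using p(3)[OF that(1)] that(2) by (simp add: not_less)
    then have "{c'. \<kappa> c' = c' \<and> c' \<le> c} = insert c {c'. \<kappa> c' = c' \<and> c' \<le> prv c}"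
      using p(1,2) c(1) by (auto simp: le_less)
    moreover have "c \<notin> {c'. \<kappa> c' = c' \<and> c' \<le> prv c}"
      using p(2) by auto
    ultimately have "\<tau> c = q c * \<tau> (prv c)"
      unfolding \<tau>_def by simp
    then show ?thesis
      using c(2) by (simp add: q_def)
  qed
  \<comment> \<open>Every coordinate that is not a centre meets just one support linking it to a
    centre, so its scaling, like the column scalings \<open>k\<close>, is read off from
    \<open>\<tau>\<close>.\<close>
  define t where "t = (\<chi> i. if i \<in> first_indices r
      then if \<kappa> i = i then \<tau> i else \<tau> (\<kappa> i) * M $ i $ i / M $ \<kappa> i $ i
      else \<tau> (\<kappa> i) * M $ i $ \<kappa> i / M $ \<kappa> i $ \<kappa> i)"
  define k where "k b = (if \<kappa> b = b then \<tau> b / M $ b $ b else \<tau> (\<kappa> b) / M $ \<kappa> b $ b)" for b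
  have diag_nz: "M $ b $ b \<noteq> 0" if "b \<in> first_indices r" for b
    using M[OF that, of b] by (simp add: supp_def)
  have \<kappa>_nz: "M $ \<kappa> b $ b \<noteq> 0" if "b \<in> first_indices r" for b
    using M[OF that, of "\<kappa> b"] by (auto simp: supp_def)
  have d_nz: "M $ d $ \<kappa> d \<noteq> 0" if "d \<notin> first_indices r" for d
    using M[OF \<kappa>_first, of d d] that \<kappa>_idem[of d] by (auto simp: supp_def)
  have "t \<in> torus"
    unfolding torus_def t_def using \<tau>_nz diag_nz \<kappa>_nz d_nz \<kappa>_first by auto
  have col: "k b \<noteq> 0 \<and> column b (diagonal t ** base_matrix) = k b *s column b M"
    if b: "b \<in> first_indices r" for b
  proof
    show kb: "k b \<noteq> 0"
      unfolding k_def using \<tau>_nz diag_nz[OF b] \<kappa>_nz[OF b] by simp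
    have "t $ i * base_matrix $ i $ b = k b * M $ i $ b" for i
    proof (cases "i \<in> supp b")
      case False
      then show ?thesis
        using M[OF b, of i] base_matrix_entry[OF b, of i] by simp
    next
      case i: True
      have "t $ i = k b * M $ i $ b"
      proof (cases "\<kappa> b = b")
        case False
        then have "i = b \<or> i = \<kappa> b"
          using i by (auto simp: supp_def)
        then show ?thesis
          using False b \<kappa>_nz[OF b] by (auto simp: t_def k_def \<kappa>_idem \<kappa>_first)
      next
        case True
        have "i = b \<or> i \<notin> first_indices r \<and> \<kappa> i = b \<or> i = prv b \<and> (\<exists>c'. \<kappa> c' = c' \<and> c' < b)"
          using i unfolding supp_centre[OF True] by (auto split: if_splits)
        then consider "i = b" | "i \<notin> first_indices r" "\<kappa> i = b" | "i = prv b" "\<exists>c'. \<kappa> c' = c' \<and> c' < b"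
          by blast
        then show ?thesis
        proof cases
          case 3
          then have "\<kappa> i = i"
            using prv[of i b] by blast
          moreover have "M $ prv b $ b \<noteq> 0"
            using i 3 M[OF b] by auto
          ultimately show ?thesis
            using 3 True \<tau>_step[OF True 3(2)] diag_nz[OF b] centre[of i] by (simp add: t_def k_def)
        qed (use True b diag_nz[OF b] in \<open>auto simp: t_def k_def\<close>)
      qed
      then show ?thesis
        using base_matrix_entry[OF b, of i] i by simp
    qed
    then show "column b (diagonal t ** base_matrix) = k b *s column b M"
      by (simp add: vec_eq_iff diagonal_mult_entry column_def)
  qed
  have "flag_of (diagonal t ** base_matrix) r = flag_of M r"
    by (rule flag_of_scale) (rule col)
  then have "flag_of M r = torus_act t (flag_of base_matrix r)"
    by (simp add: torus_act_flag_of)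
  then show ?thesis
    unfolding generic_orbit_def torus_orbit_def using \<open>t \<in> torus\<close> by auto
qed

text \<open>A spanning vector whose support lies in \<open>S\<close> is killed by the projection, so
  only the remaining ones contribute.\<close>

lemma generic_orbit_projection_dim:
  assumes "W \<in> generic_orbit"
  shows "vec.dim (coordinate_projection S ` W) \<le> card {b \<in> first_indices r. \<not> supp b \<subseteq> S}"
proof -
  obtain t where W: "W = flag_of (diagonal t ** base_matrix) r"
    using assms unfolding generic_orbit_def torus_orbit_def torus_act_flag_of by auto
  let ?u = "\<lambda>b. coordinate_projection S (column b (diagonal t ** base_matrix))"
  let ?B = "{b \<in> first_indices r. \<not> supp b \<subseteq> S}"
  have proj: "coordinate_projection S ` W = vec.span (?u ` first_indices r)"
    unfolding W flag_of_first_indices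
    by (subst vec.linear_span_image[OF coordinate_projection_linear, symmetric]) (simp add: image_image)
  have "?u b \<in> vec.span (?u ` ?B)" if b: "b \<in> first_indices r" for b
  proof (cases "supp b \<subseteq> S")
    case True
    then have "?u b = 0"
      by (auto simp: vec_eq_iff coordinate_projection_def column_diagonal_mult base_matrix_entry[OF b])
    then show ?thesis
      by (simp add: vec.span_zero)
  next
    case False
    then show ?thesis
      using b by (intro vec.span_base imageI) simp
  qed
  then have "coordinate_projection S ` W \<subseteq> vec.span (?u ` ?B)"
    unfolding proj by (intro vec.span_minimal vec.subspace_span) auto
  then have "vec.dim (coordinate_projection S ` W) \<le> card (?u ` ?B)"
    by (rule vec.dim_le_card) simp
  also have "\<dots> \<le> card ?B"
    by (rule card_image_le) simp
  finally show ?thesis .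
qed

end

subsection \<open>The dimension of the generic orbits\<close>

context interval_matching
begin

text \<open>g is a quotient F / G of polynomials in the entries of any matrix representing the
  point. Quantifying over all representatives makes g a function of the point itself, which later
  yields both injectivity of the parametrization and closedness of zero sets.\<close>

definition regular_on_orbit ::
    "(complex ^ 'n::{finite,wellorder}) set \<Rightarrow> (complex ^ 'n::{finite,wellorder} \<Rightarrow> complex) \<Rightarrow> bool" where
  "regular_on_orbit T g \<longleftrightarrow> (\<exists>F G. mat_polynomial F \<and> mat_polynomial G \<and>
     (\<forall>M t. invertible M \<and> t \<in> T \<and> flag_of M r = torus_act t (flag_of base_matrix r) \<longrightarrow>
        G M \<noteq> 0 \<and> F M = G M * g t))"

lemma regular_on_orbitI:
  assumes "mat_polynomial F" "mat_polynomial G"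
    and "\<And>M t. invertible M \<Longrightarrow> t \<in> T \<Longrightarrow> flag_of M r = torus_act t (flag_of base_matrix r) \<Longrightarrow>
      G M \<noteq> 0 \<and> F M = G M * g t"
  shows "regular_on_orbit T g"
  unfolding regular_on_orbit_def using assms by blast

lemma regular_on_orbit_const: "regular_on_orbit T (\<lambda>t. c)"
  by (rule regular_on_orbitI[of "\<lambda>_. c" "\<lambda>_. 1"]) (simp_all add: mat_polynomial.const)

lemma regular_on_orbit_add:
  assumes "regular_on_orbit T g" "regular_on_orbit T g'"
  shows "regular_on_orbit T (\<lambda>t. g t + g' t)"
proof -
  obtain F G where FG: "mat_polynomial F" "mat_polynomial G"
    "\<forall>M t. invertible M \<and> t \<in> T \<and> flag_of M r = torus_act t (flag_of base_matrix r) \<longrightarrow>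
      G M \<noteq> 0 \<and> F M = G M * g t"
    using assms(1) unfolding regular_on_orbit_def by (elim exE conjE)
  obtain F' G' where FG': "mat_polynomial F'" "mat_polynomial G'"
    "\<forall>M t. invertible M \<and> t \<in> T \<and> flag_of M r = torus_act t (flag_of base_matrix r) \<longrightarrow>
      G' M \<noteq> 0 \<and> F' M = G' M * g' t"
    using assms(2) unfolding regular_on_orbit_def by (elim exE conjE)
  show ?thesis
    by (rule regular_on_orbitI[of "\<lambda>M. F M * G' M + F' M * G M" "\<lambda>M. G M * G' M"])
      (simp_all add: mat_polynomial.add mat_polynomial.mult FG FG' algebra_simps)
qed

lemma regular_on_orbit_mult:
  assumes "regular_on_orbit T g" "regular_on_orbit T g'"
  shows "regular_on_orbit T (\<lambda>t. g t * g' t)"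
proof -
  obtain F G where FG: "mat_polynomial F" "mat_polynomial G"
    "\<forall>M t. invertible M \<and> t \<in> T \<and> flag_of M r = torus_act t (flag_of base_matrix r) \<longrightarrow>
      G M \<noteq> 0 \<and> F M = G M * g t"
    using assms(1) unfolding regular_on_orbit_def by (elim exE conjE)
  obtain F' G' where FG': "mat_polynomial F'" "mat_polynomial G'"
    "\<forall>M t. invertible M \<and> t \<in> T \<and> flag_of M r = torus_act t (flag_of base_matrix r) \<longrightarrow>
      G' M \<noteq> 0 \<and> F' M = G' M * g' t"
    using assms(2) unfolding regular_on_orbit_def by (elim exE conjE)
  show ?thesis
    by (rule regular_on_orbitI[of "\<lambda>M. F M * F' M" "\<lambda>M. G M * G' M"])
      (simp_all add: mat_polynomial.mult FG FG')
qed

lemma regular_on_orbit_inverse: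
  assumes "regular_on_orbit T g" "\<And>t. t \<in> T \<Longrightarrow> g t \<noteq> 0"
  shows "regular_on_orbit T (\<lambda>t. inverse (g t))"
proof -
  obtain F G where FG: "mat_polynomial F" "mat_polynomial G"
    "\<forall>M t. invertible M \<and> t \<in> T \<and> flag_of M r = torus_act t (flag_of base_matrix r) \<longrightarrow>
      G M \<noteq> 0 \<and> F M = G M * g t"
    using assms(1) unfolding regular_on_orbit_def by (elim exE conjE)
  show ?thesis
    by (rule regular_on_orbitI[of G F]) (simp_all add: FG assms(2))
qed

lemma regular_on_orbit_cong:
  assumes "regular_on_orbit T g" "\<And>t. t \<in> T \<Longrightarrow> g t = g' t"
  shows "regular_on_orbit T g'"
  using assms unfolding regular_on_orbit_def by simp

text \<open>
  The normalized spanning vectors of \<open>t \<sqdot> V\<close> form a reduced basis, whose entries are ratios of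
  minors by Cramer's rule.
\<close>

lemma regular_on_orbit_pivot_ratio:
  assumes b: "b \<in> first_indices r" and i: "i \<in> supp b"
  shows "regular_on_orbit torus (\<lambda>t. t $ i / t $ exchange b)"
proof (cases "i = exchange b")
  case True
  then show ?thesis
    by (intro regular_on_orbit_cong[OF regular_on_orbit_const[of _ 1]]) (simp add: torus_def)
next
  case False
  define k where "k = exchange i"
  have k: "k \<notin> first_indices r" "exchange k = i"
    unfolding k_def using supp_not_exchange[OF b i False] exchange_exchange by auto
  \<comment> \<open>The columns beyond the first \<open>r\<close> become coordinate vectors at the
    non-pivots. Solving \<open>N M *v z = axis (exchange b) 1\<close> then subtracts the non-pivot
    part of the reduced basis vector, whose entry at \<open>exchange k\<close> is minus
    \<open>z $ k\<close>; \<open>F\<close> is the Cramer numerator, with this sign.\<close>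
  define N where "N M = (\<chi> i c. if c \<in> first_indices r then M $ i $ c else axis (exchange c) 1 $ i)"
    for M :: "complex ^ 'n::{finite,wellorder} ^ 'n::{finite,wellorder}"
  define F where "F M = - det (\<chi> i c. if c = k then axis (exchange b) 1 $ i else N M $ i $ c)"
    for M :: "complex ^ 'n::{finite,wellorder} ^ 'n::{finite,wellorder}"
  have entry: "mat_polynomial (\<lambda>M. N M $ i $ c)" for i c
    by (cases "c \<in> first_indices r") (simp_all add: N_def mat_polynomial.const mat_polynomial.entry)
  have "mat_polynomial (\<lambda>M. det (\<chi> i c. if c = k then axis (exchange b) 1 $ i else N M $ i $ c))"
  proof (rule mat_polynomial_det)
    fix i c
    show "mat_polynomial (\<lambda>M. (\<chi> i c. if c = k then axis (exchange b) 1 $ i else N M $ i $ c) $ i $ c)"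
      by (cases "c = k") (simp_all add: mat_polynomial.const entry)
  qed
  then have "mat_polynomial F"
    unfolding F_def using mat_polynomial.mult[OF mat_polynomial.const[of "- 1"]] by simp
  moreover have "mat_polynomial (\<lambda>M. det (N M))"
    by (rule mat_polynomial_det) (rule entry)
  moreover have "det (N M) \<noteq> 0 \<and> F M = det (N M) * (t $ i / t $ exchange b)"
    if "invertible M" and t: "t \<in> torus" and M: "flag_of M r = torus_act t (flag_of base_matrix r)" for M t
  proof -
    have solve: "\<exists>z. N M *v z = axis (exchange b') 1 \<and> (\<forall>c. c \<notin> first_indices r \<longrightarrow>
        z $ c = - (t $ exchange c * base_matrix $ exchange c $ b' / t $ exchange b'))"
      if b': "b' \<in> first_indices r" for b'
    proof -
      \<comment> \<open>The basis vector normalized to 1 at its pivot. It is \<open>M *v x\<close>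
        with \<open>x\<close> supported on the first \<open>r\<close> columns; replacing the other
        coordinates of \<open>x\<close> by minus the non-pivot entries of \<open>y\<close> gives the
        solution \<open>z\<close>.\<close>
      define y where "y = inverse (t $ exchange b') *s column b' (diagonal t ** base_matrix)"
      have y: "y $ j = t $ j * base_matrix $ j $ b' / t $ exchange b'" for j
        by (simp add: y_def column_diagonal_mult field_simps)
      have "y \<in> flag_of M r"
        unfolding M torus_act_flag_of y_def
        by (intro vec.subspace_scale flag_of_subspace column_in_flag_of b')
      then obtain x where x: "\<And>c. c \<notin> first_indices r \<Longrightarrow> x $ c = 0" "M *v x = y"
        using flag_of_combination by blast
      define z where "z = (\<chi> c. if c \<in> first_indices r then x $ c else - y $ exchange c)"
      have "(N M *v z) $ j = axis (exchange b') 1 $ j" for j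
      proof -
        define c where "c = exchange j"
        have j: "j = exchange c"
          unfolding c_def exchange_exchange ..
        have "(N M *v z) $ j =
            (\<Sum>c'\<in>UNIV. M $ j $ c' * x $ c' + (if c' = c \<and> c \<notin> first_indices r then - y $ j else 0))"
          unfolding matrix_vector_mult_def vec_lambda_beta
          by (intro sum.cong refl) (auto simp: N_def z_def x(1) axis_def j exchange_eq_iff)
        also have "\<dots> = (M *v x) $ j + (if c \<notin> first_indices r then - y $ j else 0)"
          by (simp add: sum.distrib matrix_vector_mult_def)
        also have "\<dots> = (if c \<notin> first_indices r then 0 else y $ j)"
          unfolding x(2) by simp
        also have "\<dots> = axis (exchange b') 1 $ j"
        proof (cases "c \<in> first_indices r")
          case True
          then show ?thesis
            using b' t by (simp add: y j base_matrix_entry exchange_in_supp_iff axis_def exchange_eq_iff torus_def)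
        next
          case False
          then show ?thesis
            using b' by (auto simp: j axis_def exchange_eq_iff)
        qed
        finally show ?thesis .
      qed
      then show ?thesis
        using y by (intro exI[of _ z]) (simp add: vec_eq_iff z_def)
    qed
    have "axis j 1 \<in> vec.span (range (\<lambda>c. column c (N M)))" for j
    proof -
      define c where "c = exchange j"
      have j: "j = exchange c"
        unfolding c_def exchange_exchange ..
      show ?thesis
      proof (cases "c \<in> first_indices r")
        case True
        then obtain z where z: "N M *v z = axis j 1"
          using solve[of c] j by auto
        have "N M *v z = (\<Sum>c\<in>UNIV. z $ c *s column c (N M))"
          by (rule matrix_mult_sum)
        also have "\<dots> \<in> vec.span (range (\<lambda>c. column c (N M)))"
          by (intro vec.span_sum vec.span_scale vec.span_base rangeI)
        finally show ?thesis
          unfolding z .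
      next
        case False
        then have "axis j 1 = column c (N M)"
          by (simp add: N_def column_def vec_eq_iff j)
        then show ?thesis
          by (simp add: vec.span_base)
      qed
    qed
    then have "invertible (N M)"
      by (rule invertible_if_axes_in_span)
    then have det: "det (N M) \<noteq> 0"
      by (simp add: invertible_det_nz)
    obtain z where z: "N M *v z = axis (exchange b) 1" "z $ k = - (t $ i / t $ exchange b)"
      using solve[OF b] k i by (auto simp: base_matrix_entry[OF b])
    have "F M = - (z $ k * det (N M))"
      unfolding F_def cramer_lemma[symmetric] z(1) ..
    then show ?thesis
      using det z(2) by simp
  qed
  ultimately show ?thesis
    by (rule regular_on_orbitI)
qed

lemma regular_on_orbit_supp_ratio:
  assumes "b \<in> first_indices r" "i \<in> supp b" "j \<in> supp b"
  shows "regular_on_orbit torus (\<lambda>t. t $ i / t $ j)"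
proof -
  have "regular_on_orbit torus (\<lambda>t. inverse (t $ j / t $ exchange b))"
    by (rule regular_on_orbit_inverse[OF regular_on_orbit_pivot_ratio[OF assms(1,3)]]) (simp add: torus_def)
  from regular_on_orbit_mult[OF regular_on_orbit_pivot_ratio[OF assms(1,2)] this] show ?thesis
    by (rule regular_on_orbit_cong) (simp add: torus_def field_simps)
qed

lemma regular_on_orbit_ratio_trans:
  assumes "regular_on_orbit torus (\<lambda>t. t $ i / t $ j)" "regular_on_orbit torus (\<lambda>t. t $ j / t $ k)"
  shows "regular_on_orbit torus (\<lambda>t. t $ i / t $ k)"
  by (rule regular_on_orbit_cong[OF regular_on_orbit_mult[OF assms]]) (simp add: torus_def)

lemma regular_on_orbit_ratio_sym:
  assumes "regular_on_orbit torus (\<lambda>t. t $ i / t $ j)"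
  shows "regular_on_orbit torus (\<lambda>t. t $ j / t $ i)"
  by (rule regular_on_orbit_cong[OF regular_on_orbit_inverse[OF assms]]) (simp_all add: torus_def)

text \<open>Connectedness of the tree: each coordinate shares a support with its centre, and each
  centre other than the least one shares a support with the preceding centre, so any ratio is a
  product of ratios within supports.\<close>

lemma regular_on_orbit_ratio: "regular_on_orbit torus (\<lambda>t. t $ i / t $ j)"
proof -
  define m where "m = (LEAST c. \<kappa> c = c)"
  have m: "\<kappa> m = m" "\<And>c. \<kappa> c = c \<Longrightarrow> m \<le> c"
    unfolding m_def using LeastI[of "\<lambda>c. \<kappa> c = c", OF \<kappa>_idem] by (auto intro: Least_le)
  have centre: "c \<in> first_indices r" if "\<kappa> c = c" for c
    using \<kappa>_first[of c] that by simp
  have to_m: "regular_on_orbit torus (\<lambda>t. t $ c / t $ m)" if "\<kappa> c = c" for c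
    using that
  proof (induction c rule: less_induct)
    case (less c)
    show ?case
    proof (cases "c = m")
      case True
      then show ?thesis
        by (intro regular_on_orbit_cong[OF regular_on_orbit_const[of _ 1]]) (simp add: torus_def)
    next
      case False
      then have "m < c"
        using m(2)[OF less.prems] by simp
      define p where "p = Max {c'. \<kappa> c' = c' \<and> c' < c}"
      have "p \<in> {c'. \<kappa> c' = c' \<and> c' < c}"
        unfolding p_def using m(1) \<open>m < c\<close> by (intro Max_in) auto
      moreover have "c' \<le> p" if "\<kappa> c' = c'" "c' < c" for c'
        unfolding p_def using that by (intro Max_ge) auto
      ultimately have p: "\<kappa> p = p" "p < c" "p \<in> supp c"
        using less.prems by (auto simp: supp_def dest: leD)
      have "c \<in> supp c"
        by (simp add: supp_def)
      from regular_on_orbit_ratio_trans[OF regular_on_orbit_supp_ratio[OF centre[OF less.prems] this p(3)] less.IH[OF p(2,1)]]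
      show ?thesis .
    qed
  qed
  have to_centre: "regular_on_orbit torus (\<lambda>t. t $ i / t $ \<kappa> i)" for i
  proof (cases "i \<in> first_indices r")
    case True
    show ?thesis
      by (rule regular_on_orbit_supp_ratio[OF True]) (auto simp: supp_def)
  next
    case False
    then show ?thesis
      by (intro regular_on_orbit_supp_ratio[OF \<kappa>_first[of i]]) (auto simp: supp_def \<kappa>_idem)
  qed
  have "regular_on_orbit torus (\<lambda>t. t $ i / t $ m)" for i
    by (rule regular_on_orbit_ratio_trans[OF to_centre to_m[OF \<kappa>_idem]])
  then show ?thesis
    using regular_on_orbit_ratio_trans[OF _ regular_on_orbit_ratio_sym] by blast
qed

text \<open>Scalars act trivially, so one coordinate \<open>i0\<close> may be normalized to 1. The
  remaining coordinates are regular on the orbit: two parameters giving the same point agree, as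
  seen by evaluating the same F and G at one representative.\<close>

lemma krull_dim_generic_orbit:
  "krull_dim (subtopology (zariski_Gr r) generic_orbit) = enat (CARD('n) - 1)"
proof -
  define i0 where "i0 = (SOME i::'n. True)"
  define T where "T = slice_torus (- {i0})"
  define \<phi> where "\<phi> t = torus_act t (flag_of base_matrix r)" for t
  let ?X = "subtopology (zariski_Gr r) generic_orbit"
  have T1: "t $ i0 = 1" if "t \<in> T" for t
    using that by (simp add: T_def slice_torus_def)
  have T_torus: "T \<subseteq> torus"
    by (auto simp: T_def slice_torus_def torus_def)
  have \<phi>_flag: "\<phi> t = flag_of (diagonal t ** base_matrix) r" for t
    by (simp add: \<phi>_def torus_act_flag_of)
  have inv: "invertible (diagonal t ** base_matrix)" if "t \<in> torus" for t
    using invertible_diagonal[OF that] invertible_base_matrix by (rule invertible_mult)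
  have orbit_Gr: "generic_orbit \<subseteq> Gr r"
    unfolding generic_orbit_def torus_orbit_def using flag_of_in_Gr[OF inv r]
    by (auto simp: torus_act_flag_of)
  then have top: "topspace ?X = generic_orbit"
    by (simp add: topspace_zariski_Gr[OF r] Int_absorb1)
  have img: "\<phi> ` T = generic_orbit"
  proof
    show "\<phi> ` T \<subseteq> generic_orbit"
      unfolding \<phi>_def generic_orbit_def torus_orbit_def using T_torus by auto
    show "generic_orbit \<subseteq> \<phi> ` T"
    proof
      fix V assume "V \<in> generic_orbit"
      then obtain t where t: "t \<in> torus" "V = flag_of (diagonal t ** base_matrix) r"
        unfolding generic_orbit_def torus_orbit_def torus_act_flag_of by auto
      define s where "s = (\<chi> i. t $ i / t $ i0)"
      have "s \<in> T"
        using t(1) by (simp add: s_def T_def slice_torus_def torus_def)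
      moreover have "flag_of (diagonal s ** base_matrix) r = V"
        unfolding t(2)
        by (rule flag_of_scale[where k = "\<lambda>_. inverse (t $ i0)"])
          (use t(1) in \<open>simp add: vec_eq_iff column_def diagonal_mult_entry s_def torus_def field_simps\<close>)
      ultimately show "V \<in> \<phi> ` T"
        unfolding \<phi>_flag by auto
    qed
  qed
  have regular_coord: "regular_on_orbit T (\<lambda>t. t $ i)" for i
  proof -
    have "regular_on_orbit T (\<lambda>t. t $ i / t $ i0)"
      using regular_on_orbit_ratio[of i i0] T_torus unfolding regular_on_orbit_def by blast
    then show ?thesis
      by (rule regular_on_orbit_cong) (simp add: T1)
  qed
  have regular: "regular_on_orbit T h" if "vec_polynomial h" for h
    using that
    by induction (auto intro: regular_on_orbit_const regular_coord regular_on_orbit_add regular_on_orbit_mult)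
  have "krull_dim ?X = enat (card (- {i0}))"
  proof (rule krull_dim_slice_torus[of \<phi>])
    show "inj_on \<phi> (slice_torus (- {i0}))"
      unfolding T_def[symmetric]
    proof (rule inj_onI)
      fix s t assume st: "s \<in> T" "t \<in> T" "\<phi> s = \<phi> t"
      have "s $ i = t $ i" for i
      proof -
        obtain F G where FG: "\<forall>M t. invertible M \<and> t \<in> T \<and> flag_of M r = torus_act t (flag_of base_matrix r) \<longrightarrow>
      G M \<noteq> 0 \<and> F M = G M * t $ i"
          using regular_coord[of i] unfolding regular_on_orbit_def by (elim exE conjE)
        define M where "M = diagonal s ** base_matrix"
        have "invertible M"
          unfolding M_def using inv st(1) T_torus by auto
        moreover have "flag_of M r = \<phi> s" "flag_of M r = \<phi> t"
          unfolding M_def \<phi>_flag[symmetric] using st(3) by simp_all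
        ultimately have "G M \<noteq> 0 \<and> F M = G M * s $ i" "G M \<noteq> 0 \<and> F M = G M * t $ i"
          unfolding \<phi>_def using FG st(1,2) by blast+
        then show ?thesis by auto
      qed
      then show "s = t"
        by (simp add: vec_eq_iff)
    qed
    show "\<phi> ` slice_torus (- {i0}) = topspace ?X"
      unfolding T_def[symmetric] top by (rule img)
  next
    fix A assume "closedin ?X A"
    then obtain C where C: "closedin (zariski_Gr r) C" "A = C \<inter> generic_orbit"
      unfolding closedin_subtopology by auto
    have "openin (zariski_Gr r) (Gr r - C)"
      using C(1) unfolding closedin_def topspace_zariski_Gr[OF r] by simp
    then obtain S where S: "\<forall>f\<in>S. mat_polynomial f"
        "{M. invertible M \<and> flag_of M r \<in> Gr r - C} = {M. invertible M \<and> (\<exists>f\<in>S. f M \<noteq> 0)}"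
      unfolding openin_zariski_Gr openin_zariski_GL by auto
    define S' where "S' = (\<lambda>f t. f (diagonal t ** base_matrix)) ` S"
    have "vec_polynomial (\<lambda>t. f (diagonal t ** base_matrix))" if "mat_polynomial f" for f
      using that
    proof induction
      case (entry i j)
      have "(diagonal t ** base_matrix) $ i $ j = t $ i * base_matrix $ i $ j" for t
        by (rule diagonal_mult_entry)
      then show ?case
        by (simp add: vec_polynomial.mult vec_polynomial.coord vec_polynomial.const)
    qed (simp_all add: vec_polynomial.const vec_polynomial.add vec_polynomial.mult)
    then have "\<forall>h\<in>S'. vec_polynomial h"
      using S(1) by (auto simp: S'_def)
    moreover have "\<phi> t \<in> A \<longleftrightarrow> (\<forall>h\<in>S'. h t = 0)" if t: "t \<in> T" for t
    proof -
      have M: "invertible (diagonal t ** base_matrix)"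
        using inv t T_torus by auto
      have "\<phi> t \<in> Gr r - C \<longleftrightarrow> (\<exists>f\<in>S. f (diagonal t ** base_matrix) \<noteq> 0)"
        unfolding \<phi>_flag using S(2) M by (auto simp: set_eq_iff)
      moreover have "\<phi> t \<in> generic_orbit"
        using img t by auto
      ultimately show ?thesis
        using orbit_Gr unfolding C(2) S'_def by auto
    qed
    ultimately show "\<exists>S. (\<forall>h\<in>S. vec_polynomial h) \<and>
        (\<forall>t\<in>slice_torus (- {i0}). \<phi> t \<in> A \<longleftrightarrow> (\<forall>h\<in>S. h t = 0))"
      unfolding T_def[symmetric] by (intro exI[of _ S']) simp
  next
    fix h :: "complex ^ 'n::{finite,wellorder} \<Rightarrow> complex"
    assume "vec_polynomial h"
    then have "regular_on_orbit T h"
      by (rule regular)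
    then obtain F G where FG: "mat_polynomial F" "mat_polynomial G"
      "\<forall>M t. invertible M \<and> t \<in> T \<and> flag_of M r = torus_act t (flag_of base_matrix r) \<longrightarrow>
      G M \<noteq> 0 \<and> F M = G M * h t"
      unfolding regular_on_orbit_def by (elim exE conjE)
    \<comment> \<open>As G vanishes at no representative of an orbit point and F = G h there, F
      vanishes at such a representative exactly when h does at its parameter.\<close>
    define C where "C = {V \<in> Gr r. \<forall>M. invertible M \<and> flag_of M r = V \<longrightarrow> F M = 0}"
    have "\<phi> t \<in> C \<longleftrightarrow> h t = 0" if t: "t \<in> T" for t
    proof -
      define M where "M = diagonal t ** base_matrix"
      have M: "invertible M" "flag_of M r = \<phi> t"
        unfolding M_def \<phi>_flag using inv t T_torus by auto
      show ?thesis
      proof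
        assume "\<phi> t \<in> C"
        then have "F M = 0"
          using M unfolding C_def by auto
        then show "h t = 0"
          using FG(3) M t by (simp add: \<phi>_def)
      next
        assume "h t = 0"
        then have "F N = 0" if "invertible N" "flag_of N r = \<phi> t" for N
          using FG(3) that t by (simp add: \<phi>_def)
        moreover have "\<phi> t \<in> Gr r"
          using M flag_of_in_Gr[OF M(1) r] by simp
        ultimately show "\<phi> t \<in> C"
          unfolding C_def by simp
      qed
    qed
    then have "\<phi> ` {t \<in> T. h t = 0} = C \<inter> generic_orbit"
      unfolding img[symmetric] by auto
    moreover have "closedin (zariski_Gr r) C"
      unfolding C_def by (rule closedin_zariski_Gr_zero[OF FG(1) r])
    ultimately show "closedin ?X (\<phi> ` {t \<in> slice_torus (- {i0}). h t = 0})"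
      unfolding T_def[symmetric] closedin_subtopology by auto
  qed
  also have "card (- {i0}) = CARD('n) - 1"
    by (simp add: Compl_eq_Diff_UNIV)
  finally show ?thesis .
qed

end

subsection \<open>Reduced bases of points of the quasisymmetric Grassmannian\<close>

text \<open>Reads a reduced basis as a cell matrix. The nontrivial blocks have a single element p
  \<open><= r\<close>, a non-pivot, and maximum \<open>q p\<close>; then \<open>w p = q p\<close>,
  pivots \<open><= r\<close> are fixed, and \<open>w\<close> maps the first \<open>r\<close> columns
  onto the pivots. The allowed entries come from splitting the block of p, or from merging with the
  block of the preceding non-pivot.\<close>

lemma subspace_in_QGr:
  fixes b :: "'n::{finite,wellorder} \<Rightarrow> complex ^ 'n::{finite,wellorder}" and P J :: "'n set"
  assumes P: "P = first_indices r - J" and Q: "q ` P = J - first_indices r"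
    and q_antimono: "\<And>p p'. p \<in> P \<Longrightarrow> p' \<in> P \<Longrightarrow> p < p' \<Longrightarrow> q p' < q p"
    and b_pivot: "\<And>j. j \<in> J \<Longrightarrow> b j $ j = 1"
    and b_first: "\<And>j i. j \<in> J \<Longrightarrow> j \<in> first_indices r \<Longrightarrow> i \<noteq> j \<Longrightarrow> b j $ i \<noteq> 0 \<Longrightarrow>
        i \<in> P \<and> i < j \<and> (\<forall>p\<in>P. \<not> (i < p \<and> p < j))"
    and b_last: "\<And>p i. p \<in> P \<Longrightarrow> i \<noteq> q p \<Longrightarrow> b (q p) $ i \<noteq> 0 \<Longrightarrow>
        i \<in> P \<and> i \<le> p \<and> (\<forall>p'\<in>P. \<not> (i < p' \<and> p' < p)) \<or>
        i \<notin> first_indices r \<and> i < q p \<and> (\<forall>p'\<in>P. p < p' \<longrightarrow> q p' < i)"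
    and V: "V = vec.span (b ` J)"
  shows "V \<in> QGr r"
proof -
  \<comment> \<open>As \<open>q\<close> reverses the order, the intervals from p to
    \<open>q p\<close> are nested; an index beyond \<open>r\<close> joins the innermost one reaching
    it, and one beyond all of them stays a singleton.\<close>
  define f where "f x = (if x \<notin> first_indices r \<and> (\<exists>p\<in>P. x \<le> q p) then Max {p \<in> P. x \<le> q p} else x)" for x
  have qU: "q p \<notin> first_indices r" if "p \<in> P" for p
    using Q that by auto
  have PL: "p \<in> first_indices r" if "p \<in> P" for p
    using P that by auto
  have LU: "x < y" if "x \<in> first_indices r" "y \<notin> first_indices r" for x y :: 'n
    using that first_indices_down[of x r y] by (metis le_less_linear)
  have f_L: "f x = x" if "x \<in> first_indices r" for x
    using that by (simp add: f_def)
  have f_iff: "f d = p \<longleftrightarrow> d \<le> q p \<and> (\<forall>p'\<in>P. p < p' \<longrightarrow> q p' < d)"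
    if d: "d \<notin> first_indices r" and p: "p \<in> P" for d p
  proof
    assume fd: "f d = p"
    have ex: "\<exists>p\<in>P. d \<le> q p"
      using fd d PL[OF p] by (auto simp: f_def split: if_splits)
    then have "Max {p \<in> P. d \<le> q p} \<in> {p \<in> P. d \<le> q p}"
      by (intro Max_in) auto
    moreover have Max: "Max {p \<in> P. d \<le> q p} = p"
      using fd ex d by (simp add: f_def)
    moreover have "q p' < d" if "p' \<in> P" "p < p'" for p'
    proof (rule ccontr)
      assume "\<not> q p' < d"
      then have "p' \<le> Max {p \<in> P. d \<le> q p}"
        using that by (intro Max_ge) auto
      then show False
        using Max that by simp
    qed
    ultimately show "d \<le> q p \<and> (\<forall>p'\<in>P. p < p' \<longrightarrow> q p' < d)"
      by simp
  next
    assume *: "d \<le> q p \<and> (\<forall>p'\<in>P. p < p' \<longrightarrow> q p' < d)"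
    then have "Max {p \<in> P. d \<le> q p} = p"
      using p by (intro Max_eqI) (auto simp: not_less[symmetric])
    then show "f d = p"
      using * p d by (auto simp: f_def)
  qed
  have f_U: "f d = d \<or> f d \<in> P" for d
  proof (cases "d \<notin> first_indices r \<and> (\<exists>p\<in>P. d \<le> q p)")
    case True
    then have "Max {p \<in> P. d \<le> q p} \<in> {p \<in> P. d \<le> q p}"
      by (intro Max_in) auto
    then show ?thesis
      by (simp add: f_def True)
  next
    case False
    then show ?thesis
      unfolding f_def by metis
  qed
  have f_anti: "f d' \<le> f d" if "d \<notin> first_indices r" "d < d'" "f d \<in> P" "f d' \<in> P" for d d'
  proof (rule ccontr)
    have d': "d' \<notin> first_indices r"
      using that(1) less_imp_le[OF that(2)] first_indices_down[of d' r d] by auto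
    assume "\<not> f d' \<le> f d"
    then have "q (f d') < d"
      using f_iff[OF that(1,3)] that(4) by auto
    moreover have "d' \<le> q (f d')"
      using f_iff[OF d' that(4)] by simp
    ultimately show False
      using that(2) by simp
  qed
  have same: "y \<notin> first_indices r \<and> f y \<in> P" if "x < y" "f x = f y" for x y
  proof -
    have y: "y \<notin> first_indices r"
    proof
      assume "y \<in> first_indices r"
      moreover from this have "x \<in> first_indices r"
        using less_imp_le[OF that(1)] by (rule first_indices_down)
      ultimately show False
        using that f_L by auto
    qed
    moreover have "f y \<noteq> y"
    proof
      assume "f y = y"
      then have "f x \<notin> P" "f x \<noteq> x"
        using y that PL by auto
      then show False
        using f_U[of x] by simp
    qed
    ultimately show ?thesis
      using f_U[of y] by simp
  qed
  have nc: "noncrossing_labelling f"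
    unfolding noncrossing_labelling_def
  proof (intro allI impI; elim conjE)
    fix x p y d
    assume o: "x < p" "p < y" "y < d" and eq: "f x = f y" "f p = f d"
    have y: "y \<notin> first_indices r" "f y \<in> P" and d: "d \<notin> first_indices r" "f d \<in> P"
      using same[of x y] same[of p d] o eq by auto
    have dy: "f d \<le> f y"
      using f_anti[OF y(1) o(3) y(2) d(2)] .
    show "f x = f p"
    proof (cases "p \<in> first_indices r")
      case True
      then have "x \<in> first_indices r"
        using less_imp_le[OF o(1)] by (rule first_indices_down)
      then show ?thesis
        using True dy eq o(1) f_L by simp
    next
      case False
      then have "f y \<le> f p"
        using f_anti[OF False o(2)] y(2) d(2) eq by simp
      then show ?thesis
        using dy eq by simp
    qed
  qed
  obtain w where w: "w \<in> NC" "cyclic_pred f w"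
    using labelling_NC[OF nc] by blast
  have bij: "bij w"
    using w(2) by (rule cyclic_pred_bij)
  have fq: "f (q p) = p" if "p \<in> P" for p
    using f_iff[OF qU[OF that] that] q_antimono[OF that] by auto
  have w_fix: "w t = t" if t: "t \<in> first_indices r" "t \<notin> P" for t
  proof -
    have "f (w t) = t"
      using cyclic_pred_label[OF w(2), of t] f_L[OF t(1)] by simp
    then show ?thesis
      using f_U[of "w t"] t(2) by auto
  qed
  have w_P: "w p = q p" if p: "p \<in> P" for p
  proof -
    have fw: "f (w p) = p" and fp: "f p = p"
      using cyclic_pred_label[OF w(2), of p] f_L[OF PL[OF p]] by simp_all
    have "p \<le> w p"
      using fw f_L[of "w p"] PL[OF p] LU[of p "w p"] by (cases "w p \<in> first_indices r") auto
    then have "q p \<le> w p"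
      using cyclic_pred_ge[OF w(2), of p "q p"] fq[OF p] fp by simp
    then have "w p \<notin> first_indices r"
      using qU[OF p] first_indices_down by blast
    then show ?thesis
      using f_iff[OF _ p, of "w p"] fw \<open>q p \<le> w p\<close> by simp
  qed
  have inv_P: "inv w p \<notin> first_indices r \<and> f (inv w p) = p" if p: "p \<in> P" for p
  proof -
    have wi: "w (inv w p) = p"
      using bij by (simp add: bij_is_surj surj_f_inv_f)
    then have fi: "f (inv w p) = p"
      using cyclic_pred_label[OF w(2), of "inv w p"] f_L[OF PL[OF p]] by simp
    moreover have "inv w p \<noteq> p"
      using wi w_P[OF p] qU[OF p] PL[OF p] by auto
    ultimately show ?thesis
      using f_L[of "inv w p"] by auto
  qed
  have p_less: "p < q p" if "p \<in> P" for p
    by (rule LU[OF PL[OF that] qU[OF that]])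
  have f_inj: "x = t" if "f x = t" "t \<notin> P" for x t
    using f_U[of x] that by auto
  have Inv_first: "(i, t) \<in> Inv_NC w"
    if t: "t \<in> first_indices r" "t \<notin> P" and i: "i \<in> P" "i < t" "\<forall>p\<in>P. \<not> (i < p \<and> p < t)" for i t
  proof -
    have "(i, w t) \<in> Inv_NC w"
    proof (rule Inv_NC_merge[OF nc w(2)])
      show "t \<le> w t" "i < t"
        using w_fix[OF t] i by simp_all
      show "w t < inv w i"
        using w_fix[OF t] inv_P[OF i(1)] LU[OF t(1)] by simp
      show "f i \<noteq> f t"
        using f_L[OF t(1)] f_L[OF PL[OF i(1)]] i(2) by simp
      fix p x d
      assume "f x = f t" and pd: "f p = f d" and o: "i < p" "p < x" "x < d"
      then have x: "x = t"
        using f_inj[of x t] f_L[OF t(1)] t(2) by simp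
      have "p \<in> first_indices r"
        using first_indices_down[OF t(1), of p] o x by simp
      then have "p \<in> P"
        using same[of p d] pd o f_L[of p] by auto
      then show "f p = f i \<or> f p = f t"
        using i(3) o x by auto
    qed
    then show ?thesis
      by (simp add: w_fix[OF t])
  qed
  have Inv_last: "(i, q p) \<in> Inv_NC w"
    if p: "p \<in> P" and i: "i \<in> P \<and> i \<le> p \<and> (\<forall>p'\<in>P. \<not> (i < p' \<and> p' < p)) \<or>
        i \<notin> first_indices r \<and> i < q p \<and> (\<forall>p'\<in>P. p < p' \<longrightarrow> q p' < i)" for i p
  proof -
    have wp: "p \<le> w p"
      using w_P[OF p] p_less[OF p] by simp
    show ?thesis
    proof (cases "f i = f p")
      case True
      have "i < w p"
        using i w_P[OF p] p_less[OF p] by auto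
      then have "(i, w p) \<in> Inv_NC w"
        by (rule Inv_NC_split[OF nc w(2) wp True])
      then show ?thesis
        by (simp add: w_P[OF p])
    next
      case False
      have "i \<in> first_indices r"
      proof (rule ccontr)
        assume "i \<notin> first_indices r"
        then have "f i = p"
          using i PL f_iff[OF _ p, of i] by auto
        then show False
          using False f_L[OF PL[OF p]] by simp
      qed
      then have iP: "i \<in> P" "i < p" "\<And>p'. p' \<in> P \<Longrightarrow> \<not> (i < p' \<and> p' < p)"
        using i False by (auto simp: le_less)
      have "(i, w p) \<in> Inv_NC w"
      proof (rule Inv_NC_merge[OF nc w(2) wp iP(2) _ False])
        show "w p < inv w i"
          using f_iff[of "inv w i" i] inv_P[OF iP(1)] iP p w_P[OF p] by simp
        fix p' x d
        assume x: "f x = f p" and pd: "f p' = f d" and o: "i < p'" "p' < x" "x < d"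
        have d: "d \<notin> first_indices r" "f d \<in> P"
          using same[of p' d] pd o by auto
        have fp: "f p = p" "f i = i"
          using f_L PL p iP(1) by auto
        show "f p' = f i \<or> f p' = f p"
        proof (cases "p' \<in> first_indices r")
          case True
          then have p': "p' \<in> P" "f d = p'"
            using d(2) pd f_L[OF True] by auto
          then have "p \<le> p'"
            using iP(3)[OF p'(1)] o(1) by auto
          show ?thesis
          proof (cases "p = p'")
            case False
            then have "p < p'"
              using \<open>p \<le> p'\<close> by simp
            then have xU: "x \<notin> first_indices r"
              using x fp f_L[of x] o(2) by auto
            then have "q p' < x"
              using f_iff[OF xU p] x fp p' \<open>p < p'\<close> by auto
            moreover have "d \<le> q p'"
              using f_iff[OF d(1) p'(1)] p' by simp
            ultimately show ?thesis
              using o by simp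
          qed simp
        next
          case p'U: False
          then have xU: "x \<notin> first_indices r"
            using first_indices_down[of x r p'] less_imp_le[OF o(2)] by auto
          have "f d \<le> f x"
            using f_anti[OF xU o(3)] x fp p d by simp
          moreover have "f x \<le> f p'"
            using f_anti[OF p'U o(2)] x fp p d pd by simp
          ultimately show ?thesis
            using pd x by simp
        qed
      qed
      then show ?thesis
        by (simp add: w_P[OF p])
    qed
  qed
  \<comment> \<open>The columns after the first \<open>r\<close> do not affect the subspace; unit
    vectors there satisfy the conditions of the cell.\<close>
  define M where "M = (\<chi> i c. if c \<in> first_indices r then b (w c) $ i else axis (w c) 1 $ i)"
  have wJ: "w c \<in> J" if "c \<in> first_indices r" for c
    using that P Q w_fix[of c] w_P[of c] by (cases "c \<in> P") auto
  have "M \<in> NC_cell_matrices w"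
    unfolding NC_cell_matrices_def
  proof (intro CollectI conjI allI impI; (elim conjE)?)
    fix c
    show "M $ w c $ c = 1"
      using b_pivot wJ[of c] by (simp add: M_def)
  next
    fix i c assume ne: "i \<noteq> w c" and notin: "(i, w c) \<notin> Inv_NC w"
    show "M $ i $ c = 0"
    proof (rule ccontr)
      assume nz: "M $ i $ c \<noteq> 0"
      then have c: "c \<in> first_indices r" "b (w c) $ i \<noteq> 0"
        using ne by (auto simp: M_def axis_def split: if_splits)
      show False
      proof (cases "c \<in> P")
        case True
        then show False
          using b_last[OF True, of i] Inv_last[OF True, of i] c ne notin w_P[OF True] by simp
      next
        case False
        have cJ: "c \<in> J"
          using False c P by auto
        show False
          using b_first[OF cJ c(1), of i] Inv_first[OF c(1) False, of i] c ne notin w_fix[OF c(1) False] by simp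
      qed
    qed
  qed
  moreover have "flag_of M r = V"
  proof -
    have "w ` first_indices r = J"
    proof
      show "w ` first_indices r \<subseteq> J"
        using wJ by auto
      show "J \<subseteq> w ` first_indices r"
      proof
        fix j assume j: "j \<in> J"
        show "j \<in> w ` first_indices r"
        proof (cases "j \<in> first_indices r")
          case True
          then have "w j = j"
            using w_fix j P by auto
          then show ?thesis
            using True by (metis imageI)
        next
          case False
          then obtain p where "p \<in> P" "j = q p"
            using Q j by auto
          then show ?thesis
            using w_P PL by (metis imageI)
        qed
      qed
    qed
    moreover have "column c M = b (w c)" if "c \<in> first_indices r" for c
      using that by (simp add: M_def column_def vec_eq_iff)
    ultimately have "(\<lambda>c. column c M) ` first_indices r = b ` J"
      by (metis (mono_tags, lifting) image_cong image_image)
    then show ?thesis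
      by (simp add: flag_of_first_indices V)
  qed
  ultimately have "flag_of M \<in> NC_cell w" "flag_of M r = V"
    unfolding NC_cell_def by auto
  then show ?thesis
    unfolding QGr_def QFl_def using w(1) by (intro image_eqI[of _ _ "flag_of M"]) auto
qed

section \<open>Rank bounds, initial segments and the closures of generic orbits\<close>

lemma card_dual_family_le_dim:
  fixes u :: "'n \<Rightarrow> complex ^ 'n"
  assumes "\<And>j. j \<in> J \<Longrightarrow> u j \<in> W" "\<And>j. j \<in> J \<Longrightarrow> u j $ j \<noteq> 0"
    "\<And>j i. j \<in> J \<Longrightarrow> i \<in> J \<Longrightarrow> i \<noteq> j \<Longrightarrow> u j $ i = 0"
  shows "card J \<le> vec.dim W"
proof -
  have inj: "inj_on u J"
    by (rule inj_onI) (metis assms(2,3))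
  have "vec.independent (u ` J)"
  proof (rule vec.independent_if_scalars_zero)
    fix f x assume f: "(\<Sum>x\<in>u ` J. f x *s x) = 0" and x: "x \<in> u ` J"
    then obtain j where j: "j \<in> J" "x = u j" by auto
    have "0 = (\<Sum>k\<in>J. f (u k) *s u k) $ j"
      using f by (simp add: sum.reindex[OF inj])
    also have "\<dots> = (\<Sum>k\<in>J. if k = j then f (u j) * u j $ j else 0)"
      unfolding sum_component using assms(3) j by (intro sum.cong) auto
    finally show "f x = 0"
      using assms(2)[OF j(1)] j by simp
  qed simp
  then have "card (u ` J) \<le> vec.dim W"
    using assms(1) by (intro vec.independent_card_le_dim) auto
  then show ?thesis
    by (simp add: card_image[OF inj])
qed

lemma ex_card_less_eq:
  fixes Q :: "'a::wellorder set"
  assumes "finite Q" "k < card Q"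
  shows "\<exists>x\<in>Q. card {y \<in> Q. y < x} = k"
proof -
  obtain h where h: "bij_betw h {..<card Q} Q" "strict_mono_on {..<card Q} h"
    using ex_bij_betw_strict_mono_card[OF assms(1)] by blast
  have "{y \<in> Q. y < h k} = h ` {..<k}"
  proof (intro equalityI subsetI)
    fix y assume y: "y \<in> {y \<in> Q. y < h k}"
    then obtain i where i: "i < card Q" "y = h i"
      using h(1) unfolding bij_betw_def by auto
    have "i < k"
    proof (rule ccontr)
      assume "\<not> i < k"
      then have "h k \<le> h i"
        using strict_mono_onD[OF h(2), of k i] assms(2) i by (cases "i = k") auto
      then show False
        using y i by (auto simp: not_less[symmetric])
    qed
    then show "y \<in> h ` {..<k}"
      using i by auto
  next
    fix y assume "y \<in> h ` {..<k}"
    then obtain i where "i < k" "y = h i" by auto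
    then show "y \<in> {y \<in> Q. y < h k}"
      using strict_mono_onD[OF h(2), of i k] assms(2) bij_betwE[OF h(1)] by auto
  qed
  moreover have "inj_on h {..<k}"
    using bij_betw_imp_inj_on[OF h(1)] by (rule inj_on_subset) (use assms(2) in auto)
  ultimately show ?thesis
    using bij_betwE[OF h(1)] assms(2) by (intro bexI[of _ "h k"]) (auto simp: card_image)
qed

lemma downsets_eq_if_card_eq:
  fixes Q :: "'a::linorder set"
  assumes "finite Q" "A \<subseteq> Q" "B \<subseteq> Q" "card A = card B"
    and "\<And>x y. x \<in> A \<Longrightarrow> y \<in> Q \<Longrightarrow> y < x \<Longrightarrow> y \<in> A" "\<And>x y. x \<in> B \<Longrightarrow> y \<in> Q \<Longrightarrow> y < x \<Longrightarrow> y \<in> B"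
  shows "A = B"
proof -
  have "A \<subseteq> B \<or> B \<subseteq> A"
  proof (rule ccontr)
    assume "\<not> ?thesis"
    then obtain x y where "x \<in> A" "x \<notin> B" "y \<in> B" "y \<notin> A" by auto
    then show False
      using assms(2,3) assms(5)[of x y] assms(6)[of y x] by (cases x y rule: linorder_cases) auto
  qed
  moreover have "finite A" "finite B"
    using assms(1-3) finite_subset by auto
  ultimately show ?thesis
    using assms(4) card_subset_eq by metis
qed

context interval_matching
begin

text \<open>
  For a non-pivot \<open>p \<le> r\<close>, the two rank conditions of the orbit attached to the interval of \<open>p\<close>
  together leave no room: both hold with equality, which forces the supports of the basis vectors.
\<close>

lemma echelon_tight:
  fixes b :: "'n \<Rightarrow> complex ^ 'n::{finite,wellorder}"
  assumes V: "V \<in> zariski_Gr r closure_of generic_orbit"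
    and J: "card J = r"
    and basis: "\<forall>j\<in>J. b j \<in> V \<and> b j $ j = 1 \<and> (\<forall>i\<in>J. i \<noteq> j \<longrightarrow> b j $ i = 0)"
    and p: "p \<in> first_indices r - J"
  defines "A \<equiv> {x. \<kappa> x \<le> \<kappa> p}"
    and "B \<equiv> {x. if x \<in> first_indices r then \<kappa> p \<le> \<kappa> x else \<kappa> p < \<kappa> x}"
  shows "\<And>j i. j \<in> J \<Longrightarrow> j \<in> A \<Longrightarrow> b j $ i \<noteq> 0 \<Longrightarrow> i \<in> A"
    and "\<And>j i. j \<in> J \<Longrightarrow> j \<in> B \<Longrightarrow> b j $ i \<noteq> 0 \<Longrightarrow> i \<in> B"
    and "\<And>p'. p' \<in> first_indices r - J \<Longrightarrow> \<kappa> p' = \<kappa> p \<Longrightarrow> p' = p"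
    and "card (J - A) = card {b \<in> first_indices r. \<kappa> p < \<kappa> b}"
proof -
  have bV: "b j \<in> V" and b1: "b j $ j = 1" if "j \<in> J" for j
    using basis that by auto
  have b0: "b j $ i = 0" if "j \<in> J" "i \<in> J" "i \<noteq> j" for j i
    using basis that by auto
  define L :: "'n set" where "L = first_indices r"
  define I where "I = {x \<in> L. \<kappa> x = \<kappa> p}"
  have pI: "p \<in> I"
    using p by (simp add: I_def L_def)
  \<comment> \<open>The basis vectors with pivots outside \<open>S\<close> stay independent after
    deleting the coordinates in \<open>S\<close>.\<close>
  have lower: "card (J - S) \<le> vec.dim (coordinate_projection S ` V)" for S
  proof (rule card_dual_family_le_dim[where u = "\<lambda>j. coordinate_projection S (b j)"])
    fix j assume "j \<in> J - S"
    then show "coordinate_projection S (b j) \<in> coordinate_projection S ` V"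
      "coordinate_projection S (b j) $ j \<noteq> 0"
      using bV b1 by (auto simp: coordinate_projection_def)
  qed (auto simp: coordinate_projection_def b0)
  \<comment> \<open>A vector with pivot inside \<open>S\<close> but a nonzero entry \<open>i\<close>
    outside adds one to the rank: it takes \<open>i\<close> as pivot, and its multiples clear
    position \<open>i\<close> in the other vectors.\<close>
  have strict: "Suc (card (J - S)) \<le> vec.dim (coordinate_projection S ` V)"
    if j: "j \<in> J" "j \<in> S" and i: "b j $ i \<noteq> 0" "i \<notin> S" for S j i
  proof -
    define v where "v = coordinate_projection S (b j)"
    define u where "u k = (if k = i then v
        else coordinate_projection S (b k) - (coordinate_projection S (b k) $ i / v $ i) *s v)" for k
    have vi: "v $ i \<noteq> 0"
      using i by (simp add: v_def coordinate_projection_def)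
    have v0: "v $ k = 0" if "k \<in> J - S" for k
      using that j b0[of j k] by (auto simp: v_def coordinate_projection_def)
    have "i \<notin> J - S"
      using vi v0 by auto
    have sub: "vec.subspace (coordinate_projection S ` V)"
    proof -
      have "V \<in> topspace (zariski_Gr r)"
        using V by (simp add: in_closure_of)
      then have "vec.subspace V"
        by (simp add: topspace_zariski_Gr[OF r] Gr_def)
      then show ?thesis
        by (rule vec.linear_subspace_image[OF coordinate_projection_linear])
    qed
    have "card (insert i (J - S)) \<le> vec.dim (coordinate_projection S ` V)"
    proof (rule card_dual_family_le_dim[where u = u])
      fix k assume k: "k \<in> insert i (J - S)"
      show "u k \<in> coordinate_projection S ` V"
        unfolding u_def v_def using k bV j(1)
        by (auto intro!: vec.subspace_diff[OF sub] vec.subspace_scale[OF sub])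
      show "u k $ k \<noteq> 0"
        using k vi v0[of k] b1[of k] by (auto simp: u_def coordinate_projection_def)
      fix l assume "l \<in> insert i (J - S)" "l \<noteq> k"
      then show "u k $ l = 0"
        using k vi v0[of l] b0[of k l] \<open>i \<notin> J - S\<close> by (auto simp: u_def coordinate_projection_def)
    qed
    then show ?thesis
      using \<open>i \<notin> J - S\<close> by simp
  qed
  have upper: "vec.dim (coordinate_projection S ` V) \<le> card {b \<in> L. \<not> supp b \<subseteq> S}" for S
    unfolding L_def by (rule closure_projection_dim[OF V r generic_orbit_projection_dim])
  have cases: "i = b \<or> i = \<kappa> b \<and> \<kappa> b \<noteq> b \<or> i \<notin> L \<and> \<kappa> i = b \<and> \<kappa> b = b \<or>
      \<kappa> b = b \<and> \<kappa> i = i \<and> i < b \<and> (\<forall>c. \<kappa> c = c \<longrightarrow> \<not> (i < c \<and> c < b))" if "i \<in> supp b" for i b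
    using that by (auto simp: supp_def L_def split: if_splits)
  have "supp b \<subseteq> A" if "\<kappa> b \<le> \<kappa> p" for b
  proof
    fix i assume "i \<in> supp b"
    then show "i \<in> A"
      using cases[of i b] that \<kappa>_idem[of b] unfolding A_def by auto
  qed
  then have "{b \<in> L. \<not> supp b \<subseteq> A} \<subseteq> {b \<in> L. \<kappa> p < \<kappa> b}"
    by (auto simp: not_less[symmetric])
  then have "card {b \<in> L. \<not> supp b \<subseteq> A} \<le> card {b \<in> L. \<kappa> p < \<kappa> b}"
    by (intro card_mono) auto
  then have upA: "vec.dim (coordinate_projection A ` V) \<le> card {b \<in> L. \<kappa> p < \<kappa> b}"
    using upper[of A] by simp
  \<comment> \<open>The centre \<open>\<kappa> p\<close> itself is excluded: its support contains
    its indices beyond \<open>r\<close>, which are not in \<open>B\<close>. It accounts for the one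
    extra unit in the bound for \<open>B\<close>.\<close>
  have "supp b \<subseteq> B" if b: "b \<in> L" "\<kappa> p \<le> \<kappa> b" "b \<noteq> \<kappa> p" for b
  proof
    fix i assume "i \<in> supp b"
    from cases[OF this] show "i \<in> B"
    proof (elim disjE conjE)
      assume *: "\<kappa> b = b" "\<kappa> i = i" "i < b" "\<forall>c. \<kappa> c = c \<longrightarrow> \<not> (i < c \<and> c < b)"
      have "\<kappa> p < b"
        using b * by auto
      then have "\<kappa> p \<le> i"
        using *(4) \<kappa>_idem[of p] by auto
      then show "i \<in> B"
        using * \<kappa>_first[of i] by (simp add: B_def)
    qed (use b \<kappa>_idem[of b] \<kappa>_first[of b] in \<open>auto simp: B_def L_def\<close>)
  qed
  then have "{b \<in> L. \<not> supp b \<subseteq> B} \<subseteq> insert (\<kappa> p) {b \<in> L. \<kappa> b < \<kappa> p}"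
    by (auto simp: not_less[symmetric])
  then have "card {b \<in> L. \<not> supp b \<subseteq> B} \<le> card (insert (\<kappa> p) {b \<in> L. \<kappa> b < \<kappa> p})"
    by (intro card_mono) auto
  also have "\<dots> = Suc (card {b \<in> L. \<kappa> b < \<kappa> p})"
    by (subst card_insert_disjoint) (auto simp: \<kappa>_idem)
  finally have upB: "vec.dim (coordinate_projection B ` V) \<le> Suc (card {b \<in> L. \<kappa> b < \<kappa> p})"
    using upper[of B] by simp
  have "card L = card ({b \<in> L. \<kappa> p < \<kappa> b} \<union> {b \<in> L. \<kappa> b < \<kappa> p} \<union> I)"
    by (rule arg_cong[where f = card]) (auto simp: I_def)
  also have "\<dots> = card {b \<in> L. \<kappa> p < \<kappa> b} + card {b \<in> L. \<kappa> b < \<kappa> p} + card I"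
    by (subst card_Un_disjoint; (auto simp: I_def)?)+
  finally have cardL: "r = card {b \<in> L. \<kappa> p < \<kappa> b} + card {b \<in> L. \<kappa> b < \<kappa> p} + card I"
    unfolding L_def card_first_indices[OF r] .
  \<comment> \<open>The complements of \<open>A\<close> and \<open>B\<close> partition the indices
    beyond \<open>r\<close>; among the indices \<open><= r\<close> they leave out exactly
    \<open>I\<close>, the interval of \<open>p\<close>.\<close>
  have "card J = card ((J - A) \<union> (J - B) \<union> (J \<inter> I))"
    by (rule arg_cong[where f = card]) (auto simp: A_def B_def I_def L_def)
  also have "\<dots> = card (J - A) + card (J - B) + card (J \<inter> I)"
    by (subst card_Un_disjoint; (auto simp: A_def B_def I_def L_def split: if_splits)?)+
  finally have cardJ: "r = card (J - A) + card (J - B) + card (J \<inter> I)"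
    unfolding J .
  have "card (J \<inter> I) + card (I - J) = card I"
    by (subst card_Un_disjoint[symmetric]) (auto intro: arg_cong[where f = card])
  moreover have "0 < card (I - J)"
    using pI p by (auto simp: card_gt_0_iff)
  \<comment> \<open>The bounds on \<open>J - A\<close> and \<open>J - B\<close> total one more than
    r - |I|, while \<open>J \<inter> I\<close> misses at least \<open>p\<close>. All inequalities
    are therefore equalities and \<open>p\<close> is the only non-pivot in \<open>I\<close>.\<close>
  ultimately have eqA: "card (J - A) = card {b \<in> L. \<kappa> p < \<kappa> b}"
      and eqB: "card (J - B) = Suc (card {b \<in> L. \<kappa> b < \<kappa> p})" and one: "card (I - J) = 1"
    using cardL cardJ lower[of A] lower[of B] upA upB by linarith+
  show "card (J - A) = card {b \<in> first_indices r. \<kappa> p < \<kappa> b}"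
    using eqA by (simp add: L_def)
  show "i \<in> A" if "j \<in> J" "j \<in> A" "b j $ i \<noteq> 0" for j i
    using strict[OF that(1,2,3)] eqA upA by fastforce
  show "i \<in> B" if "j \<in> J" "j \<in> B" "b j $ i \<noteq> 0" for j i
    using strict[OF that(1,2,3)] eqB upB by fastforce
  show "p' = p" if "p' \<in> first_indices r - J" "\<kappa> p' = \<kappa> p" for p'
  proof -
    obtain x where "I - J = {x}"
      using one by (rule card_1_singletonE)
    moreover have "p' \<in> I - J" "p \<in> I - J"
      using that p pI by (auto simp: I_def L_def)
    ultimately show ?thesis by auto
  qed
qed

text \<open>Non-pivots \<open><= r\<close> and pivots beyond \<open>r\<close> are equally many and
  are matched in reverse order by \<open>q\<close>. Tightness at one non-pivot confines the supports
  from one side; tightness at the others excludes skipping over a non-pivot.\<close>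

lemma closure_generic_orbit_subset: "zariski_Gr r closure_of generic_orbit \<subseteq> QGr r"
proof
  fix V assume V: "V \<in> zariski_Gr r closure_of generic_orbit"
  then have Gr: "V \<in> Gr r"
    using topspace_zariski_Gr[OF r] by (auto simp: in_closure_of)
  from reduced_echelon_basis[OF Gr] obtain J b where J: "card J = r"
    and basis: "\<forall>j\<in>J. b j \<in> V \<and> b j $ j = 1 \<and> (\<forall>i. j < i \<longrightarrow> b j $ i = 0) \<and> (\<forall>i\<in>J. i \<noteq> j \<longrightarrow> b j $ i = 0)"
    and expand: "\<forall>v\<in>V. v = (\<Sum>j\<in>J. v $ j *s b j)"
    by blast
  have bV: "b j \<in> V" and b1: "b j $ j = 1" if "j \<in> J" for j
    using basis that by auto
  have last: "b j $ i = 0" if "j \<in> J" "j < i" for j i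
    using basis that by auto
  have b0: "b j $ i = 0" if "j \<in> J" "i \<in> J" "i \<noteq> j" for j i
    using basis that by auto
  define L :: "'n set" where "L = first_indices r"
  define P where "P = L - J"
  define Q where "Q = J - L"
  have "\<forall>j\<in>J. b j \<in> V \<and> b j $ j = 1 \<and> (\<forall>i\<in>J. i \<noteq> j \<longrightarrow> b j $ i = 0)"
    using basis by simp
  note tight = echelon_tight[OF V J this, folded L_def, folded P_def]
  have low: "i \<in> L" if "j \<in> L" "i \<le> j" for i j
    using that first_indices_down unfolding L_def by blast
  have mono: "\<kappa> x \<le> \<kappa> y" if "x \<le> y" "y \<in> L" for x y
    using that low[of y x] \<kappa>_mono unfolding L_def by blast
  have mono_P: "\<kappa> p < \<kappa> p' \<longleftrightarrow> p < p'" if "p \<in> P" "p' \<in> P" for p p'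
  proof
    assume "\<kappa> p < \<kappa> p'"
    then show "p < p'"
      using mono[of p' p] that by (force simp: P_def not_less[symmetric])
  next
    assume "p < p'"
    then show "\<kappa> p < \<kappa> p'"
      using mono[of p p'] tight(3)[OF that] that by (auto simp: P_def le_less)
  qed
  have "card J = card (J \<inter> L) + card Q" "card L = card (J \<inter> L) + card P"
    unfolding P_def Q_def by (subst card_Un_disjoint[symmetric]; auto intro: arg_cong[where f = card])+
  then have cardPQ: "card P = card Q"
    using J card_first_indices[OF r] by (simp add: L_def)
  \<comment> \<open>\<open>q p\<close> is the element of \<open>Q\<close> with as many elements of
    \<open>Q\<close> below it as there are non-pivots of \<open>P\<close> above p.\<close>
  have "\<forall>p\<in>P. \<exists>x. x \<in> Q \<and> card {y \<in> Q. y < x} = card {p' \<in> P. p < p'}"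
  proof
    fix p assume "p \<in> P"
    then have "card {p' \<in> P. p < p'} < card Q"
      unfolding cardPQ[symmetric] by (intro psubset_card_mono) auto
    then show "\<exists>x. x \<in> Q \<and> card {y \<in> Q. y < x} = card {p' \<in> P. p < p'}"
      using ex_card_less_eq[of Q] by auto
  qed
  from bchoice[OF this] obtain q where q: "\<And>p. p \<in> P \<Longrightarrow> q p \<in> Q"
      "\<And>p. p \<in> P \<Longrightarrow> card {y \<in> Q. y < q p} = card {p' \<in> P. p < p'}"
    by auto
  have q_anti: "q p' < q p" if "p \<in> P" "p' \<in> P" "p < p'" for p p'
  proof (rule ccontr)
    assume "\<not> q p' < q p"
    then have "card {y \<in> Q. y < q p} \<le> card {y \<in> Q. y < q p'}"
      by (intro card_mono) auto
    moreover have "card {x \<in> P. p' < x} < card {x \<in> P. p < x}"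
      using that by (intro psubset_card_mono) auto
    ultimately show False
      using q(2) that by simp
  qed
  have "inj_on q P"
    by (rule inj_onI) (metis q_anti less_irrefl linorder_less_linear)
  then have "q ` P = Q"
    using q(1) cardPQ by (intro card_subset_eq) (auto simp: card_image)
  \<comment> \<open>Both conditions cut out initial segments of \<open>Q\<close>, because
    \<open>\<kappa>\<close> is antitone beyond \<open>r\<close>; the exact count of
    \<open>J - A\<close> shows that these segments have equal size.\<close>
  have key: "\<kappa> p < \<kappa> x \<longleftrightarrow> x < q p" if p: "p \<in> P" and x: "x \<in> Q" for p x
  proof -
    have "J - {x. \<kappa> x \<le> \<kappa> p} = {x \<in> Q. \<kappa> p < \<kappa> x} \<union> {x \<in> J \<inter> L. \<kappa> p < \<kappa> x}"
      unfolding Q_def by auto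
    then have "card (J - {x. \<kappa> x \<le> \<kappa> p}) = card {x \<in> Q. \<kappa> p < \<kappa> x} + card {x \<in> J \<inter> L. \<kappa> p < \<kappa> x}"
      by (simp add: card_Un_disjoint Q_def disjoint_iff)
    moreover have "{x \<in> L. \<kappa> p < \<kappa> x} = {p' \<in> P. p < p'} \<union> {x \<in> J \<inter> L. \<kappa> p < \<kappa> x}"
      using mono_P[OF p] unfolding P_def by auto
    then have "card {x \<in> L. \<kappa> p < \<kappa> x} = card {p' \<in> P. p < p'} + card {x \<in> J \<inter> L. \<kappa> p < \<kappa> x}"
      by (simp add: card_Un_disjoint P_def disjoint_iff)
    ultimately have "card {x \<in> Q. \<kappa> p < \<kappa> x} = card {x \<in> Q. x < q p}"
      using tight(4)[OF p] q(2)[OF p] by simp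
    moreover have "y \<in> {x \<in> Q. \<kappa> p < \<kappa> x}" if "x \<in> {x \<in> Q. \<kappa> p < \<kappa> x}" "y \<in> Q" "y < x" for x y
    proof -
      have "\<kappa> x \<le> \<kappa> y"
        using that \<kappa>_antimono[of y x] by (auto simp: Q_def L_def)
      then show ?thesis
        using that by auto
    qed
    ultimately have "{x \<in> Q. \<kappa> p < \<kappa> x} = {x \<in> Q. x < q p}"
      by (intro downsets_eq_if_card_eq[of Q]) auto
    then show ?thesis
      using x by (auto simp: set_eq_iff)
  qed
  show "V \<in> QGr r"
  proof (rule subspace_in_QGr[of P r J q b])
    show "P = first_indices r - J" "q ` P = J - first_indices r"
      using \<open>q ` P = Q\<close> by (simp_all add: P_def Q_def L_def)
    show "\<And>p p'. p \<in> P \<Longrightarrow> p' \<in> P \<Longrightarrow> p < p' \<Longrightarrow> q p' < q p"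
      by (rule q_anti)
    show "\<And>j. j \<in> J \<Longrightarrow> b j $ j = 1"
      by (rule b1)
    show "V = vec.span (b ` J)"
    proof
      show "V \<subseteq> vec.span (b ` J)"
      proof
        fix v assume "v \<in> V"
        then have "v = (\<Sum>j\<in>J. v $ j *s b j)"
          using expand by blast
        also have "\<dots> \<in> vec.span (b ` J)"
          by (intro vec.span_sum vec.span_scale vec.span_base) auto
        finally show "v \<in> vec.span (b ` J)" .
      qed
      show "vec.span (b ` J) \<subseteq> V"
        using Gr bV by (intro vec.span_minimal) (auto simp: Gr_def)
    qed
  next
    fix j i assume j: "j \<in> J" "j \<in> first_indices r" and i: "i \<noteq> j" "b j $ i \<noteq> 0"
    have ij: "i < j"
      using last[OF j(1), of i] i by (metis linorder_neqE)
    have iP: "i \<in> P"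
      using b0[OF j(1), of i] i j(2) ij low[of j i] by (auto simp: P_def L_def)
    \<comment> \<open>A non-pivot \<open>p\<close> strictly between would have \<open>j\<close> in
      its set B; tightness puts \<open>i\<close> there as well, though its interval precedes that of
      \<open>p\<close>.\<close>
    have False if p: "p \<in> P" "i < p" "p < j" for p
    proof -
      have "\<kappa> p \<le> \<kappa> j"
        using mono[of p j] p j(2) by (simp add: L_def)
      then have "\<kappa> p \<le> \<kappa> i"
        using tight(2)[OF p(1) j(1), of i] i(2) j(2) iP by (simp add: L_def P_def)
      then show False
        using mono_P[OF iP p(1)] p(2) by simp
    qed
    then show "i \<in> P \<and> i < j \<and> (\<forall>p\<in>P. \<not> (i < p \<and> p < j))"
      using ij iP by blast
  next
    fix p i assume p: "p \<in> P" and i: "i \<noteq> q p" "b (q p) $ i \<noteq> 0"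
    have qp: "q p \<in> Q" "q p \<in> J" "q p \<notin> L"
      using q(1)[OF p] by (auto simp: Q_def)
    have less: "i < q p"
      using last[OF qp(2), of i] i by (metis linorder_neqE)
    have iJ: "i \<notin> J"
      using b0[OF qp(2), of i] i by auto
    have "\<kappa> (q p) \<le> \<kappa> p"
      using key[OF p qp(1)] by simp
    then have ip: "\<kappa> i \<le> \<kappa> p"
      using tight(1)[OF p qp(2)] i(2) by simp
    show "i \<in> P \<and> i \<le> p \<and> (\<forall>p'\<in>P. \<not> (i < p' \<and> p' < p)) \<or>
        i \<notin> first_indices r \<and> i < q p \<and> (\<forall>p'\<in>P. p < p' \<longrightarrow> q p' < i)"
    proof (cases "i \<in> L")
      case True
      then have iP: "i \<in> P"
        using iJ by (simp add: P_def)
      have "i \<le> p"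
        using ip mono_P[OF p iP] by auto
      \<comment> \<open>From p' < p follows \<open>q p < q p'\<close>, so \<open>key\<close> puts
        \<open>q p\<close> into the set B of p'; tightness there contradicts i < p'.\<close>
      moreover have False if p': "p' \<in> P" "i < p'" "p' < p" for p'
      proof -
        have "\<kappa> p' < \<kappa> (q p)"
          using key[OF p'(1) qp(1)] q_anti[OF p'(1) p p'(3)] by simp
        then have "\<kappa> p' \<le> \<kappa> i"
          using tight(2)[OF p'(1) qp(2), of i] i(2) qp(3) True by (simp add: L_def)
        then show False
          using mono_P[OF iP p'(1)] p'(2) by simp
      qed
      ultimately show ?thesis
        using iP by blast
    next
      case False
      have "q p' < i" if p': "p' \<in> P" "p < p'" for p'
      proof (rule ccontr)
        assume "\<not> q p' < i"
        then have "\<kappa> (q p') \<le> \<kappa> i"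
          using \<kappa>_antimono[of i "q p'"] False q(1)[OF p'(1)] by (auto simp: L_def Q_def)
        moreover have "\<kappa> p < \<kappa> (q p')"
          using key[OF p q(1)[OF p'(1)]] q_anti[OF p p'] by simp
        ultimately show False
          using ip by simp
      qed
      then show ?thesis
        using False less by (auto simp: L_def)
    qed
  qed
qed

end

subsection \<open>Points of the quasisymmetric Grassmannian as limits of generic points\<close>

text \<open>Vectors whose supports are contained in the generic ones become generic when their
  missing entries are filled with small numbers. It suffices that they span the given columns, since
  the dimensions then agree.\<close>

lemma (in interval_matching) flag_of_in_closure_generic_orbit:
  fixes M :: "complex ^ 'n::{finite,wellorder} ^ 'n::{finite,wellorder}"
    and x :: "'n \<Rightarrow> complex ^ 'n::{finite,wellorder}"
  assumes M: "invertible M" and x: "\<And>b i. b \<in> first_indices r \<Longrightarrow> x b $ i \<noteq> 0 \<Longrightarrow> i \<in> supp b"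
    and span: "\<And>c. c \<in> first_indices r \<Longrightarrow> column c M \<in> vec.span (x ` first_indices r)"
  shows "flag_of M r \<in> zariski_Gr r closure_of generic_orbit"
proof -
  define N where "N = (\<chi> i c. if c \<in> first_indices r then x c $ i else M $ i $ c)"
  have N_col: "column c N = (if c \<in> first_indices r then x c else column c M)" for c
    by (simp add: N_def column_def vec_eq_iff)
  have imageN: "(\<lambda>c. column c N) ` first_indices r = x ` first_indices r"
    using N_col by (intro image_cong) auto
  have "column c M \<in> vec.span (range (\<lambda>c. column c N))" for c
  proof (cases "c \<in> first_indices r")
    case True
    then have "column c M \<in> vec.span ((\<lambda>c. column c N) ` first_indices r)"
      unfolding imageN by (rule span)
    also have "\<dots> \<subseteq> vec.span (range (\<lambda>c. column c N))"
      by (intro vec.span_mono image_mono) simp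
    finally show ?thesis .
  next
    case False
    then have "column c M = column c N"
      by (simp add: N_col)
    then show ?thesis
      by (simp add: vec.span_base)
  qed
  then have sub: "vec.span (range (\<lambda>c. column c M)) \<subseteq> vec.span (range (\<lambda>c. column c N))"
    by (intro vec.span_minimal) auto
  have "axis i 1 \<in> vec.span (range (\<lambda>c. column c M))" for i
  proof -
    obtain z where "axis i 1 = M *v z"
      using M unfolding invertible_right_inverse matrix_right_invertible_surjective surj_def by blast
    then have "axis i 1 = (\<Sum>c\<in>UNIV. z $ c *s column c M)"
      by (simp add: matrix_mult_sum)
    also have "\<dots> \<in> vec.span (range (\<lambda>c. column c M))"
      by (intro vec.span_sum vec.span_scale vec.span_base rangeI)
    finally show ?thesis .
  qed
  then have N: "invertible N"
    using sub by (intro invertible_if_axes_in_span) auto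
  have "flag_of M r = flag_of N r"
  proof (rule vec.subspace_dim_equal)
    show "flag_of M r \<subseteq> flag_of N r"
      unfolding flag_of_first_indices imageN using span by (intro vec.span_minimal) auto
    show "vec.dim (flag_of N r) \<le> vec.dim (flag_of M r)"
      using flag_of_in_Gr[OF N r] flag_of_in_Gr[OF M r] by (simp add: Gr_def)
  qed (rule flag_of_subspace)+
  moreover have "flag_of N r \<in> zariski_Gr r closure_of generic_orbit"
  proof (rule flag_of_limit_in_closure[OF _ N r])
    \<comment> \<open>Missing entries on the support are 1/(k+1), never zero, so every term of the
      sequence gives a point of the orbit.\<close>
    define g where "g k i c = (if c \<in> first_indices r
        then if x c $ i \<noteq> 0 then x c $ i else if i \<in> supp c then 1 / of_nat (Suc k) else 0
        else M $ i $ c)" for k :: nat and i c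
    have "(\<lambda>k. g k i c) \<longlonglongrightarrow> N $ i $ c" for i c
    proof (cases "c \<in> first_indices r \<and> x c $ i = 0 \<and> i \<in> supp c")
      case True
      then show ?thesis
        using LIMSEQ_Suc[OF lim_1_over_n] by (simp add: g_def N_def)
    next
      case False
      then have "g k i c = N $ i $ c" for k
        by (auto simp: g_def N_def)
      then show ?thesis by simp
    qed
    then show "(\<lambda>k. \<chi> i c. g k i c) \<longlonglongrightarrow> N"
      by (intro vec_tendstoI) simp
    have "g k i b \<noteq> 0 \<longleftrightarrow> i \<in> supp b" if "b \<in> first_indices r" for k i b
    proof -
      have "(1 / of_nat (Suc k) :: complex) \<noteq> 0"
        using of_nat_neq_0[of k, where ?'a = complex] by simp
      then show ?thesis
        using that x[OF that, of i] by (auto simp: g_def)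
    qed
    then show "flag_of (\<chi> i c. g k i c) r \<in> generic_orbit" for k
      by (intro flag_of_in_generic_orbit) simp
  qed
  ultimately show ?thesis by simp
qed

text \<open>Entries other than the 1 of column c lie in rows before \<open>w c\<close>, so the
  matrix is unitriangular after permuting columns. A kernel vector is tested in the row
  \<open>w c\<close> that is largest among its nonzero coordinates.\<close>

lemma invertible_NC_cell_matrix:
  fixes M :: "complex ^ 'n::{finite,wellorder} ^ 'n::{finite,wellorder}"
  assumes w: "bij w" and M: "M \<in> NC_cell_matrices w"
  shows "invertible M"
  unfolding invertible_left_inverse matrix_left_invertible_ker
proof (intro allI impI)
  fix z assume Mz: "M *v z = 0"
  show "z = 0"
  proof (rule ccontr)
    assume "z \<noteq> 0"
    then have "w ` {c. z $ c \<noteq> 0} \<noteq> {}"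
      by (auto simp: vec_eq_iff)
    then have "Max (w ` {c. z $ c \<noteq> 0}) \<in> w ` {c. z $ c \<noteq> 0}"
      by (intro Max_in) auto
    then obtain c where c: "z $ c \<noteq> 0" "w c = Max (w ` {c. z $ c \<noteq> 0})"
      by auto
    have "M $ w c $ c' * z $ c' = (if c' = c then z $ c else 0)" for c'
    proof (cases "c' = c")
      case True
      then show ?thesis
        using M by (simp add: NC_cell_matrices_def)
    next
      case False
      have "z $ c' = 0" if "M $ w c $ c' \<noteq> 0"
      proof (rule ccontr)
        assume "z $ c' \<noteq> 0"
        then have "w c' \<le> w c"
          unfolding c(2) by (intro Max_ge) auto
        moreover have "w c \<noteq> w c'"
          using w False by (auto simp: bij_def inj_eq)
        then have "(w c, w c') \<in> Inv_NC w"
          using M that by (auto simp: NC_cell_matrices_def)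
        then have "w c < w c'"
          by (simp add: Inv_NC_def)
        ultimately show False by simp
      qed
      then show ?thesis
        using False by auto
    qed
    then have "(M *v z) $ w c = z $ c"
      by (simp add: matrix_vector_mult_def)
    then show False
      using Mz c(1) by simp
  qed
qed

text \<open>
  The centres are the elements \<open>p \<le> r\<close> whose successor in their block exceeds \<open>r\<close>; they belong to
  different blocks, which are nested. After adding to the column of a block the unit vectors
  \<open>e\<^sub>i\<close>, where \<open>i\<close> has a successor \<open>\<le> r\<close> in its block, its support is one of the generic supports.
\<close>

lemma flag_of_NC_cell_matrix_in_closure:
  fixes M :: "complex ^ 'n::{finite,wellorder} ^ 'n::{finite,wellorder}"
  assumes r: "1 \<le> r" "r \<le> CARD('n) - 1" and w: "w \<in> NC" and M: "M \<in> NC_cell_matrices w"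
  shows "\<exists>\<kappa>. interval_matching r \<kappa> \<and>
    flag_of M r \<in> zariski_Gr r closure_of interval_matching.generic_orbit r \<kappa>"
proof -
  obtain f :: "'n \<Rightarrow> 'n set" where f: "noncrossing_labelling f" "cyclic_pred f w"
    using NC_labelling[OF w] by blast
  have bij: "bij w"
    using f(2) by (rule cyclic_pred_bij)
  then have w_inv: "w (inv w i) = i" and inv_w: "inv w (w i) = i" for i
    by (simp_all add: bij_is_surj surj_f_inv_f bij_is_inj)
  have f_inv: "f (inv w i) = f i" for i
    using cyclic_pred_label[OF f(2), of "inv w i"] by (simp add: w_inv)
  have inv_M: "invertible M"
    using bij M by (rule invertible_NC_cell_matrix)
  have rn: "r \<le> CARD('n)"
    using r by simp
  define L :: "'n set" where "L = first_indices r"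
  have low: "i \<in> L" if "j \<in> L" "i \<le> j" for i j
    using that first_indices_down unfolding L_def by blast
  have LU: "x < y" if "x \<in> L" "y \<notin> L" for x y
    using that low[of x y] by (metis le_less_linear)
  have cardL: "card L = r"
    unfolding L_def by (rule card_first_indices[OF rn])
  moreover have "0 < CARD('n)"
    by simp
  ultimately have L_ne: "L \<noteq> {}" and "card L \<noteq> CARD('n)"
    using r by auto
  then have "L \<noteq> UNIV"
    by metis
  then obtain u where u: "u \<notin> L" by auto
  have M_Inv: "(i, w c) \<in> Inv_NC w" if "M $ i $ c \<noteq> 0" "i \<noteq> w c" for i c
    using M that by (auto simp: NC_cell_matrices_def)
  have Inv_less: "i < w c" if "(i, w c) \<in> Inv_NC w" for i c
    using that by (simp add: Inv_NC_def)
  define C where "C = {p \<in> L. inv w p \<notin> L}"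
  show ?thesis
  proof (cases "C = {}")
    case True
    \<comment> \<open>No block straddles \<open>r\<close>, so \<open>w\<close> preserves
      \<open>L\<close> and the point is the coordinate subspace on \<open>L\<close>. Since b lies in
      every \<open>supp b\<close>, any matching would do; the constant one is taken, and r < n
      provides its index beyond \<open>r\<close>.\<close>
    define m where "m = Max L"
    have m: "m \<in> L"
      unfolding m_def using L_ne by (intro Max_in) auto
    interpret interval_matching r "\<lambda>_. m"
      by unfold_locales (use m u rn in \<open>auto simp: L_def\<close>)
    have "inv w ` L \<subseteq> L"
      using True by (auto simp: C_def)
    moreover have "inj_on (inv w) L"
      using bij by (metis bij_betw_imp_inj_on bij_imp_bij_inv inj_on_subset subset_UNIV)
    ultimately have "inv w ` L = L"
      by (intro endo_inj_surj) auto
    then have wL: "w c \<in> L" if "c \<in> L" for c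
      using that w_inv by (metis imageE)
    have "flag_of M r \<in> zariski_Gr r closure_of generic_orbit"
    proof (rule flag_of_in_closure_generic_orbit[OF inv_M])
      show "i \<in> supp b" if "axis b 1 $ i \<noteq> (0 :: complex)" for b i
        using that by (auto simp: axis_def supp_def split: if_splits)
      fix c :: 'n assume c: "c \<in> first_indices r"
      have "i \<in> L" if "M $ i $ c \<noteq> 0" for i
        using wL[of c] M_Inv[OF that] Inv_less[of i c] low[of "w c" i] c
        by (cases "i = w c") (auto simp: L_def)
      then have "column c M = (\<Sum>i\<in>L. M $ i $ c *s axis i 1)"
        by (auto simp: vec_eq_iff column_def sum_component axis_def if_distrib cong: if_cong)
      also have "\<dots> \<in> vec.span ((\<lambda>b. axis b 1) ` first_indices r)"
        unfolding L_def[symmetric] by (intro vec.span_sum vec.span_scale vec.span_base imageI)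
      finally show "column c M \<in> vec.span ((\<lambda>b. axis b 1) ` first_indices r)" .
    qed
    then show ?thesis
      using interval_matching_axioms by blast
  next
    case False
    define Q where "Q p = Max {y. f y = f p}" for p
    have Q_ge: "y \<le> Q p" if "f y = f p" for y p
      unfolding Q_def using that by (intro Max_ge) auto
    have fQ: "f (Q p) = f p" for p
    proof -
      have "Q p \<in> {y. f y = f p}"
        unfolding Q_def by (intro Max_in) auto
      then show ?thesis by simp
    qed
    have QU: "Q p \<notin> L" if "p \<in> C" for p
      using Q_ge[of "inv w p" p] low[of "Q p" "inv w p"] f_inv that by (auto simp: C_def)
    have C_unique: "p = p'" if "p \<in> C" "p' \<in> C" "f p = f p'" for p p'
    proof -
      have "p \<le> p'" if p: "p \<in> C" "p' \<in> C" "f p = f p'" for p p'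
      proof -
        have "w (inv w p') < inv w p'"
          using LU[of p' "inv w p'"] p(2) by (simp add: w_inv C_def)
        then have "p \<le> p' \<or> inv w p' \<le> p"
          using cyclic_pred_less[OF f(2), of "inv w p'" p] p(3) by (simp add: w_inv f_inv)
        then show ?thesis
          using LU[of p "inv w p'"] p(1,2) by (auto simp: C_def)
      qed
      then show ?thesis
        using that by (metis antisym)
    qed
    have Q_anti: "Q p' < Q p" if p: "p \<in> C" "p' \<in> C" "p < p'" for p p'
    proof (rule ccontr)
      assume "\<not> Q p' < Q p"
      moreover have ne: "f p \<noteq> f p'"
        using C_unique[OF p(1,2)] p(3) by auto
      then have "Q p \<noteq> Q p'"
        using fQ by metis
      ultimately have "Q p < Q p'" by simp
      moreover have "p' < Q p"
        using LU QU[OF p(1)] p(2) by (auto simp: C_def)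
      ultimately show False
        using noncrossing_labellingD[OF f(1) p(3)] fQ ne by metis
    qed
    \<comment> \<open>An index \<open><= r\<close> goes to the last centre not after it, one beyond
      \<open>r\<close> to the innermost straddling block reaching it. The default is the least
      centre, that of the outermost block, which keeps \<open>\<kappa>\<close> monotone on one side
      and antitone on the other.\<close>
    define \<kappa> where "\<kappa> x = (if x \<in> L then if \<exists>p\<in>C. p \<le> x then Max {p \<in> C. p \<le> x} else Min C
        else if \<exists>p\<in>C. x \<le> Q p then Max {p \<in> C. x \<le> Q p} else Min C)" for x
    have \<kappa>_C: "\<kappa> x \<in> C" for x
    proof -
      have "Max {p \<in> C. p \<le> x} \<in> {p \<in> C. p \<le> x}" if "\<exists>p\<in>C. p \<le> x"
        using that by (intro Max_in) auto
      moreover have "Max {p \<in> C. x \<le> Q p} \<in> {p \<in> C. x \<le> Q p}" if "\<exists>p\<in>C. x \<le> Q p"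
        using that by (intro Max_in) auto
      moreover have "Min C \<in> C"
        using False by (intro Min_in) auto
      ultimately show ?thesis
        unfolding \<kappa>_def by auto
    qed
    have CL: "p \<in> L" if "p \<in> C" for p
      using that by (simp add: C_def)
    have \<kappa>_L: "\<kappa> b = i" if "b \<in> L" "i \<in> C" "i \<le> b" "\<And>p. p \<in> C \<Longrightarrow> \<not> (i < p \<and> p \<le> b)" for b i
    proof -
      have "Max {p \<in> C. p \<le> b} = i"
        using that by (intro Max_eqI) (auto simp: not_less[symmetric])
      then show ?thesis
        using that by (auto simp: \<kappa>_def)
    qed
    have \<kappa>_U: "\<kappa> d = i" if "d \<notin> L" "i \<in> C" "d \<le> Q i" "\<And>p. p \<in> C \<Longrightarrow> i < p \<Longrightarrow> Q p < d" for d i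
    proof -
      have "y \<le> i" if "y \<in> {p \<in> C. d \<le> Q p}" for y
        using that \<open>\<And>p. p \<in> C \<Longrightarrow> i < p \<Longrightarrow> Q p < d\<close>[of y] by (auto simp: not_less[symmetric])
      then have "Max {p \<in> C. d \<le> Q p} = i"
        using that by (intro Max_eqI) auto
      then show ?thesis
        using that by (auto simp: \<kappa>_def)
    qed
    have \<kappa>_fix: "\<kappa> p = p" if "p \<in> C" for p
      using that CL by (intro \<kappa>_L) auto
    have \<kappa>_Q: "\<kappa> (Q p) = p" if "p \<in> C" for p
      using that QU Q_anti by (intro \<kappa>_U) auto
    interpret interval_matching r \<kappa>
    proof
      show "r \<le> CARD('n)" by (rule rn)
      show "\<kappa> x \<in> first_indices r" for x
        using CL[OF \<kappa>_C] by (simp add: L_def)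
      show "\<kappa> (\<kappa> x) = \<kappa> x" for x
        by (rule \<kappa>_fix[OF \<kappa>_C])
      show "\<exists>d. d \<notin> first_indices r \<and> \<kappa> d = \<kappa> x" for x
        using QU[OF \<kappa>_C] \<kappa>_Q[OF \<kappa>_C] unfolding L_def by blast
    next
      fix b b' :: 'n assume b: "b \<in> first_indices r" "b' \<in> first_indices r" "b \<le> b'"
      show "\<kappa> b \<le> \<kappa> b'"
      proof (cases "\<exists>p\<in>C. p \<le> b")
        case True
        then have "Max {p \<in> C. p \<le> b} \<le> Max {p \<in> C. p \<le> b'}"
          using b(3) by (intro Max_mono) auto
        moreover have "\<exists>p\<in>C. p \<le> b'"
          using True b(3) order.trans by blast
        ultimately show ?thesis
          using True b by (simp add: \<kappa>_def L_def)
      next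
        case no: False
        then have "\<kappa> b = Min C"
          using b by (simp add: \<kappa>_def L_def)
        then show ?thesis
          using \<kappa>_C[of b'] by simp
      qed
    next
      fix d d' :: 'n assume d: "d \<notin> first_indices r" "d' \<notin> first_indices r" "d \<le> d'"
      show "\<kappa> d' \<le> \<kappa> d"
      proof (cases "\<exists>p\<in>C. d' \<le> Q p")
        case True
        then have "Max {p \<in> C. d' \<le> Q p} \<le> Max {p \<in> C. d \<le> Q p}"
          using d(3) by (intro Max_mono) auto
        moreover have "\<exists>p\<in>C. d \<le> Q p"
          using True d(3) order.trans by blast
        ultimately show ?thesis
          using True d by (simp add: \<kappa>_def L_def)
      next
        case no: False
        then have "\<kappa> d' = Min C"
          using d by (simp add: \<kappa>_def L_def)
        then show ?thesis
          using \<kappa>_C[of d] by simp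
      qed
    qed
    have fix_iff: "\<kappa> p = p \<longleftrightarrow> p \<in> C" for p
      using \<kappa>_fix \<kappa>_C by metis
    \<comment> \<open>For such i the column \<open>inv w i\<close> is among the first
      \<open>r\<close> and descends to i, so \<open>Inv_NC\<close> allows it no further entry: it is
      the unit vector at i.\<close>
    define plain where "plain = {i. i < inv w i \<and> inv w i \<in> L}"
    have plain: "i \<in> L" "i \<notin> C" if "i \<in> plain" for i
      using that low[of "inv w i" i] by (auto simp: plain_def C_def)
    \<comment> \<open>For b not in \<open>plain\<close>, the column with its 1 at the maximum of the
      block: this is b itself when the block ends within \<open>L\<close>, and \<open>Q b\<close>
      when b is a centre. Entries off the generic support are cut away; they turn out to sit at
      plain indices.\<close>
    define x where "x b = (if b \<in> plain then axis b 1
        else (\<chi> i. if i \<in> supp b then M $ i $ inv w (if b \<in> C then Q b else b) else 0))" for b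
    have self: "b \<in> supp b" for b
      by (simp add: supp_def)
    have plain_span: "v \<in> vec.span (x ` L)" if "\<And>i. v $ i \<noteq> 0 \<Longrightarrow> i \<in> plain" for v
    proof -
      have "v = (\<Sum>i\<in>plain. v $ i *s x i)"
        using that by (auto simp: vec_eq_iff sum_component axis_def x_def if_distrib cong: if_cong)
      also have "\<dots> \<in> vec.span (x ` L)"
        using plain(1) by (intro vec.span_sum vec.span_scale vec.span_base imageI)
      finally show ?thesis .
    qed
    have "flag_of M r \<in> zariski_Gr r closure_of generic_orbit"
    proof (rule flag_of_in_closure_generic_orbit[OF inv_M, of x])
      show "i \<in> supp b" if "b \<in> first_indices r" "x b $ i \<noteq> 0" for b i
        using that self[of b] by (auto simp: x_def axis_def split: if_splits)
    next
      fix c :: 'n assume "c \<in> first_indices r"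
      then have c: "c \<in> L" by (simp add: L_def)
      define j where "j = w c"
      have inv_j: "inv w j = c" and fj: "f j = f c"
        using inv_w cyclic_pred_label[OF f(2)] by (simp_all add: j_def)
      show "column c M \<in> vec.span (x ` first_indices r)"
      proof (cases "c \<le> j")
        case False
        then have "M $ i $ c = 0" if "i \<noteq> j" for i
          using Inv_NC_cases(1)[OF f M_Inv[of i c]] that unfolding j_def by auto
        moreover have "j \<in> plain"
          using False c inv_j by (simp add: plain_def)
        ultimately have "i \<in> plain" if "column c M $ i \<noteq> 0" for i
          using that by (cases "i = j") (auto simp: column_def)
        then have "column c M \<in> vec.span (x ` L)"
          by (rule plain_span)
        then show ?thesis
          by (simp add: L_def)
      next
        case cj: True
        have block: "c \<le> y \<and> y \<le> j" if "f y = f c" for y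
          using cyclic_pred_ge[OF f(2), of c y] cj that by (simp add: j_def)
        have up: "i < inv w i" if "f i = f c" "i \<noteq> j" for i
        proof (rule ccontr)
          assume "\<not> i < inv w i"
          then have "inv w i \<le> c"
            using cyclic_pred_ge[OF f(2), of "inv w i" c] that(1) by (simp add: w_inv f_inv)
          then have "inv w i = c"
            using block[of "inv w i"] that(1) f_inv by (simp add: antisym)
          then show False
            using that(2) w_inv[of i] by (simp add: j_def)
        qed
        \<comment> \<open>The index b whose vector accounts for column c, which now starts its
          block: the maximum j of the block if j is in \<open>L\<close>, otherwise the last element
          of the block in \<open>L\<close>.\<close>
        have "\<exists>b\<in>L. b \<notin> plain \<and> inv w (if b \<in> C then Q b else b) = c \<and> f b = f c \<and>
            (\<forall>i. M $ i $ c \<noteq> 0 \<and> i \<notin> supp b \<longrightarrow> i \<in> plain)"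
        proof (cases "j \<in> L")
          case True
          have jC: "j \<notin> C"
            using inv_j c by (simp add: C_def)
          have jp: "j \<notin> plain"
            using inv_j cj by (simp add: plain_def not_less)
          have "i \<in> plain" if i: "M $ i $ c \<noteq> 0" "i \<notin> supp j" for i
          proof -
            have ij: "i \<noteq> j"
              using i(2) self[of j] by auto
            then have Inv: "(i, w c) \<in> Inv_NC w"
              using M_Inv i(1) by (simp add: j_def)
            show ?thesis
            proof (cases "f i = f c")
              case True
              then have "inv w i \<in> L"
                using block[of "inv w i"] f_inv low[OF \<open>j \<in> L\<close>] by simp
              then show ?thesis
                using up[OF True ij] by (simp add: plain_def)
            next
              case ne: False
              then have ic: "i < c" "j < inv w i"
                and nc: "\<And>p x d. f x = f c \<Longrightarrow> f p = f d \<Longrightarrow> i < p \<Longrightarrow> p < x \<Longrightarrow> x < d \<Longrightarrow> f p = f i \<or> f p = f c"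
                using Inv_NC_cases(2)[OF f Inv] unfolding j_def by blast+
              have i_inv: "i < inv w i"
                using ic cj by auto
              show ?thesis
              proof (rule ccontr)
                assume "i \<notin> plain"
                then have iC: "i \<in> C"
                  using i_inv low[OF c, of i] ic(1) by (auto simp: plain_def C_def)
                \<comment> \<open>A centre between i and j would belong to a third block enclosing j
                  after i, which the merging condition forbids.\<close>
                have "\<kappa> j = i"
                proof (rule \<kappa>_L[OF True iC])
                  show "i \<le> j"
                    using ic cj by auto
                  fix p assume p: "p \<in> C"
                  show "\<not> (i < p \<and> p \<le> j)"
                  proof
                    assume o: "i < p \<and> p \<le> j"
                    then have "p < j"
                      using p jC by (metis le_less)
                    moreover have jd: "j < inv w p"
                      using LU[OF True] p by (simp add: C_def)
                    ultimately have "f p = f i \<or> f p = f c"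
                      using nc[of j p "inv w p"] o fj f_inv by simp
                    moreover have "f p \<noteq> f i"
                      using C_unique[OF p iC] o by auto
                    moreover have "f p \<noteq> f c"
                      using block[of "inv w p"] jd f_inv by (auto simp: not_less[symmetric])
                    ultimately show False by simp
                  qed
                qed
                then show False
                  using i(2) ij by (auto simp: supp_def)
              qed
            qed
          qed
          then show ?thesis
            using True jC jp inv_j fj by (intro bexI[of _ j]) auto
        next
          case jU: False
          define p where "p = Max {y \<in> L. f y = f c}"
          have "p \<in> {y \<in> L. f y = f c}"
            unfolding p_def using c by (intro Max_in) auto
          then have p: "p \<in> L" "f p = f c" by auto
          have p_max: "y \<le> p" if "y \<in> L" "f y = f c" for y
            unfolding p_def using that by (intro Max_ge) auto
          have pj: "p \<noteq> j"
            using p(1) jU by auto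
          have pC: "p \<in> C"
            using up[OF p(2) pj] p_max[of "inv w p"] p f_inv[of p] by (auto simp: C_def not_less[symmetric])
          have Qp: "Q p = j"
            using Q_ge[of j p] block[of "Q p"] fQ[of p] fj p(2) by (simp add: antisym)
          have pp: "p \<notin> plain"
            using pC by (auto simp: plain_def C_def)
          have supp_p: "supp p = {p} \<union> {d. d \<notin> L \<and> \<kappa> d = p} \<union>
              {i \<in> C. i < p \<and> (\<forall>p'\<in>C. \<not> (i < p' \<and> p' < p))}"
            using \<kappa>_fix[OF pC] unfolding supp_def fix_iff L_def by auto
          \<comment> \<open>A later centre whose block reached \<open>d\<close> would have a block
            crossing that of \<open>p\<close>.\<close>
          have U_supp: "d \<in> supp p" if d: "d \<notin> L" "f d = f c" for d
          proof -
            have "\<kappa> d = p"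
            proof (rule \<kappa>_U[OF d(1) pC])
              show "d \<le> Q p"
                unfolding Qp using block[OF d(2)] by simp
              fix p' assume p': "p' \<in> C" "p < p'"
              have ne: "f p \<noteq> f p'"
                using C_unique[OF pC p'(1)] p'(2) by auto
              show "Q p' < d"
              proof (rule ccontr)
                assume "\<not> Q p' < d"
                moreover have "Q p' \<noteq> d"
                  using fQ[of p'] ne d(2) p(2) by auto
                ultimately have "d < Q p'" by simp
                moreover have "p' < d"
                  using LU[OF CL[OF p'(1)] d(1)] .
                ultimately show False
                  using noncrossing_labellingD[OF f(1) p'(2)] fQ[of p'] ne d(2) p(2) by metis
              qed
            qed
            then show ?thesis
              using d(1) by (simp add: supp_p)
          qed
          have "i \<in> plain" if i: "M $ i $ c \<noteq> 0" "i \<notin> supp p" for i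
          proof -
            have ij: "i \<noteq> j"
              using i(2) U_supp[OF jU fj] by auto
            then have Inv: "(i, w c) \<in> Inv_NC w"
              using M_Inv i(1) by (simp add: j_def)
            show ?thesis
            proof (cases "f i = f c")
              case True
              then have iL: "i \<in> L"
                using U_supp i(2) by blast
              have "i \<notin> C"
                using C_unique[OF _ pC] True p(2) i(2) self[of p] by metis
              then show ?thesis
                using up[OF True ij] iL by (simp add: plain_def C_def)
            next
              case ne: False
              then have ic: "i < c" "j < inv w i"
                and nc: "\<And>p x d. f x = f c \<Longrightarrow> f p = f d \<Longrightarrow> i < p \<Longrightarrow> p < x \<Longrightarrow> x < d \<Longrightarrow> f p = f i \<or> f p = f c"
                using Inv_NC_cases(2)[OF f Inv] unfolding j_def by blast+
              have iC: "i \<in> C"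
                using low[OF c less_imp_le[OF ic(1)]] low[OF _ less_imp_le[OF ic(2)]] jU by (auto simp: C_def)
              have "False" if p': "p' \<in> C" "i < p'" "p' < p" for p'
              proof -
                have "p < inv w p'"
                  using LU[OF p(1)] p'(1) by (simp add: C_def)
                then have "f p' = f i \<or> f p' = f c"
                  using nc[OF p(2), of p' "inv w p'"] p' f_inv by simp
                then show False
                  using C_unique[OF p'(1) iC] C_unique[OF p'(1) pC] p' p(2) by auto
              qed
              moreover have "i < p"
                using ic(1) block[OF p(2)] by auto
              ultimately have "i \<in> supp p"
                unfolding supp_p using iC by blast
              then show ?thesis
                using i(2) by simp
            qed
          qed
          then show ?thesis
            using p pC pp Qp inv_j by (intro bexI[of _ p]) auto
        qed
        then obtain b where b: "b \<in> L" "b \<notin> plain" "inv w (if b \<in> C then Q b else b) = c"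
            "\<And>i. M $ i $ c \<noteq> 0 \<Longrightarrow> i \<notin> supp b \<Longrightarrow> i \<in> plain"
          by blast
        have "column c M - x b \<in> vec.span (x ` L)"
          by (rule plain_span) (use b in \<open>auto simp: x_def column_def split: if_splits\<close>)
        moreover have "x b \<in> vec.span (x ` L)"
          using b(1) by (intro vec.span_base imageI)
        ultimately have "column c M - x b + x b \<in> vec.span (x ` L)"
          by (rule vec.span_add)
        then show ?thesis
          by (simp add: L_def)
      qed
    qed
    then show ?thesis
      using interval_matching_axioms by blast
  qed
qed

theorem corollary9p4:
  fixes r :: nat
  assumes "1 \<le> r" and "r \<le> CARD('n::{finite,wellorder}) - 1"
  shows "\<exists>Os :: (complex ^ 'n::{finite,wellorder}) set set set.
           finite Os \<and>
           (\<forall>Ob\<in>Os. (\<exists>V\<in>Gr r. Ob = torus_orbit V) \<and>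
              krull_dim (subtopology (zariski_Gr r) Ob) = enat (CARD('n) - 1)) \<and>
           QGr r = (\<Union>Ob\<in>Os. zariski_Gr r closure_of Ob)"
proof -
  define Os :: "(complex ^ 'n::{finite,wellorder}) set set set"
    where "Os = interval_matching.generic_orbit r ` {\<kappa>. interval_matching r \<kappa>}"
  have "finite Os"
    unfolding Os_def by simp
  moreover have "(\<exists>V\<in>Gr r. Ob = torus_orbit V) \<and>
      krull_dim (subtopology (zariski_Gr r) Ob) = enat (CARD('n) - 1)" if "Ob \<in> Os" for Ob
  proof -
    obtain \<kappa> where \<kappa>: "interval_matching r \<kappa>" "Ob = interval_matching.generic_orbit r \<kappa>"
      using \<open>Ob \<in> Os\<close> unfolding Os_def by auto
    interpret interval_matching r \<kappa>
      by (rule \<kappa>(1))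
    show ?thesis
      unfolding \<kappa>(2) using base_flag_in_Gr krull_dim_generic_orbit generic_orbit_def by auto
  qed
  moreover have "QGr r = (\<Union>Ob\<in>Os. zariski_Gr r closure_of Ob)"
  proof
    show "QGr r \<subseteq> (\<Union>Ob\<in>Os. zariski_Gr r closure_of Ob)"
    proof
      fix V :: "(complex ^ 'n::{finite,wellorder}) set"
      assume "V \<in> QGr r"
      then obtain w M where "w \<in> NC" "M \<in> NC_cell_matrices w" "V = flag_of M r"
        unfolding QGr_def QFl_def NC_cell_def by auto
      then show "V \<in> (\<Union>Ob\<in>Os. zariski_Gr r closure_of Ob)"
        using flag_of_NC_cell_matrix_in_closure[OF assms] unfolding Os_def by blast
    qed
    show "(\<Union>Ob\<in>Os. zariski_Gr r closure_of Ob) \<subseteq> QGr r"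
      unfolding Os_def using interval_matching.closure_generic_orbit_subset by auto
  qed
  ultimately show ?thesis
    by (intro exI[of _ Os]) simp
qed

end
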